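(* Fix $m\ge1$. As formal power series in $x_1,x_2,\ldots$, $y_1,y_2,\ldots$, $\hat y_1,\ldots,\hat y_m$ (with $y_{\hat h}=\hat y_h$), $$\begin{aligned}\prod_{\substack{i\in\mathbb Z_{>0},\ j\in\hat{\mathcal A}\\ j\le\lambda(i)}}\frac1{1-x_iy_j}&=\left(\prod_{i,j\ge1}\frac1{1-x_iy_j}\right)\left(\prod_{\substack{1\le i,h\le m\\ i+h\le m+1}}\frac1{1-x_i\hat y_h}\right)\\&=\sum_\alpha\hat K_\alpha(x)\,F_\alpha(y,\hat y)\\&=\sum_\Lambda s_\Lambda(x;0)\,\mathfrak s^*_\Lambda(y,\hat y),\end{aligned}$$ where the first sum runs over weak compositions $\alpha$ of finite support and the second over $m$-partitions $\Lambda$.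
   Context: Alphabets: $\hat{\mathcal A}=\mathbb Z_{>0}\cup\{\hat1,\ldots,\hat m\}$ and $\hat{\mathcal A}_0=\hat{\mathcal A}\cup\{\hat0\}$ with total order $1<2<\cdots<\hat0<\hat1<\cdots<\hat m$. The letter $\hat0$ is used only as an upper bound, never as a tableau entry. The function $\lambda:\mathbb Z_{>0}\to\hat{\mathcal A}_0$ is $\lambda(i)=\widehat{m+1-i}$ for $1\le i\le m$ and $\lambda(i)=\hat0$ for $i>m$. $\operatorname{Tab}_{\mathcal B}(\nu)$ is the set of semistandard Young tableaux (English notation) of shape $\nu$ with entries in the ordered alphabet $\mathcal B$ (finitely many cells). $\operatorname{wt}(Q)$ is the content of $Q$; $\operatorname{wt}_{\mathbb Z_{>0}}(P)$ and $\operatorname{wt}_{\{\hat1,\ldots,\hat m\}}(P)$ are the contents of $P$ in the ordinary, resp. hatted, letters. $\le$ between fillings of the same shape is entrywise. Weak compositions of finite support are eventually zero sequences $\alpha=(\alpha_1,\alpha_2,\ldots)$ of nonnegative integers; $\alpha^+$ is the weakly decreasing rearrangement and $K(\alpha)$ the key tableau of shape $\alpha^+$ and content $\alpha$ (column $r$ is $\{i:\alpha_i\ge r\}$). $K_+(T)$ is the right key of $T$: let $T_r$ be the subtableau of columns of $T$ weakly right of column $r$, with reading word obtained by reading rows left to right from bottom row to top row; column $r$ of $K_+(T)$, read bottom to top, is $\sup W(T_r)$, where $W(T_r)$ is the set of strictly decreasing subwords of the reading word and $\sup$ of a set of decreasing words of maximal length $t$ is $w_1\cdots w_t$ with $w_i$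 the maximum of the $i$-th letters of its words of length $\ge i$. $\hat K_\alpha(x)$ is the Demazure atom, computed in $x_1,\ldots,x_N$ for any $N$ with $\operatorname{supp}(\alpha)\subseteq[N]$ (independent of $N$): with $\hat\pi_i=\frac{x_{i+1}}{x_i-x_{i+1}}(1-K_{i,i+1})$, $K_{i,i+1}$ exchanging $x_i$ and $x_{i+1}$, one has $\hat K_\alpha=x^\alpha$ if $\alpha$ is weakly decreasing and $\hat K_\alpha=\hat\pi_i\hat K_{s_i\alpha}$ if $\alpha_i<\alpha_{i+1}$. (Classically, $\hat K_\alpha=\sum x^{\operatorname{wt}(T)}$ over semistandard $T$ of shape $\alpha^+$ with entries in $[N]$ and $K_+(T)=K(\alpha)$.) $B_+^\lambda(\alpha)$ is the filling of shape $\alpha^+$ obtained from $K(\alpha)$ by applying $\lambda$ to all entries and reversing each column. Then $$F_\alpha(y,\hat y)=\sum_{\substack{P\in\operatorname{Tab}_{\hat{\mathcal A}}(\alpha^+)\\ K_+(P)\le B_+^\lambda(\alpha)}}y^{\operatorname{wt}_{\mathbb Z_{>0}}(P)}\,\hat y^{\operatorname{wt}_{\{\hat1,\ldots,\hat m\}}(P)}.$$ An $m$-partition is $\Lambda=(\mathbf a;\nu)$ with $\mathbf a=(a_1,\ldots,a_m)\in\mathbb N^m$ and $\nu$ a partition; $\Lambda^{(0)}$ is the partition obtained by sorting the parts of $\mathbf a$ and $\nu$. $B_+(\Lambda)$ is the filling of shape $\Lambda^{(0)}$ whose column $r$ contains the letters $\{i\in\{1,\ldots,m\}:a_i\ge r\}$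 listed increasingly from the top, followed by enough copies of $\hat0$ to fill the column. $B_+^\lambda(\Lambda)$ is obtained by applying $\lambda$ to the ordinary entries of $B_+(\Lambda)$, leaving $\hat0$ unchanged, and reversing each column. The restriction of a filling to $\{1,\ldots,m\}$ retains the positions and values of the entries in that set and ignores all others. Define $$\mathcal S(\Lambda)=\{Q\in\operatorname{Tab}_{\mathbb Z_{>0}}(\Lambda^{(0)}):K_+(Q)|_{\{1,\ldots,m\}}=B_+(\Lambda)|_{\{1,\ldots,m\}}\},$$ $$\mathcal S^*(\Lambda)=\{P\in\operatorname{Tab}_{\hat{\mathcal A}}(\Lambda^{(0)}):K_+(P)\le B_+^\lambda(\Lambda)\}.$$ The $m$-symmetric Schur functions at $t=0$ and their duals are $$s_\Lambda(x;0)=\sum_{Q\in\mathcal S(\Lambda)}x^{\operatorname{wt}(Q)},\qquad \mathfrak s^*_\Lambda(y,\hat y)=\sum_{P\in\mathcal S^*(\Lambda)}y^{\operatorname{wt}_{\mathbb Z_{>0}}(P)}\,\hat y^{\operatorname{wt}_{\{\hat1,\ldots,\hat m\}}(P)}.$$ *)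

theory Defs
  imports
    "HOL-Library.Poly_Mapping"
    "HOL-Library.Sublist"
    "HOL-Combinatorics.Transposition"
    "HOL-Analysis.Infinite_Sum"
begin

section \<open>Formal power series in arbitrarily many variables\<close>

text \<open>
  A monomial is a finitely supported exponent function \<open>'v \<Rightarrow>\<^sub>0 nat\<close>; a power series over the
  integers assigns an arbitrary coefficient to every monomial.
\<close>

typedef 'v mfps = "UNIV :: (('v \<Rightarrow>\<^sub>0 nat) \<Rightarrow> int) set"
  morphisms mcoeff Abs_mfps ..

setup_lifting type_definition_mfps

lemma mfps_eqI: "(\<And>\<mu>. mcoeff f \<mu> = mcoeff g \<mu>) \<Longrightarrow> f = g"
  by (simp add: mcoeff_inject[symmetric] fun_eq_iff)

lemma finite_splits:
  fixes \<mu> :: "'v \<Rightarrow>\<^sub>0 nat"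
  shows "finite {(a, b). a + b = \<mu>}"
proof -
  let ?F = "{f. \<forall>x. (x \<in> Poly_Mapping.keys \<mu> \<longrightarrow> f x \<in> {..Max (range (Poly_Mapping.lookup \<mu>))})
      \<and> (x \<notin> Poly_Mapping.keys \<mu> \<longrightarrow> f x = (0::nat))}"
  have finr: "finite (range (Poly_Mapping.lookup \<mu>))"
  proof (rule finite_subset)
    show "range (Poly_Mapping.lookup \<mu>)
        \<subseteq> insert 0 (Poly_Mapping.lookup \<mu> ` Poly_Mapping.keys \<mu>)"
      by (auto simp: in_keys_iff)
  qed simp
  have finF: "finite ?F"
    by (rule finite_set_of_finite_funs) auto
  have sub: "{(a, b). a + b = \<mu>} \<subseteq>
      (\<lambda>(f, g). (Abs_poly_mapping f, Abs_poly_mapping g)) ` (?F \<times> ?F)"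
  proof clarify
    fix a b :: "'v \<Rightarrow>\<^sub>0 nat"
    assume ab: "\<mu> = a + b"
    have le: "Poly_Mapping.lookup a x \<le> Poly_Mapping.lookup \<mu> x"
        "Poly_Mapping.lookup b x \<le> Poly_Mapping.lookup \<mu> x" for x
      by (simp_all add: ab lookup_add)
    have M: "Poly_Mapping.lookup \<mu> x \<le> Max (range (Poly_Mapping.lookup \<mu>))" for x
      using finr by (intro Max_ge) auto
    have z: "Poly_Mapping.lookup \<mu> x = 0" if "x \<notin> Poly_Mapping.keys \<mu>" for x
      using that by (simp add: in_keys_iff)
    have "Poly_Mapping.lookup a \<in> ?F"
      using le(1) M z by (auto intro: order_trans) (metis le_zero_eq)
    moreover have "Poly_Mapping.lookup b \<in> ?F"
      using le(2) M z by (auto intro: order_trans) (metis le_zero_eq)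
    ultimately show "(a, b) \<in> (\<lambda>(f, g). (Abs_poly_mapping f, Abs_poly_mapping g)) `
        ({f. \<forall>x. (x \<in> Poly_Mapping.keys (a + b) \<longrightarrow> f x \<in> {..Max (range (Poly_Mapping.lookup (a + b)))})
          \<and> (x \<notin> Poly_Mapping.keys (a + b) \<longrightarrow> f x = (0::nat))} \<times>
         {f. \<forall>x. (x \<in> Poly_Mapping.keys (a + b) \<longrightarrow> f x \<in> {..Max (range (Poly_Mapping.lookup (a + b)))})
          \<and> (x \<notin> Poly_Mapping.keys (a + b) \<longrightarrow> f x = (0::nat))})"
      unfolding ab[symmetric]
      by (intro image_eqI[where x = "(Poly_Mapping.lookup a, Poly_Mapping.lookup b)"])
         (simp_all add: Poly_Mapping.lookup_inverse)
  qed
  show ?thesis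
    by (rule finite_subset[OF sub]) (use finF in auto)
qed

instantiation mfps :: (type) comm_ring_1
begin

lift_definition zero_mfps :: "'a mfps" is "\<lambda>_. 0" .
lift_definition one_mfps :: "'a mfps" is "\<lambda>\<mu>. if \<mu> = 0 then 1 else 0" .
lift_definition plus_mfps :: "'a mfps \<Rightarrow> 'a mfps \<Rightarrow> 'a mfps" is "\<lambda>f g \<mu>. f \<mu> + g \<mu>" .
lift_definition minus_mfps :: "'a mfps \<Rightarrow> 'a mfps \<Rightarrow> 'a mfps" is "\<lambda>f g \<mu>. f \<mu> - g \<mu>" .
lift_definition uminus_mfps :: "'a mfps \<Rightarrow> 'a mfps" is "\<lambda>f \<mu>. - f \<mu>" .
lift_definition times_mfps :: "'a mfps \<Rightarrow> 'a mfps \<Rightarrow> 'a mfps"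
  is "\<lambda>f g \<mu>. \<Sum>(a, b) | a + b = \<mu>. f a * g b" .

instance
proof
  fix f g h :: "'a mfps"
  show "f + g + h = f + (g + h)" by transfer (simp add: fun_eq_iff)
  show "f + g = g + f" by transfer (simp add: fun_eq_iff)
  show "0 + f = f" by transfer simp
  show "- f + f = 0" by transfer simp
  show "f - g = f + - g" by transfer simp
  show "(0 :: 'a mfps) \<noteq> 1" by transfer (auto simp: fun_eq_iff)
  show "(f + g) * h = f * h + g * h"
    by transfer (simp add: fun_eq_iff case_prod_unfold distrib_right sum.distrib)
  show "f * g = g * f"
  proof (transfer, rule ext)
    fix f g :: "('a \<Rightarrow>\<^sub>0 nat) \<Rightarrow> int" and \<mu>
    show "(\<Sum>(a, b) | a + b = \<mu>. f a * g b) = (\<Sum>(a, b) | a + b = \<mu>. g a * f b)"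
      by (rule sum.reindex_bij_witness[where i = "\<lambda>(a, b). (b, a)" and j = "\<lambda>(a, b). (b, a)"])
         (auto simp: ac_simps)
  qed
  show "1 * f = f"
  proof (transfer, rule ext)
    fix f :: "('a \<Rightarrow>\<^sub>0 nat) \<Rightarrow> int" and \<mu>
    have "(\<Sum>(a, b) | a + b = \<mu>. (if a = 0 then 1 else 0) * f b)
        = (\<Sum>(a, b)\<in>{(0 :: 'a \<Rightarrow>\<^sub>0 nat, \<mu>)}. (if a = 0 then 1 else 0) * f b)"
      by (rule sum.mono_neutral_right) (use finite_splits[of \<mu>] in \<open>auto split: if_splits\<close>)
    then show "(\<Sum>(a, b) | a + b = \<mu>. (if a = 0 then 1 else 0) * f b) = f \<mu>" by simp
  qed
  show "f * g * h = f * (g * h)"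
  proof (transfer, rule ext)
    fix f g h :: "('a \<Rightarrow>\<^sub>0 nat) \<Rightarrow> int" and \<mu>
    have "(\<Sum>(p, c) | p + c = \<mu>. (\<Sum>(a, b) | a + b = p. f a * g b) * h c)
        = (\<Sum>(p, c)\<in>{(p, c). p + c = \<mu>}. \<Sum>(a, b)\<in>{(a, b). a + b = p}. f a * g b * h c)"
      by (simp add: sum_distrib_right case_prod_unfold)
    also have "\<dots> = (\<Sum>(q, s)\<in>(SIGMA q:{(p, c). p + c = \<mu>}. {(a, b). a + b = fst q}).
        f (fst s) * g (snd s) * h (snd q))"
      by (subst sum.Sigma[symmetric])
         (auto simp: finite_splits[unfolded case_prod_unfold] case_prod_unfold)
    also have "\<dots> = (\<Sum>(q, s)\<in>(SIGMA q:{(a, r). a + r = \<mu>}. {(b, c). b + c = snd q}).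
        f (fst q) * (g (fst s) * h (snd s)))"
      by (rule sum.reindex_bij_witness[
          where i = "\<lambda>((a, r), (b, c)). ((a + b, c), (a, b))"
            and j = "\<lambda>((p, c), (a, b)). ((a, b + c), (b, c))"])
         (auto simp: ac_simps)
    also have "\<dots> = (\<Sum>(a, r)\<in>{(a, r). a + r = \<mu>}.
        \<Sum>(b, c)\<in>{(b, c). b + c = r}. f a * (g b * h c))"
      by (subst sum.Sigma[symmetric])
         (auto simp: finite_splits[unfolded case_prod_unfold] case_prod_unfold)
    also have "\<dots> = (\<Sum>(a, r) | a + r = \<mu>. f a * (\<Sum>(b, c) | b + c = r. g b * h c))"
      by (simp add: sum_distrib_left case_prod_unfold)
    finally show "(\<Sum>(p, c) | p + c = \<mu>. (\<Sum>(a, b) | a + b = p. f a * g b) * h c)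
        = (\<Sum>(a, r) | a + r = \<mu>. f a * (\<Sum>(b, c) | b + c = r. g b * h c))" .
  qed
qed

end

text \<open>Inverses are unique when they exist; otherwise the value is unspecified.\<close>

instantiation mfps :: (type) inverse
begin

definition inverse_mfps :: "'a mfps \<Rightarrow> 'a mfps" where
  "inverse_mfps f = (THE g. f * g = 1)"

definition divide_mfps :: "'a mfps \<Rightarrow> 'a mfps \<Rightarrow> 'a mfps" where
  "divide_mfps f g = f * inverse g"

instance ..

end

text \<open>
  The topology of coefficientwise convergence (coefficients discrete): a neighbourhood of \<open>f\<close>
  fixes finitely many coefficients of \<open>f\<close>.
\<close>

instantiation mfps :: (type) t2_space
begin

definition open_mfps :: "'a mfps set \<Rightarrow> bool" where
  "open_mfps U \<longleftrightarrow>
    (\<forall>f\<in>U. \<exists>M. finite M \<and> (\<forall>g. (\<forall>\<mu>\<in>M. mcoeff g \<mu> = mcoeff f \<mu>) \<longrightarrow> g \<in> U))"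

instance
proof
  show "open (UNIV :: 'a mfps set)"
    unfolding open_mfps_def by blast
next
  fix U V :: "'a mfps set"
  assume U: "open U" and V: "open V"
  show "open (U \<inter> V)"
    unfolding open_mfps_def
  proof
    fix f assume f: "f \<in> U \<inter> V"
    obtain M where M: "finite M" "\<And>g. \<forall>\<mu>\<in>M. mcoeff g \<mu> = mcoeff f \<mu> \<Longrightarrow> g \<in> U"
      using U f unfolding open_mfps_def by blast
    obtain N where N: "finite N" "\<And>g. \<forall>\<mu>\<in>N. mcoeff g \<mu> = mcoeff f \<mu> \<Longrightarrow> g \<in> V"
      using V f unfolding open_mfps_def by blast
    show "\<exists>M. finite M \<and> (\<forall>g. (\<forall>\<mu>\<in>M. mcoeff g \<mu> = mcoeff f \<mu>) \<longrightarrow> g \<in> U \<inter> V)"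
      by (rule exI[of _ "M \<union> N"]) (use M N in auto)
  qed
next
  fix K :: "'a mfps set set"
  assume K: "\<forall>U\<in>K. open U"
  show "open (\<Union>K)"
    unfolding open_mfps_def
  proof
    fix f assume "f \<in> \<Union>K"
    then obtain U where U: "U \<in> K" "f \<in> U" by blast
    then obtain M where "finite M" "\<forall>g. (\<forall>\<mu>\<in>M. mcoeff g \<mu> = mcoeff f \<mu>) \<longrightarrow> g \<in> U"
      using K unfolding open_mfps_def by blast
    then show "\<exists>M. finite M \<and> (\<forall>g. (\<forall>\<mu>\<in>M. mcoeff g \<mu> = mcoeff f \<mu>) \<longrightarrow> g \<in> \<Union>K)"
      using U by blast
  qed
next
  fix f g :: "'a mfps"
  assume "f \<noteq> g"
  then obtain \<mu> where \<mu>: "mcoeff f \<mu> \<noteq> mcoeff g \<mu>" using mfps_eqI by blast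
  let ?N = "\<lambda>k. {h. mcoeff h \<mu> = mcoeff k \<mu>}"
  have o: "open (?N k)" for k :: "'a mfps"
    unfolding open_mfps_def by (auto intro!: exI[of _ "{\<mu>}"])
  show "\<exists>U V. open U \<and> open V \<and> f \<in> U \<and> g \<in> V \<and> U \<inter> V = {}"
    by (rule exI[of _ "?N f"], rule exI[of _ "?N g"]) (use o \<mu> in auto)
qed

end

definition mvar :: "'v \<Rightarrow> 'v mfps" where
  "mvar v = Abs_mfps (\<lambda>\<mu>. if \<mu> = Poly_Mapping.single v 1 then 1 else 0)"

text \<open>Unconditional convergence of a product, in analogy with \<^const>\<open>HAS_SUM\<close>.\<close>

definition has_product :: "('i \<Rightarrow> 'v mfps) \<Rightarrow> 'i set \<Rightarrow> 'v mfps \<Rightarrow> bool" where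
  "has_product f I P \<longleftrightarrow> (prod f \<longlongrightarrow> P) (finite_subsets_at_top I)"


section \<open>Letters and variables\<close>

text \<open>
  \<open>Ord i\<close> (for \<open>i \<ge> 1\<close>) is the ordinary letter \<open>i\<close>, and \<open>Hat h\<close> is the hatted letter;
  every ordinary letter is smaller than every hatted one.  \<open>Hat 0\<close> only serves as an upper bound.
\<close>

datatype letter = Ord nat | Hat nat

instantiation letter :: linorder
begin

fun less_eq_letter :: "letter \<Rightarrow> letter \<Rightarrow> bool" where
  "Ord i \<le> Ord j \<longleftrightarrow> i \<le> j"
| "Ord i \<le> Hat h \<longleftrightarrow> True"
| "Hat h \<le> Ord i \<longleftrightarrow> False"
| "Hat g \<le> Hat h \<longleftrightarrow> g \<le> h"

definition less_letter :: "letter \<Rightarrow> letter \<Rightarrow> bool" where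
  "a < b \<longleftrightarrow> a \<le> b \<and> \<not> b \<le> (a :: letter)"

instance
proof
  fix a b c :: letter
  show "a < b \<longleftrightarrow> a \<le> b \<and> \<not> b \<le> a" by (rule less_letter_def)
  show "a \<le> a" by (cases a) auto
  show "a \<le> b \<Longrightarrow> b \<le> c \<Longrightarrow> a \<le> c" by (cases a; cases b; cases c) auto
  show "a \<le> b \<Longrightarrow> b \<le> a \<Longrightarrow> a = b" by (cases a; cases b) auto
  show "a \<le> b \<or> b \<le> a" by (cases a; cases b) auto
qed

end

definition ordinary_letters :: "letter set" where
  "ordinary_letters = Ord ` {1..}"

definition hatted_letters :: "nat \<Rightarrow> letter set" where
  "hatted_letters m = Hat ` {1..m}"

definition hat_alphabet :: "nat \<Rightarrow> letter set" where
  "hat_alphabet m = ordinary_letters \<union> hatted_letters m"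

definition lam :: "nat \<Rightarrow> nat \<Rightarrow> letter" where
  "lam m i = (if i \<le> m then Hat (m + 1 - i) else Hat 0)"

datatype var = X nat | Y letter

abbreviation x_var :: "nat \<Rightarrow> var mfps" where
  "x_var i \<equiv> mvar (X i)"

abbreviation y_var :: "letter \<Rightarrow> var mfps" where
  "y_var a \<equiv> mvar (Y a)"


section \<open>Fillings and tableaux\<close>

text \<open>
  A filling is a partial function on cells (row, column), both counted from 0, in English
  notation.  Hence column \<open>c\<close> below is column \<open>c + 1\<close> in the usual count.
\<close>

type_synonym 'a filling = "nat \<times> nat \<rightharpoonup> 'a"

definition is_partition :: "nat list \<Rightarrow> bool" where
  "is_partition \<nu> \<longleftrightarrow> sorted_wrt (\<ge>) \<nu> \<and> 0 \<notin> set \<nu>"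

definition diagram :: "nat list \<Rightarrow> (nat \<times> nat) set" where
  "diagram \<nu> = {(r, c). r < length \<nu> \<and> c < \<nu> ! r}"

definition Tab :: "'a::linorder set \<Rightarrow> nat list \<Rightarrow> 'a filling set" where
  "Tab B \<nu> = {T. dom T = diagram \<nu> \<and> ran T \<subseteq> B \<and>
     (\<forall>r c c'. c < c' \<longrightarrow> (r, c) \<in> dom T \<longrightarrow> (r, c') \<in> dom T \<longrightarrow> the (T (r, c)) \<le> the (T (r, c'))) \<and>
     (\<forall>r r' c. r < r' \<longrightarrow> (r, c) \<in> dom T \<longrightarrow> (r', c) \<in> dom T \<longrightarrow> the (T (r, c)) < the (T (r', c)))}"

definition filling_le :: "'a::linorder filling \<Rightarrow> 'a filling \<Rightarrow> bool" where
  "filling_le T U \<longleftrightarrow> dom T = dom U \<and> (\<forall>p\<in>dom T. the (T p) \<le> the (U p))"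

definition content :: "'a filling \<Rightarrow> 'a \<Rightarrow> nat" where
  "content T a = card {p. T p = Some a}"

definition content_monomial :: "('a \<Rightarrow> var mfps) \<Rightarrow> 'a set \<Rightarrow> 'a filling \<Rightarrow> var mfps" where
  "content_monomial z S T = (\<Prod>a\<in>ran T \<inter> S. z a ^ content T a)"

definition map_filling :: "('a \<Rightarrow> 'b) \<Rightarrow> 'a filling \<Rightarrow> 'b filling" where
  "map_filling f T = (\<lambda>p. map_option f (T p))"

definition restrict_filling :: "'a set \<Rightarrow> 'a filling \<Rightarrow> 'a filling" where
  "restrict_filling S T = (\<lambda>p. case T p of None \<Rightarrow> None | Some a \<Rightarrow> if a \<in> S then Some a else None)"

definition filling_of_columns :: "(nat \<Rightarrow> 'a list) \<Rightarrow> 'a filling" where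
  "filling_of_columns w = (\<lambda>(r, c). if r < length (w c) then Some (w c ! r) else None)"

definition column :: "'a filling \<Rightarrow> nat \<Rightarrow> 'a list" where
  "column T c = map (\<lambda>r. the (T (r, c))) (sorted_list_of_set {r. (r, c) \<in> dom T})"

definition reverse_columns :: "'a filling \<Rightarrow> 'a filling" where
  "reverse_columns T = filling_of_columns (\<lambda>c. rev (column T c))"


section \<open>Right keys\<close>

text \<open>The reading word of the columns of \<open>T\<close> weakly right of column \<open>c0\<close>, from the bottom row up.\<close>

definition reading_word :: "'a filling \<Rightarrow> nat \<Rightarrow> 'a list" where
  "reading_word T c0 = concat (map
     (\<lambda>r. map (\<lambda>c. the (T (r, c))) (sorted_list_of_set {c. c0 \<le> c \<and> (r, c) \<in> dom T}))
     (rev (sorted_list_of_set (fst ` dom T))))"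

definition decreasing_subwords :: "'a::linorder list \<Rightarrow> 'a list set" where
  "decreasing_subwords u = {w. subseq w u \<and> sorted_wrt (>) w}"

definition sup_words :: "'a::linorder list set \<Rightarrow> 'a list" where
  "sup_words W = map (\<lambda>i. Max {w ! i |w. w \<in> W \<and> i < length w}) [0..<Max (length ` W)]"

definition right_key :: "'a::linorder filling \<Rightarrow> 'a filling" where
  "right_key T = filling_of_columns (\<lambda>c. rev (sup_words (decreasing_subwords (reading_word T c))))"


section \<open>Weak compositions and the series indexed by them\<close>

text \<open>Compositions are indexed by the positive integers; the exponent at 0 is a dummy.\<close>

definition weak_compositions :: "(nat \<Rightarrow>\<^sub>0 nat) set" where
  "weak_compositions = {\<alpha>. Poly_Mapping.lookup \<alpha> 0 = 0}"

definition sorted_composition :: "(nat \<Rightarrow>\<^sub>0 nat) \<Rightarrow> nat list" where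
  "sorted_composition \<alpha> = rev (sorted_list_of_multiset
     (image_mset (Poly_Mapping.lookup \<alpha>) (mset_set (Poly_Mapping.keys \<alpha>))))"

definition key_tableau :: "(nat \<Rightarrow>\<^sub>0 nat) \<Rightarrow> nat filling" where
  "key_tableau \<alpha> =
     filling_of_columns (\<lambda>c. sorted_list_of_set {i. c + 1 \<le> Poly_Mapping.lookup \<alpha> i})"

type_synonym xpoly = "(nat \<Rightarrow>\<^sub>0 nat) \<Rightarrow>\<^sub>0 int"

definition pvar :: "nat \<Rightarrow> xpoly" where
  "pvar i = Poly_Mapping.single (Poly_Mapping.single i 1) 1"

definition swap_exponents :: "nat \<Rightarrow> (nat \<Rightarrow>\<^sub>0 nat) \<Rightarrow> (nat \<Rightarrow>\<^sub>0 nat)" where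
  "swap_exponents i \<alpha> = Poly_Mapping.map_key (Transposition.transpose i (i + 1)) \<alpha>"

definition swap_vars :: "nat \<Rightarrow> xpoly \<Rightarrow> xpoly" where
  "swap_vars i f = Poly_Mapping.map_key (swap_exponents i) f"

text \<open>
  The operator \<open>x\<^sub>i\<^sub>+\<^sub>1 / (x\<^sub>i - x\<^sub>i\<^sub>+\<^sub>1) (1 - K\<^sub>i\<^sub>,\<^sub>i\<^sub>+\<^sub>1)\<close>.  The quotient is again a polynomial, and it is
  unique since the polynomial ring is an integral domain.
\<close>

definition pi_hat :: "nat \<Rightarrow> xpoly \<Rightarrow> xpoly" where
  "pi_hat i f = (THE g. (pvar i - pvar (i + 1)) * g = pvar (i + 1) * (f - swap_vars i f))"

inductive atom_rel :: "(nat \<Rightarrow>\<^sub>0 nat) \<Rightarrow> xpoly \<Rightarrow> bool" where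
  decreasing: "(\<And>i. i \<ge> 1 \<Longrightarrow> Poly_Mapping.lookup \<alpha> (i + 1) \<le> Poly_Mapping.lookup \<alpha> i) \<Longrightarrow>
     atom_rel \<alpha> (Poly_Mapping.single \<alpha> 1)"
| ascent: "i \<ge> 1 \<Longrightarrow> Poly_Mapping.lookup \<alpha> i < Poly_Mapping.lookup \<alpha> (i + 1) \<Longrightarrow>
     atom_rel (swap_exponents i \<alpha>) f \<Longrightarrow> atom_rel \<alpha> (pi_hat i f)"

text \<open>The recursion does not depend on the choice of ascents, so each \<open>\<alpha>\<close> has exactly one atom.\<close>

definition demazure_atom :: "(nat \<Rightarrow>\<^sub>0 nat) \<Rightarrow> xpoly" where
  "demazure_atom \<alpha> = (THE f. atom_rel \<alpha> f)"

definition series_of_xpoly :: "xpoly \<Rightarrow> var mfps" where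
  "series_of_xpoly p = (\<Sum>\<mu>\<in>Poly_Mapping.keys p. of_int (Poly_Mapping.lookup p \<mu>) *
     (\<Prod>i\<in>Poly_Mapping.keys \<mu>. x_var i ^ Poly_Mapping.lookup \<mu> i))"

definition B_plus_lam_comp :: "nat \<Rightarrow> (nat \<Rightarrow>\<^sub>0 nat) \<Rightarrow> letter filling" where
  "B_plus_lam_comp m \<alpha> = reverse_columns (map_filling (lam m) (key_tableau \<alpha>))"

definition F_series :: "nat \<Rightarrow> (nat \<Rightarrow>\<^sub>0 nat) \<Rightarrow> var mfps" where
  "F_series m \<alpha> =
     (\<Sum>\<^sub>\<infinity>P\<in>{P \<in> Tab (hat_alphabet m) (sorted_composition \<alpha>).
            filling_le (right_key P) (B_plus_lam_comp m \<alpha>)}.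
        content_monomial y_var ordinary_letters P * content_monomial y_var (hatted_letters m) P)"


section \<open>\<open>m\<close>-partitions and the \<open>m\<close>-symmetric Schur functions at \<open>t = 0\<close>\<close>

type_synonym mpartition = "nat list \<times> nat list"

definition mpartitions :: "nat \<Rightarrow> mpartition set" where
  "mpartitions m = {(a, \<nu>). length a = m \<and> is_partition \<nu>}"

definition mp_shape :: "mpartition \<Rightarrow> nat list" where
  "mp_shape \<Lambda> = rev (sort (filter (\<lambda>p. p \<noteq> 0) (fst \<Lambda> @ snd \<Lambda>)))"

definition B_plus :: "nat \<Rightarrow> mpartition \<Rightarrow> letter filling" where
  "B_plus m \<Lambda> = filling_of_columns (\<lambda>c.
     let w = map Ord (sorted_list_of_set {i \<in> {1..m}. c + 1 \<le> fst \<Lambda> ! (i - 1)})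
     in w @ replicate (card {r. (r, c) \<in> diagram (mp_shape \<Lambda>)} - length w) (Hat 0))"

definition B_plus_lam :: "nat \<Rightarrow> mpartition \<Rightarrow> letter filling" where
  "B_plus_lam m \<Lambda> = reverse_columns
     (map_filling (\<lambda>a. case a of Ord i \<Rightarrow> lam m i | Hat h \<Rightarrow> Hat h) (B_plus m \<Lambda>))"

definition S_set :: "nat \<Rightarrow> mpartition \<Rightarrow> nat filling set" where
  "S_set m \<Lambda> = {Q \<in> Tab {1..} (mp_shape \<Lambda>).
     restrict_filling (Ord ` {1..m}) (map_filling Ord (right_key Q))
       = restrict_filling (Ord ` {1..m}) (B_plus m \<Lambda>)}"

definition S_star_set :: "nat \<Rightarrow> mpartition \<Rightarrow> letter filling set" where
  "S_star_set m \<Lambda> = {P \<in> Tab (hat_alphabet m) (mp_shape \<Lambda>).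
     filling_le (right_key P) (B_plus_lam m \<Lambda>)}"

definition m_schur :: "nat \<Rightarrow> mpartition \<Rightarrow> var mfps" where
  "m_schur m \<Lambda> = (\<Sum>\<^sub>\<infinity>Q\<in>S_set m \<Lambda>. content_monomial x_var UNIV Q)"

definition dual_m_schur :: "nat \<Rightarrow> mpartition \<Rightarrow> var mfps" where
  "dual_m_schur m \<Lambda> = (\<Sum>\<^sub>\<infinity>P\<in>S_star_set m \<Lambda>.
     content_monomial y_var ordinary_letters P * content_monomial y_var (hatted_letters m) P)"

end

theory Submission
  imports Defs
begin

text \<open>
  Row insertion (RSK) turns a finite multiset of pairs \<open>(i, j)\<close> into a pair \<open>(Q, P)\<close> of tableaux of the
  same shape.  The lengths of longest decreasing subwords in tails of the reading words determine the
  right keys, and following them through one insertion shows that all pairs satisfy \<open>j \<le> \<lambda>(i)\<close> if and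
  only if \<open>K\<^sub>+(P)\<close> is bounded by the \<open>\<lambda>\<close>-image of \<open>K\<^sub>+(Q)\<close> with columns reversed.  This holds for every
  antitone \<open>\<lambda>\<close>.  Grouping the pairs \<open>(Q, P)\<close> by the content \<open>\<alpha>\<close> of \<open>K\<^sub>+(Q)\<close> gives the first sum, and
  grouping them by the \<open>m\<close>-partition \<open>(\<alpha>\<^sub>1, \<dots>, \<alpha>\<^sub>m; \<nu>)\<close> gives the second.

  It remains to see that the generating function \<open>A\<^sub>\<alpha>\<close> of the \<open>Q\<close> with \<open>K\<^sub>+(Q) = K(\<alpha>)\<close> is the Demazure
  atom.  The same correspondence is applied to staircases \<open>i + j \<le> n + 1\<close>: adding one cell makes rows
  \<open>i\<close> and \<open>i + 1\<close> equal, so that the kernel becomes symmetric in \<open>x\<^sub>i\<close> and the next variable.  Since the \<open>y\<close>-coefficients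
  for distinct \<open>\<alpha>\<close> are linearly independent, comparing expansions yields the recursion of the atoms
  under the divided difference operators.
\<close>

section \<open>Longest strictly decreasing subwords\<close>

text \<open>For antitone \<open>l\<close>, the bound \<open>j \<le> l i\<close> means that the pairs
  avoid every quadrant \<open>a \<le> i\<close>, \<open>b \<le> j\<close> with
  \<open>l a < b\<close>. Each quadrant is tested by itself: for fixed \<open>a\<close> and
  \<open>b\<close> only two integers per column have to be followed, never a key as a tableau. Up to
  the column of the new cell, an insertion into \<open>P\<close> amounts to appending a letter,
  modulo an equivalence that preserves chain lengths. The obstacle lies right of that column, where
  one letter leaves the reading word and the equivalence breaks down. There the change of one count
  is compensated by an inequality at the new column; without it a violated bound could be repaired
  by a later insertion.

  The atoms are given by operators, so their description by keys has to be proved along the way. One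
  theorem, applied to a region and to the same region with one more cell, gives two expansions in
  the \<open>A_\<alpha>\<close>. Their coefficients count tableaux \<open>P\<close>, and
  independence is triangularity with respect to partial sums of compositions, with reversed key
  tableaux on the diagonal.\<close>

definition upset :: "'a::linorder set \<Rightarrow> bool" where
  "upset U \<longleftrightarrow> (\<forall>x\<in>U. \<forall>y\<ge>x. y \<in> U)"

lemma upset_atLeast [simp]: "upset {v..}" and upset_greaterThan [simp]: "upset {v<..}"
  and upset_UNIV [simp]: "upset UNIV"
  by (auto simp: upset_def)

text \<open>The set argument lets the recursion confine the rest of a chain to letters below its
  first one. Later uses take upper sets, since the number of key letters above a threshold is all
  that is ever compared.\<close>

fun dec_len :: "'a::linorder set \<Rightarrow> 'a list \<Rightarrow> nat" where
  "dec_len U [] = 0"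
| "dec_len U (x # w) =
    (if x \<in> U then max (dec_len U w) (Suc (dec_len (U \<inter> {..<x}) w)) else dec_len U w)"

lemma dec_len_witness:
  "\<exists>s. subseq s w \<and> sorted_wrt (>) s \<and> set s \<subseteq> U \<and> length s = dec_len U w"
proof (induction w arbitrary: U)
  case (Cons x w)
  obtain s where s: "subseq s w" "sorted_wrt (>) s" "set s \<subseteq> U" "length s = dec_len U w"
    using Cons by blast
  obtain t where t: "subseq t w" "sorted_wrt (>) t" "set t \<subseteq> U \<inter> {..<x}"
      "length t = dec_len (U \<inter> {..<x}) w"
    using Cons by blast
  show ?case
  proof (cases "x \<in> U \<and> dec_len U w < Suc (dec_len (U \<inter> {..<x}) w)")
    case True
    then show ?thesis using t by (intro exI[of _ "x # t"]) auto
  next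
    case False
    then show ?thesis using s by (intro exI[of _ s]) auto
  qed
qed simp

lemma dec_len_ge:
  "subseq s w \<Longrightarrow> sorted_wrt (>) s \<Longrightarrow> set s \<subseteq> U \<Longrightarrow> length s \<le> dec_len U w"
proof (induction w arbitrary: s U)
  case (Cons x w)
  show ?case
  proof (cases s)
    case (Cons y t)
    show ?thesis
    proof (cases "y = x \<and> subseq t w")
      case True
      have "length t \<le> dec_len (U \<inter> {..<x}) w"
        using True Cons Cons.prems by (intro Cons.IH) auto
      then show ?thesis using True Cons Cons.prems by auto
    next
      case False
      then have "subseq s w" using Cons Cons.prems by (auto simp: subseq_Cons2_iff split: if_splits)
      then have "length s \<le> dec_len U w" using Cons.IH Cons.prems by blast
      then show ?thesis by auto
    qed
  qed simp
qed simp

lemma dec_len_mono: "subseq u w \<Longrightarrow> U \<subseteq> V \<Longrightarrow> dec_len U u \<le> dec_len V w"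
  by (metis dec_len_ge dec_len_witness subseq_order.trans subset_trans)

lemma dec_len_cong: "U \<inter> set w = V \<inter> set w \<Longrightarrow> dec_len U w = dec_len V w"
proof (induction w arbitrary: U V)
  case (Cons x w)
  have "U \<inter> set w = V \<inter> set w" "x \<in> U \<longleftrightarrow> x \<in> V"
    "U \<inter> {..<x} \<inter> set w = V \<inter> {..<x} \<inter> set w"
    using Cons.prems by auto
  then show ?case using Cons.IH[of U V] Cons.IH[of "U \<inter> {..<x}" "V \<inter> {..<x}"] by simp
qed simp

text \<open>The mirror image of the defining recursion, with the last letter cut off.
  \<open>key_step\<close> consumes a word in this direction, and so does row insertion.\<close>

lemma dec_len_snoc:
  "dec_len U (w @ [x]) =
    (if x \<in> U then max (dec_len U w) (Suc (dec_len (U \<inter> {x<..}) w)) else dec_len U w)"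
proof (induction w arbitrary: U)
  case (Cons a w)
  have "dec_len (U \<inter> {..<a} \<inter> {x<..}) w = dec_len (U \<inter> {x<..} \<inter> {..<a}) w"
    by (simp add: Int_ac)
  then show ?case by (auto simp: Cons max_def)
qed simp

lemma dec_len_snoc_notin: "x \<notin> U \<Longrightarrow> dec_len U (w @ [x]) = dec_len U w"
  by (simp add: dec_len_snoc)

lemma sorted_subseq_length:
  assumes "subseq s w" "sorted (w :: 'a::linorder list)" "sorted_wrt (>) s"
  shows "length s \<le> 1"
proof (rule ccontr)
  assume "\<not> length s \<le> 1"
  then obtain x y t where s: "s = x # y # t" by (cases s; cases "tl s") auto
  have "sorted s" using assms(1,2) by (metis sorted_nths subseq_conv_nths)
  then show False using s assms(3) by auto
qed

text \<open>Keeping the replacement between \<open>last m\<close> and \<open>hd m\<close> allows it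
  to be spliced into a longer chain in place of \<open>m\<close>: both seams stay strictly
  decreasing, and an upper set that contains \<open>m\<close> also contains the replacement.\<close>

definition word_le :: "'a::linorder list \<Rightarrow> 'a list \<Rightarrow> bool" where
  "word_le u v \<longleftrightarrow> (\<forall>m. subseq m u \<longrightarrow> sorted_wrt (>) m \<longrightarrow> m \<noteq> [] \<longrightarrow>
     (\<exists>m'. subseq m' v \<and> sorted_wrt (>) m' \<and> length m' = length m \<and>
       (\<forall>z\<in>set m'. last m \<le> z \<and> z \<le> hd m)))"

lemma last_least_dec: "sorted_wrt (>) (m :: 'a::linorder list) \<Longrightarrow> z \<in> set m \<Longrightarrow> last m \<le> z"
proof (induction m)
  case (Cons a m)
  then show ?case using last_in_set[of m] by (auto intro: less_imp_le)
qed simp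

lemma word_le_dec_len:
  assumes "word_le u v" "upset U"
  shows "dec_len U (p @ u @ s) \<le> dec_len U (p @ v @ s)"
proof -
  obtain t where t: "subseq t (p @ u @ s)" "sorted_wrt (>) t" "set t \<subseteq> U"
      "length t = dec_len U (p @ u @ s)"
    using dec_len_witness by blast
  obtain t1 m t3 where tt: "t = t1 @ m @ t3" "subseq t1 p" "subseq m u" "subseq t3 s"
    using t(1) by (metis subseq_appendE)
  show ?thesis
  proof (cases "m = []")
    case True
    then have "subseq t (p @ v @ s)" using tt
      by (metis append_Nil list_emb_append_mono list_emb_append2)
    then show ?thesis using t dec_len_ge by metis
  next
    case False
    have srt: "sorted_wrt (>) t1" "sorted_wrt (>) m" "sorted_wrt (>) t3"
        "\<And>a b. a \<in> set t1 \<Longrightarrow> b \<in> set m \<Longrightarrow> b < a" "\<And>a b. a \<in> set m \<Longrightarrow> b \<in> set t3 \<Longrightarrow> b < a"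
        "\<And>a b. a \<in> set t1 \<Longrightarrow> b \<in> set t3 \<Longrightarrow> b < a"
      using t(2) unfolding tt(1) by (auto simp: sorted_wrt_append)
    then obtain m' where m': "subseq m' v" "sorted_wrt (>) m'" "length m' = length m"
        "\<forall>z\<in>set m'. last m \<le> z \<and> z \<le> hd m"
      using assms(1) False tt(3) unfolding word_le_def by blast
    have lm: "last m \<in> set m" "hd m \<in> set m" using False by auto
    have "subseq (t1 @ m' @ t3) (p @ v @ s)"
      using tt m' by (intro list_emb_append_mono) auto
    moreover have "sorted_wrt (>) (t1 @ m' @ t3)"
      using srt m'(2,4) lm unfolding sorted_wrt_append
      by (metis Un_iff order_le_less_trans order_less_le_trans set_append)
    moreover have "set (t1 @ m' @ t3) \<subseteq> U"
    proof -
      have "last m \<in> U" using lm tt(1) t(3) by auto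
      then have "set m' \<subseteq> U" using m'(4) assms(2) by (auto simp: upset_def)
      then show ?thesis using t(3) tt(1) by auto
    qed
    ultimately have "length (t1 @ m' @ t3) \<le> dec_len U (p @ v @ s)" by (rule dec_len_ge)
    then show ?thesis using t(4) tt(1) m'(3) by simp
  qed
qed

text \<open>Stands in for Knuth equivalence: quantifying over contexts makes it a congruence for
  concatenation, and it preserves every count from which the right key is recovered.\<close>

definition word_equiv :: "'a::linorder list \<Rightarrow> 'a list \<Rightarrow> bool" where
  "word_equiv u v \<longleftrightarrow> (\<forall>p s U. upset U \<longrightarrow> dec_len U (p @ u @ s) = dec_len U (p @ v @ s))"

lemma word_equivI: "word_le u v \<Longrightarrow> word_le v u \<Longrightarrow> word_equiv u v"
  unfolding word_equiv_def by (metis antisym word_le_dec_len)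

lemma word_equiv_refl [simp]: "word_equiv u u"
  and word_equiv_trans: "word_equiv u v \<Longrightarrow> word_equiv v w \<Longrightarrow> word_equiv u w"
  and word_equiv_sym: "word_equiv u v \<Longrightarrow> word_equiv v u"
  by (simp_all add: word_equiv_def)

lemma word_equiv_append: "word_equiv u v \<Longrightarrow> word_equiv (p @ u @ s) (p @ v @ s)"
  unfolding word_equiv_def by (metis append.assoc)

lemma word_equiv_dec_len: "word_equiv u v \<Longrightarrow> upset U \<Longrightarrow> dec_len U u = dec_len U v"
  unfolding word_equiv_def by (metis append_Nil append_Nil2)

text \<open>The Knuth relations behind one step of row insertion: \<open>x\<close> bumps \<open>y\<close> from the row.\<close>

lemma row_bump_equiv:
  assumes srt: "sorted (A @ y # B)" and A: "\<forall>a\<in>set A. a \<le> x" and xy: "(x :: 'a::linorder) < y"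
  shows "word_equiv ((A @ y # B) @ [x]) (y # A @ x # B)"
proof (rule word_equivI)
  have B: "\<forall>b\<in>set B. y \<le> b" using srt by (auto simp: sorted_append)
  have srt': "sorted (A @ x # B)" using srt A B xy by (auto simp: sorted_append)
  have sub: "subseq [z] l" if "z \<in> set l" for z :: 'a and l
    using that by (simp add: subseq_singleton_left)
  have sub1: "subseq [y, x] ((A @ y # B) @ [x])" "subseq [y, x] (y # A @ x # B)"
    by (auto simp: subseq_singleton_left list_emb_append2 intro: list_emb_append2)
  show "word_le ((A @ y # B) @ [x]) (y # A @ x # B)"
    unfolding word_le_def
  proof (intro allI impI)
    fix m assume m: "subseq m ((A @ y # B) @ [x])" "sorted_wrt (>) m" "m \<noteq> []"
    then obtain m1 m2 where mm: "m = m1 @ m2" "subseq m1 (A @ y # B)" "subseq m2 [x]"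
      by (metis subseq_appendE)
    have l1: "length m1 \<le> 1"
      using sorted_subseq_length[OF mm(2) srt] m(2) mm(1) by (auto simp: sorted_wrt_append)
    have m2: "m2 = [] \<or> m2 = [x]" using mm(3) by (cases m2) (auto simp: subseq_Cons2_iff split: if_splits)
    show "\<exists>m'. subseq m' (y # A @ x # B) \<and> sorted_wrt (>) m' \<and> length m' = length m \<and>
       (\<forall>z\<in>set m'. last m \<le> z \<and> z \<le> hd m)"
    proof (cases m1)
      case Nil
      then have "m = [x]" using m2 mm m(3) by auto
      then show ?thesis using sub by (intro exI[of _ "[x]"]) auto
    next
      case (Cons c r)
      then have m1: "m1 = [c]" using l1 by simp
      have c: "c \<in> set (A @ y # B)" using mm(2) m1 by (simp add: subseq_singleton_left)
      show ?thesis
      proof (cases "m2 = []")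
        case True
        then have "m = [c]" using mm m1 by simp
        then show ?thesis using sub c by (intro exI[of _ "[c]"]) auto
      next
        case False
        \<comment> \<open>A descent from the row to \<open>x\<close> starts at an entry
          \<open>c \<ge> y\<close>, so \<open>y > x\<close> lies in its interval, and this pair is a
          subword on both sides.\<close>
        then have meq: "m = [c, x]" using m2 mm m1 by simp
        then have "x < c" using m(2) by simp
        then have "y \<le> c" using c A B by auto
        then show ?thesis using meq xy sub1 by (intro exI[of _ "[y, x]"]) auto
      qed
    qed
  qed
  show "word_le (y # A @ x # B) ((A @ y # B) @ [x])"
    unfolding word_le_def
  proof (intro allI impI)
    fix m assume m: "subseq m (y # A @ x # B)" "sorted_wrt (>) m" "m \<noteq> []"
    have "subseq m ([y] @ (A @ x # B))" using m(1) by simp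
    then obtain m1 m2 where mm: "m = m1 @ m2" "subseq m1 [y]" "subseq m2 (A @ x # B)"
      by (metis subseq_appendE)
    have l2: "length m2 \<le> 1"
      using sorted_subseq_length[OF mm(3) srt'] m(2) mm(1) by (auto simp: sorted_wrt_append)
    have m1: "m1 = [] \<or> m1 = [y]" using mm(2) by (cases m1) (auto simp: subseq_Cons2_iff split: if_splits)
    show "\<exists>m'. subseq m' ((A @ y # B) @ [x]) \<and> sorted_wrt (>) m' \<and> length m' = length m \<and>
       (\<forall>z\<in>set m'. last m \<le> z \<and> z \<le> hd m)"
    proof (cases m2)
      case Nil
      then have "m = [y]" using m1 mm m(3) by auto
      then show ?thesis using sub by (intro exI[of _ "[y]"]) auto
    next
      case (Cons c r)
      then have m2: "m2 = [c]" using l2 by simp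
      have c: "c \<in> set (A @ x # B)" using mm(3) m2 by (simp add: subseq_singleton_left)
      show ?thesis
      proof (cases "m1 = []")
        case True
        then have "m = [c]" using mm m2 by simp
        then show ?thesis using sub c by (intro exI[of _ "[c]"]) auto
      next
        case False
        then have meq: "m = [y, c]" using m1 mm m2 by simp
        then have "c < y" using m(2) by simp
        then have "c \<le> x" using c A B by auto
        then show ?thesis using meq xy sub1 by (intro exI[of _ "[y, x]"]) auto
      qed
    qed
  qed
qed

text \<open>Recursive form of \<open>sup W(w)\<close>, as a set: a new letter \<open>x\<close> replaces the largest letter \<open>\<le> x\<close>, or is
  added when there is none.\<close>

definition key_step :: "'a::linorder set \<Rightarrow> 'a \<Rightarrow> 'a set" where
  "key_step S x = insert x {s \<in> S. x < s \<or> (\<exists>t\<in>S. s < t \<and> t \<le> x)}"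

definition key_set :: "'a::linorder list \<Rightarrow> 'a set" where
  "key_set w = foldl key_step {} w"

lemma key_set_Nil [simp]: "key_set [] = {}"
  and key_set_snoc: "key_set (w @ [x]) = key_step (key_set w) x"
  by (simp_all add: key_set_def)

lemma key_set_subset: "key_set w \<subseteq> set w"
proof (induction w rule: rev_induct)
  case (snoc x w) then show ?case unfolding key_set_snoc key_step_def by auto
qed simp

lemma finite_key_set [simp]: "finite (key_set w)"
  by (rule finite_subset[OF key_set_subset]) simp

text \<open>If \<open>S\<close> has a letter of \<open>U\<close> that is \<open>\<le> x\<close>,
  then \<open>x\<close> takes the place of the largest such letter and the count in \<open>U\<close>
  stays. Otherwise the letters of \<open>S\<close> in \<open>U\<close> are just those above
  \<open>x\<close>, and \<open>x\<close> is added to them. The maximum covers both cases and has the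
  shape of \<open>dec_len_snoc\<close>.\<close>

lemma card_key_step:
  assumes "finite S" "upset U"
  shows "card (key_step S x \<inter> U) =
    (if x \<in> U then max (card (S \<inter> U)) (Suc (card (S \<inter> {x<..}))) else card (S \<inter> U))"
proof (cases "x \<in> U")
  case False
  then have "key_step S x \<inter> U = S \<inter> U"
    using assms(2) unfolding key_step_def upset_def by (auto simp: not_le)
  then show ?thesis using False by simp
next
  case True
  have sub: "{x<..} \<subseteq> U" using True assms(2) by (auto simp: upset_def)
  let ?L = "{s\<in>S. s \<in> U \<and> s \<le> x}"
  have SU: "S \<inter> U = (S \<inter> {x<..}) \<union> ?L" using sub by auto
  have cSU: "card (S \<inter> U) = card (S \<inter> {x<..}) + card ?L"
    unfolding SU using assms(1) by (intro card_Un_disjoint) auto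
  show ?thesis
  proof (cases "?L = {}")
    case True
    have "key_step S x \<inter> U = insert x (S \<inter> {x<..})"
    proof -
      have "s \<notin> U" if "s \<in> S" "s \<le> x" for s using True that by auto
      moreover have "t \<in> U" if "s \<in> U" "s < t" for s t using that assms(2) by (auto simp: upset_def)
      ultimately show ?thesis using \<open>x \<in> U\<close> sub unfolding key_step_def by auto
    qed
    then show ?thesis using \<open>x \<in> U\<close> assms(1) cSU True by simp
  next
    case False
    define M where "M = Max ?L"
    have fin: "finite ?L" using assms(1) by simp
    have M: "M \<in> ?L" "\<And>s. s \<in> ?L \<Longrightarrow> s \<le> M"
      unfolding M_def using Max_in[OF fin False] Max_ge[OF fin] by auto
    have maxS: "s \<le> M" if "s \<in> S" "s \<le> x" for s
    proof (cases "s \<in> U")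
      case True
      then show ?thesis using M(2) that by simp
    next
      case False
      then have "\<not> M \<le> s" using M(1) assms(2) by (auto simp: upset_def)
      then show ?thesis by simp
    qed
    have eq: "key_step S x \<inter> U = insert x (S \<inter> U - {M})"
    proof (intro set_eqI)
      fix s
      have "(\<exists>t\<in>S. s < t \<and> t \<le> x) \<longleftrightarrow> s \<noteq> M" if "s \<in> S" "s \<in> U" "\<not> x < s"
      proof
        assume "\<exists>t\<in>S. s < t \<and> t \<le> x"
        then obtain t where "t \<in> S" "s < t" "t \<le> x" by blast
        then show "s \<noteq> M" using maxS[of t] by auto
      next
        assume "s \<noteq> M"
        then have "s < M" using maxS[of s] that by (simp add: not_less)
        then show "\<exists>t\<in>S. s < t \<and> t \<le> x" using M(1) by blast
      qed
      moreover have "s \<noteq> M" if "x < s" using that M by auto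
      ultimately show "s \<in> key_step S x \<inter> U \<longleftrightarrow> s \<in> insert x (S \<inter> U - {M})"
        using \<open>x \<in> U\<close> unfolding key_step_def by auto
    qed
    have "x \<notin> S \<inter> U - {M}" using maxS[of x] M(1) by (auto intro: antisym)
    then have "card (insert x (S \<inter> U - {M})) = Suc (card (S \<inter> U - {M}))"
      using assms(1) by (intro card_insert_disjoint) auto
    also have "\<dots> = card (S \<inter> U)"
      using assms(1) M(1) by (intro card_Suc_Diff1) auto
    finally have "card (insert x (S \<inter> U - {M})) = card (S \<inter> U)" .
    moreover have "card ?L > 0" using False fin by (simp add: card_gt_0_iff)
    ultimately show ?thesis using \<open>x \<in> U\<close> cSU eq by simp
  qed
qed

text \<open>Both sides obey the same recursion in the last letter. One set thus encodes the longest
  chain lengths for all upper sets at once, and every statement on right keys below passes through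
  this equation.\<close>

lemma card_key_set: "upset U \<Longrightarrow> card (key_set w \<inter> U) = dec_len U w"
proof (induction w arbitrary: U rule: rev_induct)
  case (snoc x w)
  have "U \<inter> {x<..} = {x<..}" if "x \<in> U" using that snoc.prems by (auto simp: upset_def)
  then show ?case
    using snoc by (auto simp: key_set_snoc card_key_step dec_len_snoc)
qed simp

text \<open>\<open>key_step\<close> is monotone in its set, and reading \<open>p\<close> first only
  starts the fold from a larger set. Nestedness of the key columns will follow from this.\<close>

lemma key_set_append_mono: "key_set u \<subseteq> key_set (p @ u)"
proof (induction u rule: rev_induct)
  case (snoc x u)
  then show ?case unfolding append.assoc[symmetric] key_set_snoc key_step_def by blast
qed simp

text \<open>A finite subset of a linear order is determined by its counts above thresholds. If
  \<open>v\<close> belonged to one set only, raising the threshold from \<open>v\<close> to the next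
  element of the other set would lower just one of two equal counts.\<close>

lemma key_set_eqI:
  assumes "finite A" "\<And>v. dec_len {v..} w = card (A \<inter> {v..})"
  shows "key_set w = A"
proof -
  have eq: "card (key_set w \<inter> {v..}) = card (A \<inter> {v..})" for v
    using assms(2) by (simp add: card_key_set)
  have sub: "v \<in> B" if v: "v \<in> A" and A: "finite A" and B: "finite B"
    and e: "\<And>v. card (A \<inter> {v..}) = card (B \<inter> {v..})" for v and A B :: "'a set"
  proof (rule ccontr)
    assume n: "v \<notin> B"
    have "card (B \<inter> {v..}) = card (A \<inter> {v..})" using e by simp
    then have "card (B \<inter> {v..}) > 0" using v A by (auto simp: card_gt_0_iff)
    then have ne: "B \<inter> {v..} \<noteq> {}" by (auto simp: card_gt_0_iff)
    define u where "u = Min (B \<inter> {v..})"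
    have u: "u \<in> B" "v \<le> u" "\<And>z. z \<in> B \<Longrightarrow> v \<le> z \<Longrightarrow> u \<le> z"
      using Min_in[OF _ ne] B by (auto simp: u_def)
    then have "v < u" using n by (metis le_neq_trans)
    have "B \<inter> {v..} = B \<inter> {u..}" using u by auto
    then have "card (A \<inter> {v..}) = card (A \<inter> {u..})" using e by metis
    moreover have "A \<inter> {u..} \<subset> A \<inter> {v..}"
    proof
      show "A \<inter> {u..} \<subseteq> A \<inter> {v..}" using \<open>v < u\<close> by auto
      have "v \<in> A \<inter> {v..}" "v \<notin> A \<inter> {u..}" using v \<open>v < u\<close> by auto
      then show "A \<inter> {u..} \<noteq> A \<inter> {v..}" by blast
    qed
    ultimately show False using A psubset_card_mono[of "A \<inter> {v..}" "A \<inter> {u..}"] by (metis finite_Int less_irrefl)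
  qed
  show ?thesis
  proof (intro set_eqI iffI)
    fix v
    show "v \<in> key_set w \<Longrightarrow> v \<in> A" by (rule sub[OF _ _ assms(1) eq]) auto
    show "v \<in> A \<Longrightarrow> v \<in> key_set w" by (rule sub[OF _ assms(1) _ eq[symmetric]]) auto
  qed
qed

lemma word_equiv_key_set: "word_equiv u v \<Longrightarrow> key_set u = key_set v"
  by (rule key_set_eqI) (simp_all add: card_key_set word_equiv_dec_len)

section \<open>Tableaux as lists of rows and row insertion\<close>

fun dominates :: "'a::linorder list \<Rightarrow> 'a list list \<Rightarrow> bool" where
  "dominates R [] \<longleftrightarrow> True"
| "dominates R (R' # T) \<longleftrightarrow> length R' \<le> length R \<and> (\<forall>k<length R'. R ! k < R' ! k)"

fun tab :: "'a::linorder list list \<Rightarrow> bool" where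
  "tab [] \<longleftrightarrow> True"
| "tab (R # T) \<longleftrightarrow> R \<noteq> [] \<and> sorted R \<and> dominates R T \<and> tab T"

text \<open>The reading word of \<open>T\<^bsub>c+1\<^esub>\<close>: columns and rows are counted from 0.\<close>

fun tail_word :: "nat \<Rightarrow> 'a list list \<Rightarrow> 'a list" where
  "tail_word c [] = []"
| "tail_word c (R # T) = tail_word c T @ drop c R"

fun column_word :: "nat \<Rightarrow> 'a list list \<Rightarrow> 'a list" where
  "column_word c [] = []"
| "column_word c (R # T) = column_word c T @ (if c < length R then [R ! c] else [])"

abbreviation col_len :: "nat \<Rightarrow> 'a list list \<Rightarrow> nat" where
  "col_len c T \<equiv> length (column_word c T)"

text \<open>\<open>row_insert x q T T' r d\<close>: row insertion of \<open>x\<close> into \<open>T\<close> gives \<open>T'\<close>; it changes column \<open>q\<close>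
  of the first row, and the new cell is \<open>(r, d)\<close>.\<close>

inductive row_insert :: "'a::linorder \<Rightarrow> nat \<Rightarrow> 'a list list \<Rightarrow> 'a list list \<Rightarrow> nat \<Rightarrow> nat \<Rightarrow> bool" where
  ins_Nil: "row_insert x 0 [] [[x]] 0 0"
| ins_end: "\<forall>y\<in>set R. y \<le> x \<Longrightarrow> row_insert x (length R) (R # T) ((R @ [x]) # T) 0 (length R)"
| ins_bump: "\<forall>a\<in>set A. a \<le> x \<Longrightarrow> x < y \<Longrightarrow> row_insert y q T T' r d \<Longrightarrow>
    row_insert x (length A) ((A @ y # B) # T) ((A @ x # B) # T') (Suc r) d"

section \<open>Basic properties of row insertion\<close>

lemma append_Cons_eq_cases:
  assumes "A @ x # B = A' @ x' # B'"
  obtains "A = A'" "x = x'" "B = B'"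
    | "length A < length A'" "x \<in> set A'" "x' \<in> set B"
    | "length A' < length A" "x' \<in> set A" "x \<in> set B'"
proof -
  obtain us where "A = A' @ us \<and> us @ x # B = x' # B' \<or> A @ us = A' \<and> x # B = us @ x' # B'"
    using assms unfolding append_eq_append_conv2 by blast
  then show thesis by (cases us) (use that in auto)
qed

lemma row_insert_NilE:
  assumes "row_insert x q [] T' r d"
  obtains "q = 0" "T' = [[x]]" "r = 0" "d = 0"
  using assms by (auto elim: row_insert.cases)

lemma row_insert_ConsE [consumes 1, case_names append bump]:
  assumes "row_insert x q (R # T) T' r d"
  obtains "\<forall>y\<in>set R. y \<le> x" "q = length R" "T' = (R @ [x]) # T" "r = 0" "d = length R"
    | A y B p T0 r0 where "R = A @ y # B" "\<forall>a\<in>set A. a \<le> x" "x < y" "row_insert y p T T0 r0 d"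
        "q = length A" "T' = (A @ x # B) # T0" "r = Suc r0"
  using assms by (cases rule: row_insert.cases) (use that in auto)

lemma row_insert_exists: "\<exists>q T' r d. row_insert x q T T' r d"
proof (induction T arbitrary: x)
  case Nil
  show ?case by (blast intro: ins_Nil)
next
  case (Cons R T)
  show ?case
  proof (cases "\<forall>y\<in>set R. y \<le> x")
    case True
    then show ?thesis by (blast intro: ins_end)
  next
    case False
    then obtain A y B where R: "R = A @ y # B" "\<forall>a\<in>set A. a \<le> x" "\<not> y \<le> x"
      using split_list_first_prop[of R "\<lambda>y. \<not> y \<le> x"] by auto
    then have "x < y" by simp
    then show ?thesis using Cons[of y] R by (blast intro: ins_bump)
  qed
qed

lemma row_insert_det:
  "row_insert x q T T' r d \<Longrightarrow> row_insert x q2 T T2 r2 d2 \<Longrightarrow> q2 = q \<and> T2 = T' \<and> r2 = r \<and> d2 = d"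
proof (induction arbitrary: q2 T2 r2 d2 rule: row_insert.induct)
  case (ins_Nil x)
  then show ?case by (auto elim: row_insert_NilE)
next
  case (ins_end R x T)
  from ins_end(2) show ?case
    by (cases rule: row_insert_ConsE) (use ins_end(1) in auto)
next
  case (ins_bump A x y q T T' r d B)
  from ins_bump.prems show ?case
  proof (cases rule: row_insert_ConsE)
    case append
    then show ?thesis using ins_bump.hyps by auto
  next
    case (bump A' y' B' p T0 r0)
    from bump(1) show ?thesis
    proof (cases rule: append_Cons_eq_cases)
      case 1
      then show ?thesis using bump ins_bump.IH[of p T0 r0 d2] by auto
    qed (use bump ins_bump.hyps in auto)
  qed
qed

text \<open>An entry of the first row of \<open>T\<close> in column \<open>k\<close> would exceed
  \<open>R ! k \<ge> y\<close>, so the insertion of \<open>y\<close> cannot pass it. With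
  \<open>k\<close> the place from which \<open>y\<close> was bumped, this says that the bumping path
  moves weakly left.\<close>

lemma row_insert_position:
  assumes "row_insert y q T T' r d" "dominates R T" "k < length R" "y \<le> R ! k"
  shows "q \<le> k"
proof (cases T)
  case Nil
  then show ?thesis using assms(1) by (auto elim: row_insert_NilE)
next
  case (Cons S T0)
  have ins: "row_insert y q (S # T0) T' r d" using assms(1) Cons by simp
  show ?thesis
  proof (rule ccontr)
    assume "\<not> q \<le> k"
    from ins have "k < length S \<and> S ! k \<le> y"
    proof (cases rule: row_insert_ConsE)
      case append
      then show ?thesis using \<open>\<not> q \<le> k\<close> by auto
    next
      case (bump A y' B p T1 r0)
      then have "k < length A" using \<open>\<not> q \<le> k\<close> by auto
      then show ?thesis using bump by (auto simp: nth_append)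
    qed
    then show False using assms(2,4) Cons by auto
  qed
qed

lemma row_insert_left: "row_insert x q T T' r d \<Longrightarrow> tab T \<Longrightarrow> d \<le> q"
proof (induction rule: row_insert.induct)
  case (ins_bump A x y q T T' r d B)
  have "q \<le> length A"
    using ins_bump by (intro row_insert_position[of y q T T' r d "A @ y # B"]) auto
  then show ?case using ins_bump by auto
qed auto

text \<open>The letter \<open>y\<close> lands weakly left of the column it comes from, where the
  entries above are now at most \<open>x < y\<close>. In all other columns the upper entry did not
  grow.\<close>

lemma dominates_row_insert:
  assumes ins: "row_insert y q T T' r d" and dom: "dominates (A @ y # B) T"
    and xy: "x < y" and A: "\<forall>a\<in>set A. a \<le> x"
  shows "dominates (A @ x # B) T'"
proof -
  have q: "q \<le> length A"
    using row_insert_position[OF ins dom, of "length A"] by simp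
  have le: "(A @ x # B) ! k < y" if "k \<le> length A" for k
    using that xy A by (auto simp: nth_append nth_Cons' intro: order_le_less_trans)
  have same: "(A @ x # B) ! k \<le> (A @ y # B) ! k" if "k < length (A @ y # B)" for k
    using that xy by (auto simp: nth_append nth_Cons')
  show ?thesis
  proof (cases T)
    case Nil
    then show ?thesis using le[of 0] ins by (auto elim!: row_insert_NilE)
  next
    case (Cons R T0)
    have dR: "(A @ y # B) ! k < R ! k" "k < length (A @ y # B)" if "k < length R" for k
      using dom Cons that by auto
    have ins': "row_insert y q (R # T0) T' r d" using ins Cons by simp
    then show ?thesis
    proof (cases rule: row_insert_ConsE)
      case append
      have "(A @ x # B) ! k < (R @ [y]) ! k" if k: "k < Suc (length R)" for k
      proof (cases "k < length R")
        case True
        then show ?thesis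
          using same[OF dR(2)[OF True]] dR(1)[OF True] by (simp add: nth_append_left)
      next
        case False
        then show ?thesis using k le[of k] q append by (auto simp: nth_append)
      qed
      then show ?thesis using append q by auto
    next
      case (bump A' y' B' p T1 r0)
      have "(A @ x # B) ! k < (A' @ y # B') ! k" if k: "k < Suc (length A' + length B')" for k
      proof (cases "k = length A'")
        case True
        then show ?thesis using le[of k] q bump by (auto simp: nth_append)
      next
        case False
        have kR: "k < length R" using k bump by simp
        have "(A @ x # B) ! k < R ! k"
          using same[OF dR(2)[OF kR]] dR(1)[OF kR] by simp
        moreover have "R ! k = (A' @ y # B') ! k"
          using False bump by (auto simp: nth_append nth_Cons')
        ultimately show ?thesis by simp
      qed
      moreover have "length R \<le> length (A @ y # B)" using dom Cons by simp
      ultimately show ?thesis using bump by auto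
    qed
  qed
qed

lemma tab_row_insert: "row_insert x q T T' r d \<Longrightarrow> tab T \<Longrightarrow> tab T'"
proof (induction rule: row_insert.induct)
  case (ins_end R x T)
  have "dominates (R @ [x]) T" using ins_end by (cases T) (auto simp: nth_append)
  moreover have "sorted (R @ [x])" using ins_end by (simp add: sorted_append)
  ultimately show ?case using ins_end.prems by simp
next
  case (ins_bump A x y q T T' r d B)
  have t: "sorted (A @ y # B)" "dominates (A @ y # B) T" "tab T" using ins_bump.prems by auto
  have "dominates (A @ x # B) T'"
    by (rule dominates_row_insert[OF ins_bump.hyps(3) t(2) ins_bump.hyps(2,1)])
  moreover have "sorted (A @ x # B)"
    using t(1) ins_bump.hyps(1,2) by (fastforce simp: sorted_append)
  ultimately show ?case using ins_bump.IH[OF t(3)] by simp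
qed simp

fun add_cell :: "'a \<Rightarrow> nat \<Rightarrow> 'a list list \<Rightarrow> 'a list list" where
  "add_cell n r [] = [[n]]"
| "add_cell n 0 (R # T) = (R @ [n]) # T"
| "add_cell n (Suc r) (R # T) = R # add_cell n r T"

text \<open>Formulated for an arbitrary \<open>Q\<close> of the same shape because the new cell is
  recorded in a tableau with unrelated entries.\<close>

lemma row_insert_shape:
  "row_insert x q T T' r d \<Longrightarrow> map length Q = map length T \<Longrightarrow>
    map length (add_cell n r Q) = map length T' \<and> r \<le> length T \<and>
    d = (if r < length Q then length (Q ! r) else 0)"
proof (induction arbitrary: Q rule: row_insert.induct)
  case (ins_end R x T)
  then show ?case by (cases Q) auto
next
  case (ins_bump A x y q T T' r d B)
  then show ?case by (cases Q) auto
qed auto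

lemma row_insert_mset: "row_insert x q T T' r d \<Longrightarrow> mset (concat T') = add_mset x (mset (concat T))"
  by (induction rule: row_insert.induct) auto

text \<open>The letters bumped from a row by the two insertions stand in the same relation,
  \<open>\<le>\<close> or \<open>>\<close>, as the letters inserted into it. The comparison
  therefore passes down to the row in which one of the paths ends.\<close>

lemma row_bumping:
  "row_insert x q T T' r d \<Longrightarrow> row_insert x2 q2 T' T2 r2 d2 \<Longrightarrow> tab T \<Longrightarrow>
    (x \<le> x2 \<longrightarrow> d < d2) \<and> (x2 < x \<longrightarrow> d2 \<le> d)"
proof (induction arbitrary: x2 q2 T2 r2 d2 rule: row_insert.induct)
  case (ins_Nil x)
  from ins_Nil(1) show ?case
  proof (cases rule: row_insert_ConsE)
    case (bump A y B p T0 r0)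
    then have "y = x" by (auto simp: Cons_eq_append_conv)
    then show ?thesis using bump by (auto elim: row_insert_NilE)
  qed auto
next
  case (ins_end R x T)
  have t: "tab ((R @ [x]) # T)"
    using tab_row_insert[OF row_insert.ins_end[OF ins_end(1)] ins_end(3)] .
  from ins_end(2) show ?case
  proof (cases rule: row_insert_ConsE)
    case append
    then show ?thesis by auto
  next
    case (bump A y B p T0 r0)
    have "y \<in> set (R @ [x])" using bump(1) by simp
    then have "y \<le> x" using ins_end(1) by auto
    then have "\<not> x \<le> x2" using bump(3) by auto
    moreover have "d2 \<le> q2" by (rule row_insert_left[OF ins_end(2) t])
    moreover have "length A + length B = length R" using arg_cong[OF bump(1), of length] by simp
    ultimately show ?thesis using bump by auto
  qed
next
  case (ins_bump A x y q T T' r d B)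
  have t1: "tab T" "dominates (A @ y # B) T" "sorted (A @ y # B)" using ins_bump.prems(2) by auto
  have dA: "d \<le> length A"
    using row_insert_position[OF ins_bump.hyps(3) t1(2), of "length A"]
      row_insert_left[OF ins_bump.hyps(3) t1(1)] by simp
  from ins_bump.prems(1) show ?case
  proof (cases rule: row_insert_ConsE)
    case append
    then show ?thesis using dA by auto
  next
    case (bump A' y' B' p T0 r0)
    have IH: "(y \<le> y' \<longrightarrow> d < d2) \<and> (y' < y \<longrightarrow> d2 \<le> d)"
      by (rule ins_bump.IH[OF bump(4) t1(1)])
    have B: "\<forall>b\<in>set B. y \<le> b" using t1(3) by (auto simp: sorted_append)
    from bump(1) show ?thesis
    proof (cases rule: append_Cons_eq_cases)
      case 1
      then show ?thesis using IH bump ins_bump.hyps by auto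
    next
      case 2
      then have "y \<le> y' \<and> x \<le> x2" using B bump by auto
      then show ?thesis using IH by auto
    next
      case 3
      then have "y' \<le> x" using ins_bump.hyps(1) by auto
      then show ?thesis using IH bump ins_bump.hyps(2) by auto
    qed
  qed
qed

section \<open>Reverse row insertion\<close>

lemma row_insert_backward_det:
  "row_insert x q T T' r d \<Longrightarrow> row_insert x2 q2 T2 T' r d2 \<Longrightarrow> tab T \<Longrightarrow> tab T2 \<Longrightarrow> x2 = x \<and> T2 = T"
proof (induction arbitrary: x2 q2 T2 d2 rule: row_insert.induct)
  case (ins_Nil x)
  show ?case
  proof (cases T2)
    case Nil
    then show ?thesis using ins_Nil by (auto elim: row_insert_NilE)
  next
    case (Cons R T0)
    from ins_Nil(1)[unfolded Cons] show ?thesis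
      by (cases rule: row_insert_ConsE) (use ins_Nil Cons in auto)
  qed
next
  case (ins_end R x T)
  show ?case
  proof (cases T2)
    case Nil
    then show ?thesis using ins_end by (auto elim: row_insert_NilE)
  next
    case (Cons R' T0)
    from ins_end(2)[unfolded Cons] show ?thesis
      by (cases rule: row_insert_ConsE) (use ins_end Cons in auto)
  qed
next
  case (ins_bump A x y q T T' r d B)
  show ?case
  proof (cases T2)
    case Nil
    then show ?thesis using ins_bump.prems by (auto elim: row_insert_NilE)
  next
    case (Cons R' T0)
    from ins_bump.prems(1)[unfolded Cons] show ?thesis
    proof (cases rule: row_insert_ConsE)
      case (bump A' y' B' p T1 r0)
      have "row_insert y' p T0 T' r d2" using bump by simp
      then have e: "y' = y" "T0 = T" using ins_bump.IH[of y' p T0 d2] ins_bump.prems Cons by auto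
      have B: "\<forall>b\<in>set B. y \<le> b" "\<forall>b\<in>set B'. y \<le> b"
        using ins_bump.prems(2,3) bump Cons e by (auto simp: sorted_append)
      have eq: "A' @ x2 # B' = A @ x # B" using bump by simp
      then show ?thesis
      proof (cases rule: append_Cons_eq_cases)
        case 1
        then show ?thesis using bump e Cons by auto
      qed (use B ins_bump.hyps bump e in auto)
    qed auto
  qed
qed

text \<open>The hypotheses say that row \<open>r\<close> ends in a corner. Its last letter is
  removed, and each letter ejected from a row replaces the rightmost smaller entry of the row
  above.\<close>

lemma row_insert_backward:
  assumes "tab T'" "r < length T'" "Suc r < length T' \<longrightarrow> length (T' ! Suc r) < length (T' ! r)"
  shows "\<exists>x q T d. row_insert x q T T' r d \<and> tab T"
  using assms
proof (induction r arbitrary: T')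
  case 0
  obtain R T0 where T': "T' = R # T0" using 0 by (cases T') auto
  show ?case
  proof (cases "butlast R = []")
    case True
    then obtain x where R: "R = [x]" using 0 T' by (cases R) (auto split: if_splits)
    then have "T0 = []" using 0 T' by (cases T0) auto
    then show ?thesis using T' R ins_Nil[of x] by (intro exI[of _ x] exI[of _ 0] exI[of _ "[]"]) auto
  next
    case False
    define S x where "S = butlast R" and "x = last R"
    have R: "R = S @ [x]" using False by (cases R) (simp_all add: S_def x_def)
    have t: "sorted (S @ [x])" "dominates R T0" "tab T0" using 0 T' R by auto
    have l: "T0 \<noteq> [] \<longrightarrow> length (hd T0) \<le> length S" using 0 T' R by (cases T0) auto
    have "row_insert x (length S) (S # T0) ((S @ [x]) # T0) 0 (length S)"
      using t(1) by (intro ins_end) (simp add: sorted_append)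
    moreover have "tab (S # T0)"
    proof -
      have "dominates S T0" using t(2) l R by (cases T0) (auto simp: nth_append)
      then show ?thesis using t(1,3) False by (simp add: sorted_append S_def)
    qed
    ultimately show ?thesis using T' R by blast
  qed
next
  case (Suc r)
  obtain R T0' where T': "T' = R # T0'" using Suc by (cases T') auto
  have t: "tab T0'" "sorted R" "dominates R T0'" using Suc T' by auto
  have "\<exists>y q T d. row_insert y q T T0' r d \<and> tab T"
    using Suc.prems T' by (intro Suc.IH) auto
  then obtain y q T0 d where ins: "row_insert y q T0 T0' r d" and tT0: "tab T0" by blast
  have q: "q < length (hd T0') \<and> T0' \<noteq> [] \<and> hd T0' ! q = y"
    using ins by (cases rule: row_insert.cases) (auto simp: nth_append)
  have Rq: "q < length R" "R ! q < y" using q t(3) by (cases T0'; auto)+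
  then have "\<exists>x\<in>set R. x < y" by (meson nth_mem)
  then obtain A x B where R: "R = A @ x # B" "x < y" "\<forall>b\<in>set B. \<not> b < y"
    using split_list_last_prop[of R "\<lambda>x. x < y"] by auto
  have B: "\<forall>b\<in>set B. y \<le> b" using R(3) by auto
  \<comment> \<open>The entry of \<open>R\<close> above \<open>y\<close>, in column
    \<open>q\<close>, is smaller than \<open>y\<close>, so the rightmost smaller entry
    \<open>x\<close> cannot be further left.\<close>
  have qA: "q \<le> length A"
  proof (rule ccontr)
    assume "\<not> q \<le> length A"
    then have "R ! q \<in> set B" using Rq(1) R(1) by (auto simp: nth_append nth_Cons')
    then show False using B Rq(2) by auto
  qed
  have A: "\<forall>a\<in>set A. a \<le> x" using t(2) R by (auto simp: sorted_append)
  have "row_insert x (length A) ((A @ y # B) # T0) ((A @ x # B) # T0') (Suc r) d"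
    by (rule ins_bump[OF A R(2) ins])
  moreover have "dominates (A @ y # B) T0"
  proof (cases T0)
    case (Cons S T1)
    have le: "(A @ y # B) ! k \<le> y" if "k \<le> length A" for k
    proof (cases "k < length A")
      case True
      then have "A ! k \<le> x" using A by simp
      then show ?thesis using True R(2) by (simp add: nth_append)
    qed (use that in \<open>auto simp: nth_append\<close>)
    have low: "R ! k = (A @ y # B) ! k" if "k \<noteq> length A" for k
      using that R(1) by (auto simp: nth_append nth_Cons')
    from ins[unfolded Cons] show ?thesis
    proof (cases rule: row_insert_ConsE)
      case append
      have "(A @ y # B) ! k < S ! k" "k < length R" if "k < length S" for k
      proof -
        have "R ! k < (S @ [y]) ! k" "k < length R" using that append t(3) by auto
        then show "(A @ y # B) ! k < S ! k" "k < length R"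
          using low[of k] qA append that by (auto simp: nth_append)
      qed
      then show ?thesis using Cons append t(3) R(1) by auto
    next
      case (bump A' y' B' p T2 r0)
      have sS: "sorted S" using tT0 Cons by simp
      have dk: "R ! k < (A' @ y # B') ! k" if "k < length S" for k
        using that t(3) bump by auto
      have "(A @ y # B) ! k < S ! k" if k: "k < length S" for k
      proof (cases "k < q")
        case True
        then show ?thesis using dk[OF k] low[of k] qA bump by (auto simp: nth_append)
      next
        case False
        have "S ! q \<le> S ! k" using sS k False by (intro sorted_nth_mono) auto
        then have yk: "y < S ! k" using bump by (auto simp: nth_append)
        show ?thesis
        proof (cases "k \<le> length A")
          case True
          then show ?thesis using le[of k] yk by auto
        next
          case False
          then have "k > q" using qA by simp
          then have "(A' @ y # B') ! k = S ! k" using bump by (auto simp: nth_append nth_Cons')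
          then show ?thesis using dk[OF k] low[of k] False by auto
        qed
      qed
      moreover have "length S \<le> length (A @ y # B)" using t(3) bump R(1) by auto
      ultimately show ?thesis using Cons by auto
    qed
  qed simp
  moreover have "sorted (A @ y # B)" using A R(2) B t(2) R(1) by (auto simp: sorted_append)
  ultimately have "tab ((A @ y # B) # T0)" using tT0 by simp
  then show ?case
    using \<open>row_insert x (length A) ((A @ y # B) # T0) ((A @ x # B) # T0') (Suc r) d\<close> T' R(1) by blast
qed

section \<open>Reading words and columns of tableaux\<close>

lemma in_set_subseq: "subseq s w \<Longrightarrow> z \<in> set s \<Longrightarrow> z \<in> set w"
  using list_emb_set[of "(=)" s w z] by auto

lemma set_column_word: "set (column_word c T) \<subseteq> set (tail_word c T)"
  by (induction T) (auto simp: Cons_nth_drop_Suc[symmetric])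

lemma tab_empty_tail:
  "tab (R # T) \<Longrightarrow> length R \<le> c \<Longrightarrow> tail_word c (R # T) = [] \<and> column_word c (R # T) = []"
proof (induction T arbitrary: R)
  case (Cons R' T)
  then have "tab (R' # T)" "length R' \<le> c" by auto
  then show ?case using Cons.IH[of R'] Cons.prems by auto
qed auto

lemma tab_below_greater:
  "tab (R # T) \<Longrightarrow> c < length R \<Longrightarrow> z \<in> set (tail_word c T) \<Longrightarrow> R ! c < z"
proof (induction T arbitrary: R)
  case (Cons R' T)
  show ?case
  proof (cases "c < length R'")
    case True
    have R: "R ! c < R' ! c" using True Cons.prems by auto
    have "R' ! c \<le> z"
    proof (cases "z \<in> set (tail_word c T)")
      case True
      then show ?thesis using Cons.IH[of R'] Cons.prems \<open>c < length R'\<close> by auto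
    next
      case False
      then have "z \<in> set (drop c R')" using Cons.prems by auto
      then obtain k where "k < length (drop c R')" "z = drop c R' ! k" by (auto simp: in_set_conv_nth)
      moreover have "sorted R'" using Cons.prems by simp
      ultimately show ?thesis by (auto intro: sorted_nth_mono)
    qed
    then show ?thesis using R by simp
  next
    case False
    then have "tail_word c (R' # T) = []" using tab_empty_tail[of R' T c] Cons.prems by auto
    then show ?thesis using Cons.prems by simp
  qed
qed simp

lemma tail_word_antimono: "c \<le> c' \<Longrightarrow> subseq (tail_word c' T) (tail_word c T)"
proof (induction T)
  case (Cons R T)
  have "subseq (drop c' R) (drop c R)"
  proof -
    have "drop c' R = drop (c' - c) (drop c R)" using Cons.prems by simp
    then show ?thesis by (metis append_take_drop_id list_emb_append2 subseq_order.order_refl)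
  qed
  then show ?case using Cons by (auto intro: list_emb_append_mono)
qed simp

lemma sorted_column_word: "tab T \<Longrightarrow> sorted_wrt (>) (column_word c T)"
proof (induction T)
  case (Cons R T)
  then show ?case
    using tab_below_greater[of R T c] set_column_word[of c T] by (auto simp: sorted_wrt_append)
qed simp

lemma dec_subseq: "subseq s w \<Longrightarrow> sorted_wrt (>) w \<Longrightarrow> sorted_wrt (>) (s :: 'a::linorder list)"
  by (induction rule: list_emb.induct) (auto dest: in_set_subseq)

text \<open>Rows increase weakly, so a strictly decreasing chain takes at most one letter from each
  row, and only from rows that reach column \<open>c\<close>.\<close>

lemma dec_len_tail_le_col_len: "tab T \<Longrightarrow> dec_len U (tail_word c T) \<le> col_len c T"
proof (induction T)
  case (Cons R T)
  obtain s where s: "subseq s (tail_word c T @ drop c R)" "sorted_wrt (>) s" "set s \<subseteq> U"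
    "length s = dec_len U (tail_word c (R # T))"
    using dec_len_witness[of "tail_word c (R # T)" U] by auto
  obtain s1 s2 where ss: "s = s1 @ s2" "subseq s1 (tail_word c T)" "subseq s2 (drop c R)"
    using s(1) by (metis subseq_appendE)
  have "length s1 \<le> dec_len U (tail_word c T)"
    using s ss by (intro dec_len_ge) (auto simp: sorted_wrt_append)
  moreover have "length s2 \<le> (if c < length R then 1 else 0)"
  proof (cases "c < length R")
    case True
    have "sorted (drop c R)" using Cons.prems by (simp add: sorted_wrt_drop)
    then show ?thesis using True sorted_subseq_length[OF ss(3)] s(2) ss(1)
      by (auto simp: sorted_wrt_append)
  next
    case False
    then show ?thesis using ss(3) by simp
  qed
  ultimately show ?case using Cons s(4) ss(1) by (auto split: if_splits)
qed simp

text \<open>Each row supplies at most one letter of the chain, and the entry of that row in column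
  \<open>c\<close> is not larger. Replacing letter by letter keeps the length and does not raise the
  head.\<close>

lemma chain_to_column:
  "tab T \<Longrightarrow> subseq m (tail_word c T) \<Longrightarrow> sorted_wrt (>) m \<Longrightarrow>
    \<exists>m'. subseq m' (column_word c T) \<and> length m' = length m \<and> (m \<noteq> [] \<longrightarrow> hd m' \<le> hd m)"
proof (induction T arbitrary: m)
  case (Cons R T)
  obtain m1 m2 where m: "m = m1 @ m2" "subseq m1 (tail_word c T)" "subseq m2 (drop c R)"
    using Cons.prems(2) by (auto elim: subseq_appendE)
  obtain m1' where m1': "subseq m1' (column_word c T)" "length m1' = length m1"
      "m1 \<noteq> [] \<longrightarrow> hd m1' \<le> hd m1"
    using Cons.IH[of m1] Cons.prems m by (auto simp: sorted_wrt_append)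
  show ?case
  proof (cases m2)
    case Nil
    then show ?thesis using m m1' by (intro exI[of _ m1']) auto
  next
    case (Cons z r)
    have "sorted (drop c R)" using Cons.prems by (simp add: sorted_wrt_drop)
    then have "length m2 \<le> 1"
      using sorted_subseq_length[OF m(3)] Cons.prems(3) m(1) by (simp add: sorted_wrt_append)
    then have m2: "m2 = [z]" using Cons by simp
    have z: "z \<in> set (drop c R)" using in_set_subseq[OF m(3)] m2 by simp
    then have c: "c < length R" by (cases "c < length R") auto
    obtain k where "k < length (drop c R)" "z = drop c R ! k" using z by (auto simp: in_set_conv_nth)
    then have "R ! c \<le> z" using Cons.prems(1) by (auto intro: sorted_nth_mono)
    moreover have "subseq (m1' @ [R ! c]) (column_word c T @ [R ! c])"
      using m1'(1) by (intro list_emb_append_mono) auto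
    moreover have "hd (m1' @ [R ! c]) \<le> hd m"
      using m1'(2,3) m(1) m2 \<open>R ! c \<le> z\<close> by (cases m1; cases m1') auto
    ultimately show ?thesis using m m1'(2) m2 c
      by (intro exI[of _ "m1' @ [R ! c]"]) simp
  qed
qed auto

text \<open>Induction adds a row on top. If the chain ends in the new column entry \<open>r\<close>,
  its lower part is moved into column \<open>c\<close>, whose entries below all exceed
  \<open>r\<close>. Otherwise the induction hypothesis moves the lower part, and a possible last
  letter already lies right of column \<open>c\<close>.\<close>

lemma tail_word_le_column:
  assumes "tab T" shows "word_le (tail_word c T) (column_word c T @ tail_word (Suc c) T)"
  using assms
proof (induction T)
  case (Cons R T)
  show ?case
  proof (cases "c < length R")
    case False
    then show ?thesis
      using tab_empty_tail[of R T c] Cons.prems by (simp add: word_le_def)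
  next
    case True
    define C W r Y where "C = column_word c T" and "W = tail_word (Suc c) T" and "r = R ! c"
      and "Y = drop (Suc c) R"
    have dropR: "drop c R = r # Y" using True by (simp add: r_def Y_def Cons_nth_drop_Suc)
    have t: "tab T" using Cons.prems by simp
    show ?thesis
      unfolding word_le_def
    proof (intro allI impI)
      fix m assume m: "subseq m (tail_word c (R # T))" "sorted_wrt (>) m" "m \<noteq> []"
      then obtain m1 m2 where mm: "m = m1 @ m2" "subseq m1 (tail_word c T)" "subseq m2 (drop c R)"
        by (metis subseq_appendE tail_word.simps(2))
      have d: "sorted_wrt (>) m1" "sorted_wrt (>) m2" "\<And>a b. a \<in> set m1 \<Longrightarrow> b \<in> set m2 \<Longrightarrow> b < a"
        using m(2) mm(1) by (auto simp: sorted_wrt_append)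
      have "sorted (drop c R)" using Cons.prems by (simp add: sorted_wrt_drop)
      then have l2: "length m2 \<le> 1" using sorted_subseq_length[OF mm(3)] d by simp
      have "\<exists>m'. subseq m' (C @ [r] @ W @ Y) \<and> sorted_wrt (>) m' \<and> length m' = length m \<and>
        (\<forall>z\<in>set m'. last m \<le> z \<and> z \<le> hd m)"
      proof (cases "m2 = [r]")
        case True
        obtain m1' where m1': "subseq m1' C" "length m1' = length m1" "m1 \<noteq> [] \<longrightarrow> hd m1' \<le> hd m1"
          using chain_to_column[OF t mm(2) d(1)] by (auto simp: C_def)
        have sC: "sorted_wrt (>) m1'"
          using m1'(1) sorted_column_word[OF t, of c] unfolding C_def
          by (metis dec_subseq)
        have big: "r < z" if "z \<in> set m1'" for z
          using that in_set_subseq[OF m1'(1)] set_column_word[of c T]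
            tab_below_greater[OF Cons.prems \<open>c < length R\<close>] by (auto simp: C_def r_def)
        have up: "z \<le> hd m" if "z \<in> set (m1' @ [r])" for z
        proof (cases m1)
          case Nil
          then show ?thesis using that m1'(2) mm(1) True by simp
        next
          case (Cons a l)
          then have "hd m1' \<le> hd m" "m1' \<noteq> []" using m1'(2,3) mm(1) by auto
          moreover have "z \<le> hd m1'" using that sC big \<open>m1' \<noteq> []\<close>
            by (cases m1') (auto intro: less_imp_le)
          ultimately show ?thesis by simp
        qed
        have "subseq (m1' @ [r] @ [] @ []) (C @ [r] @ W @ Y)"
          using m1'(1) by (intro list_emb_append_mono) auto
        then show ?thesis
          using m1' sC big up mm(1) True
          by (intro exI[of _ "m1' @ [r]"]) (auto simp: sorted_wrt_append intro: less_imp_le)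
      next
        case False
        have m2Y: "subseq m2 Y"
          using mm(3) l2 False unfolding dropR
          by (cases m2) (auto simp: subseq_singleton_left)
        have "\<exists>m1'. subseq m1' (C @ W) \<and> sorted_wrt (>) m1' \<and> length m1' = length m1 \<and>
          (\<forall>z\<in>set m1'. last m1 \<le> z \<and> z \<le> hd m1)"
          using Cons.IH[OF t] mm(2) d(1) unfolding word_le_def C_def W_def
          by (cases "m1 = []") auto
        then obtain m1' where m1': "subseq m1' (C @ W)" "sorted_wrt (>) m1'" "length m1' = length m1"
          "\<forall>z\<in>set m1'. last m1 \<le> z \<and> z \<le> hd m1" by blast
        have "subseq (m1' @ m2) ((C @ W) @ Y)" using m1' m2Y by (intro list_emb_append_mono)
        moreover have "subseq (C @ W @ Y) (C @ [r] @ W @ Y)"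
          by (rule list_emb_append_mono[OF subseq_order.order_refl list_emb_append2[OF subseq_order.order_refl]])
        ultimately have "subseq (m1' @ m2) (C @ [r] @ W @ Y)"
          by (metis append.assoc subseq_order.trans)
        moreover have "sorted_wrt (>) (m1' @ m2) \<and> (\<forall>z\<in>set (m1' @ m2). last m \<le> z \<and> z \<le> hd m)"
        proof (cases "m1 = []")
          case True
          then have "m1' = []" using m1'(3) by simp
          then show ?thesis using True mm(1) m(2) l2 by (cases m2) auto
        next
          case False
          have lt: "b < a" if "a \<in> set m1'" "b \<in> set m2" for a b
            using that m1'(4) d(3)[of "last m1" b] False by force
          have l: "last m \<le> last m1" using d(3)[of "last m1" "last m2"] mm(1) False
            by (cases "m2 = []") (auto intro: less_imp_le)
          have h: "hd m = hd m1" using mm(1) False by simp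
          have "z = last m \<and> z \<le> hd m1" if "z \<in> set m2" for z
            using that l2 mm(1) d(3)[of "hd m1" z] False by (cases m2) (auto intro: less_imp_le)
          then show ?thesis
            using m1'(2,4) d(2) lt l h by (auto simp: sorted_wrt_append intro: order_trans)
        qed
        ultimately show ?thesis using m1'(3) mm(1) by (intro exI[of _ "m1' @ m2"]) simp
      qed
      then show "\<exists>m'. subseq m' (column_word c (R # T) @ tail_word (Suc c) (R # T)) \<and>
          sorted_wrt (>) m' \<and> length m' = length m \<and> (\<forall>z\<in>set m'. last m \<le> z \<and> z \<le> hd m)"
        using True by (simp add: C_def W_def r_def Y_def)
    qed
  qed
qed (simp add: word_le_def)

text \<open>All letters of \<open>W\<close> lie below and right of \<open>r\<close> and exceed it,
  so no chain uses \<open>W\<close> after \<open>r\<close>. The letters from \<open>C\<close> and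
  \<open>W\<close> then form an initial piece to which the induction hypothesis applies, and the
  rest comes from the top row.\<close>

lemma column_le_tail_word:
  assumes "tab T" shows "word_le (column_word c T @ tail_word (Suc c) T) (tail_word c T)"
  using assms
proof (induction T)
  case (Cons R T)
  show ?case
  proof (cases "c < length R")
    case False
    then show ?thesis
      using tab_empty_tail[of R T c] tab_empty_tail[of R T "Suc c"] Cons.prems by (simp add: word_le_def)
  next
    case True
    define C W r Y where "C = column_word c T" and "W = tail_word (Suc c) T" and "r = R ! c"
      and "Y = drop (Suc c) R"
    have dropR: "drop c R = r # Y" using True by (simp add: r_def Y_def Cons_nth_drop_Suc)
    have t: "tab T" using Cons.prems by simp
    have subW: "subseq W (tail_word c T)" unfolding W_def by (rule tail_word_antimono) simp
    have "word_le (C @ [r] @ W @ Y) (tail_word c T @ r # Y)"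
      unfolding word_le_def
    proof (intro allI impI)
      fix m assume m: "subseq m (C @ [r] @ W @ Y)" "sorted_wrt (>) m" "m \<noteq> []"
      then obtain m1 m2 m3 m4 where mm: "m = m1 @ m2 @ m3 @ m4" "subseq m1 C" "subseq m2 [r]"
          "subseq m3 W" "subseq m4 Y"
        by (metis subseq_appendE)
      have IH: "\<exists>l'. subseq l' (tail_word c T) \<and> sorted_wrt (>) l' \<and> length l' = length l \<and>
          (\<forall>z\<in>set l'. last l \<le> z \<and> z \<le> hd l)"
        if "subseq l (C @ W)" "sorted_wrt (>) l" for l
        using Cons.IH[OF t] that unfolding word_le_def C_def W_def by (cases "l = []") auto
      have m2: "m2 = [] \<or> m2 = [r]" using mm(3) by (cases m2) (auto simp: subseq_Cons2_iff split: if_splits)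
      have m3: "m3 = []" if "m2 = [r]"
      proof (rule ccontr)
        assume "m3 \<noteq> []"
        then obtain z where z: "z \<in> set m3" by (cases m3) auto
        then have "z < r" using m(2) mm(1) that by (auto simp: sorted_wrt_append)
        moreover have "r < z"
          using z in_set_subseq[OF mm(4)] in_set_subseq[OF subW] tab_below_greater[OF Cons.prems True]
          by (auto simp: r_def)
        ultimately show False by simp
      qed
      define l r4 where "l = m1 @ m3" and "r4 = m2 @ m4"
      have meq: "m = l @ r4" using m2 m3 mm(1) by (auto simp: l_def r4_def)
      have "subseq l (C @ W)" unfolding l_def using mm by (intro list_emb_append_mono)
      moreover have dl: "sorted_wrt (>) l" "sorted_wrt (>) r4" "\<And>a b. a \<in> set l \<Longrightarrow> b \<in> set r4 \<Longrightarrow> b < a"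
        using m(2) unfolding meq by (auto simp: sorted_wrt_append)
      ultimately obtain l' where l': "subseq l' (tail_word c T)" "sorted_wrt (>) l'" "length l' = length l"
          "\<forall>z\<in>set l'. last l \<le> z \<and> z \<le> hd l"
        using IH by blast
      have "subseq r4 ([r] @ Y)" unfolding r4_def using mm by (intro list_emb_append_mono)
      then have "subseq (l' @ r4) (tail_word c T @ r # Y)"
        using l'(1) by (intro list_emb_append_mono) auto
      moreover have "sorted_wrt (>) (l' @ r4) \<and> (\<forall>z\<in>set (l' @ r4). last m \<le> z \<and> z \<le> hd m)"
      proof (cases "l = []")
        case True
        then have "l' = []" "m = r4" using l'(3) meq by auto
        moreover have "z \<le> hd r4" if "z \<in> set r4" for z
          using that dl(2) by (cases r4) (auto intro: less_imp_le)
        ultimately show ?thesis using dl(2) last_least_dec[of r4] by auto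
      next
        case False
        have h: "hd m = hd l" using meq False by simp
        have lt: "b < a" if "a \<in> set l'" "b \<in> set r4" for a b
          using that l'(4) dl(3)[of "last l" b] False by force
        have le: "last m \<le> last l"
          using dl(3)[of "last l" "last r4"] meq False by (cases "r4 = []") (auto intro: less_imp_le)
        have 4: "last m \<le> z \<and> z \<le> hd l" if "z \<in> set r4" for z
        proof -
          have "z < hd l" using dl(3)[of "hd l" z] that False by simp
          moreover have "last m = last r4" using that meq by (cases r4) auto
          ultimately show ?thesis using last_least_dec[OF dl(2) that] by simp
        qed
        show ?thesis
          using l'(2,4) dl(2) lt le h 4 by (auto simp: sorted_wrt_append intro: order_trans)
      qed
      ultimately show "\<exists>m'. subseq m' (tail_word c T @ r # Y) \<and> sorted_wrt (>) m' \<and>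
          length m' = length m \<and> (\<forall>z\<in>set m'. last m \<le> z \<and> z \<le> hd m)"
        using l'(3) meq by (intro exI[of _ "l' @ r4"]) simp
    qed
    then show ?thesis using True by (simp add: dropR C_def W_def r_def Y_def)
  qed
qed (simp add: word_le_def)

text \<open>Peels off one column. This makes the key columns nested, identifies their lengths with
  those of the tableau, and factors out the columns left of a change.\<close>

lemma tail_word_column_equiv:
  "tab T \<Longrightarrow> word_equiv (tail_word c T) (column_word c T @ tail_word (Suc c) T)"
  by (intro word_equivI tail_word_le_column column_le_tail_word)

lemma key_set_tail_mono:
  assumes "tab T" "c \<le> c'" shows "key_set (tail_word c' T) \<subseteq> key_set (tail_word c T)"
  using assms(2)
proof (induction rule: dec_induct)
  case (step n)
  have "key_set (tail_word (Suc n) T) \<subseteq> key_set (tail_word n T)"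
    using word_equiv_key_set[OF tail_word_column_equiv[OF assms(1), of n]] key_set_append_mono by metis
  then show ?case using step by blast
qed simp

lemma col_len_eq: "tab T \<Longrightarrow> col_len c T = dec_len UNIV (tail_word c T)"
proof (rule antisym)
  assume t: "tab T"
  have "col_len c T \<le> dec_len UNIV (column_word c T @ tail_word (Suc c) T)"
    using sorted_column_word[OF t] by (intro dec_len_ge) auto
  also have "\<dots> = dec_len UNIV (tail_word c T)"
    using word_equiv_dec_len[OF tail_word_column_equiv[OF t, of c] upset_UNIV] by simp
  finally show "col_len c T \<le> dec_len UNIV (tail_word c T)" .
qed (rule dec_len_tail_le_col_len)

text \<open>The number of letters outside the upper set \<open>U\<close> in column \<open>c\<close> of the right key, since the column has
  \<open>col_len c T\<close> letters and \<open>dec_len U\<close> counts those in \<open>U\<close>.\<close>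

definition low_len :: "'a::linorder set \<Rightarrow> nat \<Rightarrow> 'a list list \<Rightarrow> nat" where
  "low_len U c T = col_len c T - dec_len U (tail_word c T)"

text \<open>What is counted is the set difference of a key column and \<open>U\<close>, and key
  columns shrink to the right.\<close>

lemma low_len_antimono:
  assumes "tab T" "upset U" "c \<le> c'" shows "low_len U c' T \<le> low_len U c T"
proof -
  have "low_len U k T = card (key_set (tail_word k T) - U)" for k
    using card_Diff_subset_Int[of "key_set (tail_word k T)" U]
      card_key_set[OF upset_UNIV, of "tail_word k T"] card_key_set[OF assms(2), of "tail_word k T"]
    by (simp add: low_len_def col_len_eq[OF assms(1)])
  then show ?thesis using key_set_tail_mono[OF assms(1,3)] by (auto intro!: card_mono)
qed

lemma low_len_add: "tab T \<Longrightarrow> low_len U c T + dec_len U (tail_word c T) = col_len c T"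
  using dec_len_tail_le_col_len[of T U c] by (simp add: low_len_def)

section \<open>The right key under row insertion\<close>

text \<open>For \<open>c \<le> d\<close> the whole bumping path runs in columns
  \<open>\<ge> c\<close>. Dropping the earlier columns thus commutes with each bump, and the bumps
  are instances of \<open>row_bump_equiv\<close>.\<close>

lemma tail_word_insert_equiv:
  "row_insert x q T T' r d \<Longrightarrow> tab T \<Longrightarrow> c \<le> d \<Longrightarrow> word_equiv (tail_word c T @ [x]) (tail_word c T')"
proof (induction rule: row_insert.induct)
  case (ins_bump A x y q T T' r d B)
  have t: "sorted (A @ y # B)" "dominates (A @ y # B) T" "tab T" using ins_bump.prems by auto
  have cA: "c \<le> length A"
    using row_insert_position[OF ins_bump.hyps(3) t(2), of "length A"]
      row_insert_left[OF ins_bump.hyps(3) t(3)] ins_bump.prems(2) by simp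
  have "sorted (drop c A @ y # B)" using t(1) cA by (metis drop_append diff_is_0_eq drop0 sorted_wrt_drop)
  moreover have "\<forall>a\<in>set (drop c A). a \<le> x" using ins_bump.hyps(1) by (auto dest: in_set_dropD)
  ultimately have "word_equiv ((drop c A @ y # B) @ [x]) (y # drop c A @ x # B)"
    using ins_bump.hyps(2) by (intro row_bump_equiv)
  from word_equiv_append[OF this, of "tail_word c T" "[]"]
  have "word_equiv (tail_word c ((A @ y # B) # T) @ [x]) ((tail_word c T @ [y]) @ drop c A @ x # B)"
    using cA by simp
  also have "word_equiv ((tail_word c T @ [y]) @ drop c A @ x # B) (tail_word c T' @ drop c A @ x # B)"
    using word_equiv_append[OF ins_bump.IH[OF t(3) ins_bump.prems(2)], of "[]"] by simp
  finally (word_equiv_trans) show ?case using cA by simp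
qed auto

lemma tail_word_insert_same: "row_insert x q T T' r d \<Longrightarrow> tab T \<Longrightarrow> q < c \<Longrightarrow> tail_word c T' = tail_word c T"
proof (induction rule: row_insert.induct)
  case (ins_bump A x y q T T' r d B)
  have "q \<le> length A"
    using ins_bump.prems row_insert_position[OF ins_bump.hyps(3), of "A @ y # B" "length A"] by simp
  then show ?case using ins_bump by (cases "c - length A") auto
qed auto

text \<open>The bumped letters form a decreasing chain through all rows of column \<open>d\<close>.\<close>

lemma bump_chain:
  "row_insert x q T T' r d \<Longrightarrow> tab T \<Longrightarrow>
    \<exists>g. subseq g (tail_word d T) \<and> sorted_wrt (>) g \<and> (\<forall>z\<in>set g. x < z) \<and> length g = col_len d T"
proof (induction rule: row_insert.induct)
  case (ins_end R x T)
  then show ?case using tab_empty_tail[of R T "length R"] by auto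
next
  case (ins_bump A x y q T T' r d B)
  have t: "dominates (A @ y # B) T" "tab T" using ins_bump.prems by auto
  have dA: "d \<le> length A"
    using row_insert_position[OF ins_bump.hyps(3) t(1), of "length A"]
      row_insert_left[OF ins_bump.hyps(3) t(2)] by simp
  obtain g where g: "subseq g (tail_word d T)" "sorted_wrt (>) g" "\<forall>z\<in>set g. y < z"
      "length g = col_len d T"
    using ins_bump.IH t by blast
  have "subseq (g @ [y]) (tail_word d T @ drop d (A @ y # B))"
    using g(1) dA by (intro list_emb_append_mono) (auto simp: subseq_singleton_left)
  then show ?case using g ins_bump.hyps(2) dA
    by (intro exI[of _ "g @ [y]"]) (auto simp: sorted_wrt_append)
qed simp

text \<open>Right of the new column \<open>d\<close>, a single letter \<open>y\<close> leaves the columns \<open>\<ge> c\<close>.\<close>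

lemma tail_word_insert_split:
  "row_insert x q T T' r d \<Longrightarrow> tab T \<Longrightarrow> d < c \<Longrightarrow>
    \<exists>u y s u2 s2 g k. word_equiv (tail_word c T @ [x]) (u @ [y] @ s) \<and> tail_word c T' = u @ s \<and>
      word_equiv (tail_word d T @ [x]) (u2 @ [y] @ s2) \<and> subseq s s2 \<and> subseq g u2 \<and>
      sorted_wrt (>) g \<and> (\<forall>z\<in>set g. y < z) \<and> length g + k = col_len d T \<and>
      dec_len UNIV u + k \<le> col_len c T"
proof (induction rule: row_insert.induct)
  case (ins_Nil x)
  then show ?case
    by (intro exI[of _ "[]"] exI[of _ x] exI[of _ 0] conjI) auto
next
  case (ins_end R x T)
  then show ?case
    using tab_empty_tail[of R T "length R"] tab_empty_tail[of R T c]
    by (intro exI[of _ "[]"] exI[of _ x] exI[of _ 0] conjI) auto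
next
  case (ins_bump A x y q T T' r d B)
  note ins = row_insert.ins_bump[OF ins_bump.hyps, of B]
  have t: "sorted (A @ y # B)" "dominates (A @ y # B) T" "tab T" using ins_bump.prems by auto
  show ?case
  proof (cases "c \<le> length A")
    case False
    \<comment> \<open>The path is already left of column \<open>c\<close>, so the letter that leaves
      is \<open>x\<close> itself: \<open>u\<close> is the whole word, \<open>s\<close> is empty, and
      \<open>k\<close>, the number of rows above the crossing, is \<open>0\<close>.\<close>
    obtain g where g: "subseq g (tail_word d ((A @ y # B) # T))" "sorted_wrt (>) g"
        "\<forall>z\<in>set g. x < z" "length g = col_len d ((A @ y # B) # T)"
      using bump_chain[OF ins ins_bump.prems(1)] by blast
    have same: "tail_word c ((A @ x # B) # T') = tail_word c ((A @ y # B) # T)"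
      using tail_word_insert_same[OF ins ins_bump.prems(1)] False by simp
    have "dec_len UNIV (tail_word c ((A @ y # B) # T)) \<le> col_len c ((A @ y # B) # T)"
      by (rule dec_len_tail_le_col_len[OF ins_bump.prems(1)])
    then have "word_equiv (tail_word c ((A @ y # B) # T) @ [x]) (tail_word c ((A @ y # B) # T) @ [x] @ []) \<and>
        tail_word c ((A @ x # B) # T') = tail_word c ((A @ y # B) # T) @ [] \<and>
        word_equiv (tail_word d ((A @ y # B) # T) @ [x]) (tail_word d ((A @ y # B) # T) @ [x] @ []) \<and>
        subseq [] ([] :: 'a list) \<and> subseq g (tail_word d ((A @ y # B) # T)) \<and> sorted_wrt (>) g \<and>
        (\<forall>z\<in>set g. x < z) \<and> length g + 0 = col_len d ((A @ y # B) # T) \<and>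
        dec_len UNIV (tail_word c ((A @ y # B) # T)) + 0 \<le> col_len c ((A @ y # B) # T)"
      unfolding same using g by (simp only: append_Nil2 add_0_right word_equiv_refl list_emb_Nil)
    then show ?thesis by blast
  next
    case True
    obtain u z s u2 s2 g k where IH: "word_equiv (tail_word c T @ [y]) (u @ [z] @ s)"
        "tail_word c T' = u @ s" "word_equiv (tail_word d T @ [y]) (u2 @ [z] @ s2)" "subseq s s2"
        "subseq g u2" "sorted_wrt (>) g" "\<forall>a\<in>set g. z < a" "length g + k = col_len d T"
        "dec_len UNIV u + k \<le> col_len c T"
      using ins_bump.IH[OF t(3) ins_bump.prems(2)] by blast
    \<comment> \<open>Above the crossing a bump only appends the changed row behind the remainder.
      The same rewriting is needed for the words from columns \<open>c\<close> and \<open>d\<close>,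
      which must lose the same letter \<open>z\<close>; each such row raises \<open>k\<close> by
      one.\<close>
    have lift: "word_equiv (tail_word e ((A @ y # B) # T) @ [x]) (v @ [z] @ (w @ drop e A @ x # B))"
      if "e \<le> length A" "word_equiv (tail_word e T @ [y]) (v @ [z] @ w)" for e v w
    proof -
      have "sorted (drop e A @ y # B)"
        using t(1) that(1) by (metis drop_append diff_is_0_eq drop0 sorted_wrt_drop)
      moreover have "\<forall>a\<in>set (drop e A). a \<le> x" using ins_bump.hyps(1) by (auto dest: in_set_dropD)
      ultimately have "word_equiv ((drop e A @ y # B) @ [x]) (y # drop e A @ x # B)"
        using ins_bump.hyps(2) by (intro row_bump_equiv)
      from word_equiv_append[OF this, of "tail_word e T" "[]"]
      have "word_equiv (tail_word e ((A @ y # B) # T) @ [x]) ((tail_word e T @ [y]) @ drop e A @ x # B)"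
        using that(1) by simp
      also have "word_equiv ((tail_word e T @ [y]) @ drop e A @ x # B) ((v @ [z] @ w) @ drop e A @ x # B)"
        using word_equiv_append[OF that(2), of "[]"] by simp
      finally (word_equiv_trans) show ?thesis by simp
    qed
    have dA: "d \<le> length A" using True ins_bump.prems(2) by simp
    have "drop c A = drop (c - d) (drop d A)" using ins_bump.prems(2) by simp
    then have "subseq (drop c A) (drop d A)"
      by (metis append_take_drop_id list_emb_append2 subseq_order.order_refl)
    then have "subseq (s @ drop c A @ x # B) (s2 @ drop d A @ x # B)"
      by (rule list_emb_append_mono[OF IH(4) list_emb_append_mono[OF _ subseq_order.order_refl]])
    moreover have "tail_word c ((A @ x # B) # T') = u @ s @ drop c A @ x # B"
      using True IH(2) by simp
    moreover have "length g + Suc k = col_len d ((A @ y # B) # T)"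
      "dec_len UNIV u + Suc k \<le> col_len c ((A @ y # B) # T)"
      using IH(8,9) True dA by simp_all
    ultimately show ?thesis
      using lift[OF True IH(1)] lift[OF dA IH(3)] IH(5-7) by blast
  qed
qed

text \<open>Modulo equivalence, the word up to column \<open>d\<close> gains only \<open>x\<close>,
  which lies outside \<open>U\<close>; further right it also loses a letter.\<close>

lemma dec_len_insert_le:
  assumes "row_insert x q T T' r d" "tab T" "upset U" "x \<notin> U"
  shows "dec_len U (tail_word c T') \<le> dec_len U (tail_word c T)"
proof (cases "c \<le> d")
  case True
  then show ?thesis
    using word_equiv_dec_len[OF tail_word_insert_equiv[OF assms(1,2) True] assms(3)] assms(4)
    by (simp add: dec_len_snoc_notin)
next
  case False
  then obtain u y s where *: "word_equiv (tail_word c T @ [x]) (u @ [y] @ s)" "tail_word c T' = u @ s"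
    using tail_word_insert_split[OF assms(1,2), of c] by auto
  have "dec_len U (u @ s) \<le> dec_len U (u @ [y] @ s)"
    by (intro dec_len_mono list_emb_append_mono) auto
  then show ?thesis
    using * word_equiv_dec_len[OF *(1) assms(3)] assms(4) by (simp add: dec_len_snoc_notin)
qed

lemma dec_len_insert_eq:
  assumes "row_insert x q T T' r d" "tab T" "upset U" "x \<notin> U" "c \<le> d"
  shows "dec_len U (tail_word c T') = dec_len U (tail_word c T)"
  using word_equiv_dec_len[OF tail_word_insert_equiv[OF assms(1,2,5)] assms(3)] assms(4)
  by (simp add: dec_len_snoc_notin)

text \<open>The chain of bumped letters followed by \<open>x\<close> has the full length of the
  lengthened column and stays in \<open>U\<close>. So column \<open>d\<close> of the new key lies
  entirely in \<open>U\<close>.\<close>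

lemma dec_len_insert_new_column:
  assumes "row_insert x q T T' r d" "tab T" "upset U" "x \<in> U"
  shows "dec_len U (tail_word d T') = Suc (col_len d T)"
proof (rule antisym)
  obtain g where g: "subseq g (tail_word d T)" "sorted_wrt (>) g" "\<forall>z\<in>set g. x < z"
      "length g = col_len d T"
    using bump_chain[OF assms(1,2)] by blast
  have eq: "dec_len V (tail_word d T') = dec_len V (tail_word d T @ [x])" if "upset V" for V
    using word_equiv_dec_len[OF tail_word_insert_equiv[OF assms(1,2)] that] by simp
  have "length (g @ [x]) \<le> dec_len U (tail_word d T @ [x])"
    using g assms(3,4)
    by (intro dec_len_ge) (auto intro!: list_emb_append_mono simp: sorted_wrt_append upset_def dest: less_imp_le)
  then show "Suc (col_len d T) \<le> dec_len U (tail_word d T')" using g(4) eq[OF assms(3)] by simp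
  have "dec_len U (tail_word d T @ [x]) \<le> Suc (dec_len UNIV (tail_word d T))"
    using dec_len_mono[OF subseq_order.order_refl, of U UNIV "tail_word d T"]
      dec_len_mono[OF subseq_order.order_refl, of "U \<inter> {x<..}" UNIV "tail_word d T"]
    by (auto simp: dec_len_snoc)
  then show "dec_len U (tail_word d T') \<le> Suc (col_len d T)"
    using eq[OF assms(3)] col_len_eq[OF assms(2)] by simp
qed

text \<open>If the count in a column \<open>c > d\<close> drops, every maximal chain of large letters used the
  letter \<open>y\<close> that leaves; continuing its lower part by bumped letters gives the bound.\<close>

lemma low_len_drop:
  assumes ins: "row_insert x q T T' r d" and T: "tab T" and U: "upset U" "x \<notin> U" and c: "d < c"
    and drop: "dec_len U (tail_word c T') < dec_len U (tail_word c T)"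
  shows "low_len U d T \<le> low_len U c T"
proof -
  obtain u y s u2 s2 g k where *: "word_equiv (tail_word c T @ [x]) (u @ [y] @ s)"
      "tail_word c T' = u @ s" "word_equiv (tail_word d T @ [x]) (u2 @ [y] @ s2)" "subseq s s2"
      "subseq g u2" "sorted_wrt (>) g" "\<forall>a\<in>set g. y < a" "length g + k = col_len d T"
      "dec_len UNIV u + k \<le> col_len c T"
    using tail_word_insert_split[OF ins T c] by blast
  have ec: "dec_len U (tail_word c T) = dec_len U (u @ [y] @ s)"
    using word_equiv_dec_len[OF *(1) U(1)] U(2) by (simp add: dec_len_snoc_notin)
  have ed: "dec_len U (tail_word d T) = dec_len U (u2 @ [y] @ s2)"
    using word_equiv_dec_len[OF *(3) U(1)] U(2) by (simp add: dec_len_snoc_notin)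
  obtain t where t: "subseq t (u @ [y] @ s)" "sorted_wrt (>) t" "set t \<subseteq> U"
      "length t = dec_len U (u @ [y] @ s)"
    using dec_len_witness by blast
  obtain t1 t2 t3 where tt: "t = t1 @ t2 @ t3" "subseq t1 u" "subseq t2 [y]" "subseq t3 s"
    using t(1) by (metis subseq_appendE)
  have "t2 \<noteq> []"
  proof
    assume "t2 = []"
    then have "subseq t (u @ s)" using tt by (auto intro!: list_emb_append_mono)
    then have "length t \<le> dec_len U (u @ s)" using t by (intro dec_len_ge)
    then show False using drop *(2) ec t(4) by simp
  qed
  then have t2: "t2 = [y]" using tt(3) by (cases t2) (auto simp: subseq_Cons2_iff split: if_splits)
  have "length t1 \<le> dec_len UNIV u"
    using tt t(2) by (intro dec_len_ge) (auto simp: sorted_wrt_append)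
  moreover have "length (g @ [y] @ t3) \<le> dec_len U (u2 @ [y] @ s2)"
  proof (rule dec_len_ge)
    show "subseq (g @ [y] @ t3) (u2 @ [y] @ s2)"
      using *(4,5) tt(4) by (intro list_emb_append_mono) (auto intro: subseq_order.trans)
    have y3: "\<forall>z\<in>set t3. z < y" using t(2) tt(1) t2 by (auto simp: sorted_wrt_append)
    then show "sorted_wrt (>) (g @ [y] @ t3)"
      using *(6,7) t(2) tt(1) t2 by (force simp: sorted_wrt_append)
    have "y \<in> U" using t(3) tt(1) t2 by simp
    then have "set g \<subseteq> U" using *(7) U(1) by (auto simp: upset_def dest: less_imp_le)
    then show "set (g @ [y] @ t3) \<subseteq> U" using t(3) tt(1) t2 by auto
  qed
  \<comment> \<open>The chain count in column \<open>c\<close> is at most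
    \<open>col_len c T - k + 1 + length t3\<close>, and that in column \<open>d\<close> is at least
    \<open>col_len d T - k + 1 + length t3\<close>. Subtraction from the column lengths gives the
    claim.\<close>
  ultimately show ?thesis
    using *(8,9) ec ed t(4) tt(1) t2 low_len_add[OF T, of U c] low_len_add[OF T, of U d] by simp
qed

section \<open>The Robinson-Schensted-Knuth correspondence\<close>

definition row_len :: "nat \<Rightarrow> 'a list list \<Rightarrow> nat" where
  "row_len r Q = (if r < length Q then length (Q ! r) else 0)"

lemma row_len_simps [simp]: "row_len r [] = 0" "row_len 0 (R # Q) = length R"
    "row_len (Suc r) (R # Q) = row_len r Q"
  by (auto simp: row_len_def)

lemma tail_word_add_cell:
  "row_len r Q < c \<Longrightarrow> tail_word c (add_cell n r Q) = tail_word c Q"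
  by (induction n r Q rule: add_cell.induct) auto

lemma column_word_add_cell:
  "r \<le> length Q \<Longrightarrow> c \<noteq> row_len r Q \<Longrightarrow> column_word c (add_cell n r Q) = column_word c Q"
  by (induction n r Q rule: add_cell.induct) (auto simp: nth_append)

text \<open>Rows below the new cell are at most as long as its row was before, so they do not reach
  its column, and the new letter opens the word.\<close>

lemma tail_word_add_cell_new:
  "tab Q \<Longrightarrow> tail_word (row_len r Q) (add_cell n r Q) = n # tail_word (row_len r Q) Q \<and>
    column_word (row_len r Q) (add_cell n r Q) = n # column_word (row_len r Q) Q"
proof (induction n r Q rule: add_cell.induct)
  case (2 n R Q)
  then show ?case using tab_empty_tail[of R Q "length R"] by auto
qed auto

lemma mset_add_cell: "mset (concat (add_cell n r Q)) = add_mset n (mset (concat Q))"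
  by (induction n r Q rule: add_cell.induct) auto

lemma set_add_cell: "set (concat (add_cell n r Q)) = insert n (set (concat Q))"
  using arg_cong[OF mset_add_cell[of n r Q], of set_mset] by simp

lemma set_tail_word: "set (tail_word c T) \<subseteq> set (concat T)"
  by (induction T) (auto dest: in_set_dropD)

lemma col_len_shape: "map length P = map length Q \<Longrightarrow> col_len c P = col_len c Q"
proof (induction P arbitrary: Q)
  case (Cons R P) then show ?case by (cases Q) auto
qed simp

text \<open>The columns left of \<open>d\<close> agree and are peeled off one after the other;
  together they form the common factor \<open>C\<close>.\<close>

lemma columns_equiv:
  assumes "tab Q" "tab Q'" "\<And>k. k < d \<Longrightarrow> column_word k Q' = column_word k Q" "c \<le> d"
  shows "\<exists>C. set C \<subseteq> set (concat Q) \<and> word_equiv (tail_word c Q) (C @ tail_word d Q) \<and>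
    word_equiv (tail_word c Q') (C @ tail_word d Q')"
  using assms(4)
proof (induction rule: inc_induct)
  case base
  then show ?case by (intro exI[of _ "[]"]) simp
next
  case (step k)
  then obtain C where C: "set C \<subseteq> set (concat Q)" "word_equiv (tail_word (Suc k) Q) (C @ tail_word d Q)"
      "word_equiv (tail_word (Suc k) Q') (C @ tail_word d Q')" by blast
  let ?K = "column_word k Q"
  have eq: "word_equiv (tail_word k T) ((?K @ C) @ tail_word d T)"
    if "tab T" "column_word k T = ?K" "word_equiv (tail_word (Suc k) T) (C @ tail_word d T)" for T
    using word_equiv_trans[OF tail_word_column_equiv[OF that(1), of k]
        word_equiv_append[OF that(3), of "column_word k T" "[]", simplified]] that(2) by simp
  have "set (?K @ C) \<subseteq> set (concat Q)"
    using C(1) set_column_word[of k Q] set_tail_word[of k Q] by auto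
  then show ?case
    using eq[OF assms(1) refl C(2)] eq[OF assms(2) assms(3)[OF step(2)] C(3)] by blast
qed

text \<open>The words become \<open>C @ W\<close> and \<open>C @ [n] @ W\<close>. As no letter of
  \<open>C\<close> exceeds \<open>n\<close>, a chain through \<open>n\<close> begins there and
  continues in \<open>W\<close>, the word from the new column on.\<close>

lemma dec_len_add_cell:
  assumes "tab Q" "tab (add_cell n r Q)" "r \<le> length Q" "\<forall>z\<in>set (concat Q). z \<le> n" "upset U"
    "c \<le> row_len r Q"
  shows "dec_len U (tail_word c (add_cell n r Q)) \<le>
      max (dec_len U (tail_word c Q)) (Suc (dec_len U (tail_word (row_len r Q) Q)))"
    and "dec_len U (tail_word c Q) \<le> dec_len U (tail_word c (add_cell n r Q))"
proof -
  let ?d = "row_len r Q"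
  obtain C where C: "set C \<subseteq> set (concat Q)" "word_equiv (tail_word c Q) (C @ tail_word ?d Q)"
      "word_equiv (tail_word c (add_cell n r Q)) (C @ tail_word ?d (add_cell n r Q))"
    using columns_equiv[OF assms(1,2) _ assms(6)] column_word_add_cell[OF assms(3)] by auto
  let ?W = "tail_word ?d Q"
  have e: "dec_len U (tail_word c Q) = dec_len U (C @ ?W)"
      "dec_len U (tail_word c (add_cell n r Q)) = dec_len U (C @ [n] @ ?W)"
    using word_equiv_dec_len[OF C(2) assms(5)] word_equiv_dec_len[OF C(3) assms(5)]
      tail_word_add_cell_new[OF assms(1), of r n] by simp_all
  show "dec_len U (tail_word c Q) \<le> dec_len U (tail_word c (add_cell n r Q))"
    unfolding e by (intro dec_len_mono list_emb_append_mono[OF subseq_order.order_refl]) auto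
  obtain t where t: "subseq t (C @ [n] @ ?W)" "sorted_wrt (>) t" "set t \<subseteq> U"
      "length t = dec_len U (C @ [n] @ ?W)"
    using dec_len_witness by blast
  obtain t1 t2 t3 where tt: "t = t1 @ t2 @ t3" "subseq t1 C" "subseq t2 [n]" "subseq t3 ?W"
    using t(1) by (metis subseq_appendE)
  show "dec_len U (tail_word c (add_cell n r Q)) \<le> max (dec_len U (tail_word c Q)) (Suc (dec_len U ?W))"
  proof (cases "t2 = []")
    case True
    have "subseq (t1 @ t3) (C @ ?W)" using tt by (intro list_emb_append_mono)
    then have "length t \<le> dec_len U (C @ ?W)"
      using t(2,3) tt(1) True by (intro dec_len_ge) auto
    then show ?thesis using t(4) e by simp
  next
    case False
    then have t2: "t2 = [n]" using tt(3) by (cases t2) (auto simp: subseq_Cons2_iff split: if_splits)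
    have "t1 = []"
    proof (rule ccontr)
      assume "t1 \<noteq> []"
      then obtain z where z: "z \<in> set t1" by (cases t1) auto
      then have "n < z" using t(2) tt(1) t2 by (auto simp: sorted_wrt_append)
      moreover have "z \<le> n" using assms(4) C(1) in_set_subseq[OF tt(2) z] by auto
      ultimately show False by simp
    qed
    moreover have "length t3 \<le> dec_len U ?W"
      using t tt by (intro dec_len_ge) (auto simp: sorted_wrt_append)
    ultimately show ?thesis using t(4) tt(1) t2 e by simp
  qed
qed

lemma dec_len_add_cell_new:
  assumes "tab Q" "upset U" "n \<in> U" "\<forall>z\<in>set (tail_word (row_len r Q) Q). z < n"
  shows "dec_len U (tail_word (row_len r Q) (add_cell n r Q)) = Suc (dec_len U (tail_word (row_len r Q) Q))"
proof -
  have "dec_len (U \<inter> {..<n}) (tail_word (row_len r Q) Q) = dec_len U (tail_word (row_len r Q) Q)"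
    using assms(4) by (intro dec_len_cong) auto
  then show ?thesis using tail_word_add_cell_new[OF assms(1), of r n] assms(3) by simp
qed

text \<open>\<open>P\<close> certifies that the new shape is a partition. The entry above the new
  cell lies in the word from its column on, so the strict bound on that word gives column
  strictness.\<close>

lemma tab_add_cell:
  "tab Q \<Longrightarrow> tab P \<Longrightarrow> map length (add_cell n r Q) = map length P \<Longrightarrow> r \<le> length Q \<Longrightarrow>
    \<forall>z\<in>set (concat Q). z \<le> n \<Longrightarrow> \<forall>z\<in>set (tail_word (row_len r Q) Q). z < n \<Longrightarrow> tab (add_cell n r Q)"
proof (induction n r Q arbitrary: P rule: add_cell.induct)
  case (2 n R Q)
  have "dominates (R @ [n]) Q" using 2 by (cases Q) (auto simp: nth_append)
  then show ?case using 2 by (auto simp: sorted_append)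
next
  case (3 n r R Q)
  obtain A P' where P: "P = A # P'" using 3 by (cases P) auto
  have len: "length A = length R" "map length (add_cell n r Q) = map length P'" using 3 P by auto
  have t: "tab (add_cell n r Q)" using 3 P by (intro "3.IH"[of P']) auto
  have "dominates R (add_cell n r Q)"
  proof (cases Q)
    case Nil
    then have "R ! 0 \<in> set R" "R \<noteq> []" using 3 by auto
    then show ?thesis using 3 Nil by auto
  next
    case (Cons S Q')
    show ?thesis
    proof (cases r)
      case 0
      obtain B P'' where P': "P' = B # P''" "length B = Suc (length S)" using len(2) Cons 0 by (cases P') auto
      then have l: "length S < length R" using 3 P len(1) by auto
      then have "R ! length S \<in> set (drop (length S) R)" by (simp add: Cons_nth_drop_Suc[symmetric])
      then have "R ! length S < n" using 3 Cons 0 by auto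
      then show ?thesis using l 3 Cons 0 by (auto simp: nth_append less_Suc_eq)
    next
      case (Suc r')
      then show ?thesis using 3 Cons by auto
    qed
  qed
  then show ?case using t 3 by simp
qed simp

text \<open>The most recent letter is at the front of the word.\<close>

inductive rsk :: "('a::linorder \<times> 'b::linorder) list \<Rightarrow> 'b list list \<Rightarrow> 'a list list \<Rightarrow> bool" where
  rsk_Nil: "rsk [] [] []"
| rsk_Cons: "rsk w P Q \<Longrightarrow> row_insert x q P P' r d \<Longrightarrow> rsk ((n, x) # w) P' (add_cell n r Q)"

definition lex_desc :: "('a::linorder \<times> 'b::linorder) list \<Rightarrow> bool" where
  "lex_desc w \<longleftrightarrow> sorted_wrt (\<lambda>p q. fst q < fst p \<or> fst q = fst p \<and> snd q \<le> snd p) w"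

lemma rsk_exists: "\<exists>P Q. rsk w P Q"
proof (induction w)
  case (Cons p w)
  then obtain P Q where PQ: "rsk w P Q" by blast
  obtain q P' r d where "row_insert (snd p) q P P' r d" using row_insert_exists by blast
  then show ?case using rsk_Cons[OF PQ, of "snd p" q P' r d "fst p"] by auto
qed (auto intro: rsk_Nil)

lemma rsk_det: "rsk w P Q \<Longrightarrow> rsk w P' Q' \<Longrightarrow> P' = P \<and> Q' = Q"
proof (induction arbitrary: P' Q' rule: rsk.induct)
  case rsk_Nil then show ?case by (auto elim: rsk.cases)
next
  case (rsk_Cons w P Q x q P1 r d n)
  from rsk_Cons.prems obtain P0 Q0 q0 r0 d0 where
      *: "rsk w P0 Q0" "row_insert x q0 P0 P' r0 d0" "Q' = add_cell n r0 Q0"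
    by (auto elim: rsk.cases)
  then have "P0 = P" "Q0 = Q" using rsk_Cons.IH by auto
  then show ?case using * row_insert_det[OF rsk_Cons.hyps(2)] by metis
qed

lemma rsk_basic:
  "rsk w P Q \<Longrightarrow> tab P \<and> map length P = map length Q \<and> mset (concat P) = mset (map snd w) \<and>
    mset (concat Q) = mset (map fst w)"
proof (induction rule: rsk.induct)
  case (rsk_Cons w P Q x q P1 r d n)
  then show ?case
    using tab_row_insert[OF rsk_Cons.hyps(2)] row_insert_shape[OF rsk_Cons.hyps(2), of Q n]
      row_insert_mset[OF rsk_Cons.hyps(2)] mset_add_cell[of n r Q] by auto
qed simp

lemma rsk_step:
  assumes "rsk w P Q" "row_insert x q P P' r d"
  shows "d = row_len r Q" "r \<le> length Q" "map length (add_cell n r Q) = map length P'"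
  using row_insert_shape[OF assms(2), of Q n] rsk_basic[OF assms(1)] map_eq_imp_length_eq[of length P length Q]
  by (auto simp: row_len_def)

lemma rsk_le_fst:
  assumes "rsk w P Q" "lex_desc (p # w)" shows "\<forall>z\<in>set (concat Q). z \<le> fst p"
proof -
  have "set (concat Q) = set (map fst w)"
    using rsk_basic[OF assms(1)] by (metis set_mset_mset)
  then show ?thesis using assms(2) by (auto simp: lex_desc_def)
qed

text \<open>By the row bumping lemma equal letters of \<open>Q\<close> are added from left to right, so the newest
  letter \<open>n\<close> is the rightmost of its kind.\<close>

lemma rsk_tab:
  "rsk w P Q \<Longrightarrow> lex_desc w \<Longrightarrow> tab Q \<and> (\<forall>n x w0. w = (n, x) # w0 \<longrightarrow>
    (\<exists>P0 Q0 q r d. rsk w0 P0 Q0 \<and> row_insert x q P0 P r d \<and> Q = add_cell n r Q0 \<and> tab Q0 \<and>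
      (\<forall>z\<in>set (tail_word d Q0). z < n) \<and> (\<forall>z\<in>set (tail_word (Suc d) Q). z < n)))"
proof (induction rule: rsk.induct)
  case (rsk_Cons w P Q x q P1 r d n)
  note step = rsk_step(1,2)[OF rsk_Cons.hyps] rsk_step(3)[OF rsk_Cons.hyps, where n = n]
  have lex: "lex_desc w" using rsk_Cons.prems by (simp add: lex_desc_def)
  have tQ: "tab Q" using rsk_Cons.IH[OF lex] by simp
  have le: "\<forall>z\<in>set (concat Q). z \<le> n" using rsk_le_fst[OF rsk_Cons.hyps(1) rsk_Cons.prems] by simp
  have lt: "z < n" if "z \<in> set (tail_word d Q)" for z
  proof (cases w)
    case Nil
    then show ?thesis using rsk_Cons.hyps(1) that by (auto elim: rsk.cases)
  next
    case (Cons p w0)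
    obtain n0 x0 where p: "p = (n0, x0)" by (cases p)
    obtain P0 Q0 q0 r0 d0 where *: "rsk w0 P0 Q0" "row_insert x0 q0 P0 P r0 d0" "Q = add_cell n0 r0 Q0"
        "\<forall>z\<in>set (tail_word (Suc d0) Q). z < n0"
      using rsk_Cons.IH[OF lex] Cons p by blast
    have zc: "z \<in> set (concat Q)" by (rule subsetD[OF set_tail_word that])
    show ?thesis
    proof (cases "n0 < n")
      case True
      have "lex_desc ((n0, x0) # w0)" using lex Cons p by simp
      then have "\<forall>z\<in>set (concat Q0). z \<le> n0" using rsk_le_fst[OF *(1)] by fastforce
      then have "z \<le> n0" using zc *(3) set_add_cell[of n0 r0 Q0] by auto
      then show ?thesis using True by simp
    next
      case False
      then have "n0 = n" "x0 \<le> x" using rsk_Cons.prems Cons p by (auto simp: lex_desc_def)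
      have "tab P0" using rsk_basic[OF *(1)] by simp
      then have "d0 < d" using row_bumping[OF *(2) rsk_Cons.hyps(2)] \<open>x0 \<le> x\<close> by simp
      then have "z \<in> set (tail_word (Suc d0) Q)"
        using in_set_subseq[OF tail_word_antimono[of "Suc d0" d Q] that] by simp
      then show ?thesis using *(4) \<open>n0 = n\<close> by simp
    qed
  qed
  have tP1: "tab P1" using tab_row_insert[OF rsk_Cons.hyps(2)] rsk_basic[OF rsk_Cons.hyps(1)] by simp
  have "tab (add_cell n r Q)"
    using tab_add_cell[OF tQ tP1 step(3) step(2) le] lt step(1) by simp
  moreover have "z < n" if "z \<in> set (tail_word (Suc d) (add_cell n r Q))" for z
  proof -
    have "z \<in> set (tail_word (Suc d) Q)" using that tail_word_add_cell[of r Q "Suc d" n] step(1) by simp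
    then show ?thesis using lt in_set_subseq[OF tail_word_antimono[of d "Suc d" Q]] by simp
  qed
  ultimately show ?case using rsk_Cons.hyps tQ lt by blast
qed simp

text \<open>In every column the right key of \<open>P\<close> has at least as many letters \<open>< b\<close> as the right key of \<open>Q\<close> has
  letters \<open>\<ge> a\<close>.\<close>

definition key_bound :: "'a::linorder \<Rightarrow> 'b::linorder \<Rightarrow> 'b list list \<Rightarrow> 'a list list \<Rightarrow> bool" where
  "key_bound a b P Q \<longleftrightarrow> (\<forall>c. dec_len {a..} (tail_word c Q) \<le> low_len {b..} c P)"

text \<open>If \<open>a\<close> exceeds \<open>n\<close>, no letter of \<open>Q\<close> reaches
  \<open>a\<close> and the bound is vacuous, hence the guard \<open>a \<le> n\<close> on the right.
  If the new pair lies in the quadrant, column \<open>d\<close> of the key of \<open>P'\<close> has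
  no letter below \<open>b\<close>, while that of \<open>Q'\<close> has a letter
  \<open>\<ge> a\<close>. In the remaining case both counts rise by exactly one in column
  \<open>d\<close>.\<close>

lemma key_bound_step:
  assumes ins: "row_insert x q P P' r (row_len r Q)" and tP: "tab P" and tP': "tab P'"
    and tQ: "tab Q" and tQ': "tab (add_cell n r Q)" and r: "r \<le> length Q"
    and shape: "map length P = map length Q" "map length P' = map length (add_cell n r Q)"
    and le: "\<forall>z\<in>set (concat Q). z \<le> n" and lt: "\<forall>z\<in>set (tail_word (row_len r Q) Q). z < n"
  shows "key_bound a b P' (add_cell n r Q) \<longleftrightarrow> \<not> (a \<le> n \<and> b \<le> x) \<and> (a \<le> n \<longrightarrow> key_bound a b P Q)"
proof -
  let ?d = "row_len r Q" and ?Q' = "add_cell n r Q"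
  have col: "col_len c P' = (if c = ?d then Suc (col_len c P) else col_len c P)" for c
    using col_len_shape[OF shape(1), of c] col_len_shape[OF shape(2), of c]
      column_word_add_cell[OF r, of c n] tail_word_add_cell_new[OF tQ, of r n] by (cases "c = ?d") auto
  consider (small) "\<not> a \<le> n" | (bad) "a \<le> n" "b \<le> x" | (good) "a \<le> n" "\<not> b \<le> x" by blast
  then show ?thesis
  proof cases
    case small
    have "dec_len {a..} (tail_word c ?Q') = 0" for c
    proof -
      have "z \<notin> {a..}" if "z \<in> set (tail_word c ?Q')" for z
        using that set_tail_word[of c ?Q'] set_add_cell[of n r Q] le small by fastforce
      then have "dec_len {a..} (tail_word c ?Q') = dec_len {} (tail_word c ?Q')"
        by (intro dec_len_cong) blast
      also have "dec_len {} w = 0" for w :: "'b list" by (induction w) auto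
      finally show ?thesis .
    qed
    then show ?thesis using small by (simp add: key_bound_def)
  next
    case bad
    have "low_len {b..} ?d P' = 0"
      using dec_len_insert_new_column[OF ins tP upset_atLeast, of b] bad(2) col[of ?d]
      by (simp add: low_len_def)
    moreover have "dec_len {a..} (tail_word ?d ?Q') > 0"
      using dec_len_add_cell_new[OF tQ upset_atLeast _ lt, of a] bad(1) by simp
    ultimately show ?thesis using bad unfolding key_bound_def by (metis not_le)
  next
    case good
    have x: "x \<notin> {b..}" using good(2) by simp
    let ?f = "\<lambda>c. dec_len {a..} (tail_word c Q)" and ?f' = "\<lambda>c. dec_len {a..} (tail_word c ?Q')"
    let ?g = "\<lambda>c. low_len {b..} c P" and ?g' = "\<lambda>c. low_len {b..} c P'"
    have gle: "?g c \<le> ?g' c" for c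
      using dec_len_insert_le[OF ins tP upset_atLeast x, of c] col[of c] by (auto simp: low_len_def)
    have gd: "?g' ?d = Suc (?g ?d)"
      using dec_len_insert_eq[OF ins tP upset_atLeast x order_refl] col[of ?d] low_len_add[OF tP, of "{b..}" ?d]
        low_len_add[OF tP', of "{b..}" ?d] by simp
    have glt: "?g' c = ?g c" if "c < ?d" for c
      using dec_len_insert_eq[OF ins tP upset_atLeast x, of c] col[of c] that by (simp add: low_len_def)
    have fd: "?f' ?d = Suc (?f ?d)"
      using dec_len_add_cell_new[OF tQ upset_atLeast _ lt, of a] good(1) by simp
    have fgt: "?f' c = ?f c" if "?d < c" for c using tail_word_add_cell[OF that, of n] by simp
    note fle = dec_len_add_cell[OF tQ tQ' r le upset_atLeast, of _ a]
    have "key_bound a b P Q \<Longrightarrow> key_bound a b P' ?Q'"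
    proof -
      assume kb: "key_bound a b P Q"
      have "?f' c \<le> ?g' c" for c
      proof (cases "c \<le> ?d")
        case True
        \<comment> \<open>Besides old chains only one starting with \<open>n\<close> can be longer,
          and its length is governed by column \<open>d\<close>. There the bound holds after the
          insertion, and \<open>?g'\<close> is at least as large further left.\<close>
        have "?f' c \<le> max (?f c) (Suc (?f ?d))" by (rule fle(1)[OF True])
        also have "\<dots> \<le> max (?g c) (?g' ?d)" using kb gd unfolding key_bound_def by (intro max.mono) auto
        also have "\<dots> \<le> ?g' c" using gle[of c] low_len_antimono[OF tP' upset_atLeast True] by simp
        finally show ?thesis .
      next
        case False
        then show ?thesis using fgt[of c] gle[of c] kb unfolding key_bound_def by (metis not_le order_trans)
      qed
      then show "key_bound a b P' ?Q'" by (simp add: key_bound_def)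
    qed
    moreover have "\<not> key_bound a b P' ?Q'" if "\<not> key_bound a b P Q"
    proof -
      have "\<exists>c. ?g c < ?f c" using that unfolding key_bound_def by (meson not_le)
      then obtain c where c: "?g c < ?f c" by blast
      \<comment> \<open>A violation either survives in its own column or is moved to column
        \<open>d\<close>, where both sides grow by one. The move is needed when \<open>?g\<close>
        rises at some \<open>c > d\<close>, and \<open>low_len_drop\<close> then gives
        \<open>?g d \<le> ?g c < ?f c \<le> ?f d\<close>.\<close>
      have "?g ?d < ?f ?d \<or> (\<exists>c'. ?g' c' < ?f' c')"
      proof (cases "c \<le> ?d")
        case True
        show ?thesis
        proof (cases "c = ?d")
          case False
          then have "?g' c < ?f' c" using True glt[of c] fle(2)[OF True] c by simp
          then show ?thesis by blast
        qed (use c in simp)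
      next
        case False
        then have dc: "?d < c" by simp
        show ?thesis
        proof (cases "dec_len {b..} (tail_word c P') < dec_len {b..} (tail_word c P)")
          case True
          have "?g ?d \<le> ?g c" by (rule low_len_drop[OF ins tP upset_atLeast x dc True])
          moreover have "?f c \<le> ?f ?d"
            using dc by (intro dec_len_mono tail_word_antimono) auto
          ultimately show ?thesis using c by simp
        next
          case False
          then have "?g' c = ?g c"
            using dec_len_insert_le[OF ins tP upset_atLeast x, of c] col[of c] dc by (simp add: low_len_def)
          then show ?thesis using fgt[OF dc] c by metis
        qed
      qed
      then have "\<exists>c'. ?g' c' < ?f' c'" using gd fd by (metis Suc_less_eq)
      then show ?thesis unfolding key_bound_def by (auto simp: not_le)
    qed
    ultimately show ?thesis using good by blast
  qed
qed

text \<open>First coordinates are inserted in increasing order, so \<open>n\<close> is the largest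
  so far. For \<open>a\<close> above \<open>n\<close> no pair meets the quadrant, which absorbs the
  guard in \<open>key_bound_step\<close>.\<close>

theorem rsk_key_bound:
  "rsk w P Q \<Longrightarrow> lex_desc w \<Longrightarrow> key_bound a b P Q \<longleftrightarrow> (\<forall>(i, j)\<in>set w. \<not> (a \<le> i \<and> b \<le> j))"
proof (induction rule: rsk.induct)
  case rsk_Nil
  then show ?case by (simp add: key_bound_def)
next
  case (rsk_Cons w P Q x q P1 r d n)
  note step = rsk_step(1,2)[OF rsk_Cons.hyps] rsk_step(3)[OF rsk_Cons.hyps, where n = n]
  have full: "rsk ((n, x) # w) P1 (add_cell n r Q)" by (rule rsk.rsk_Cons[OF rsk_Cons.hyps])
  have lex: "lex_desc w" using rsk_Cons.prems by (simp add: lex_desc_def)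
  obtain P0 Q0 q0 r0 d0 where *: "rsk w P0 Q0" "row_insert x q0 P0 P1 r0 d0" "\<forall>z\<in>set (tail_word d0 Q0). z < n"
    using rsk_tab[OF full rsk_Cons.prems] by blast
  have "P0 = P" "Q0 = Q" using rsk_det[OF rsk_Cons.hyps(1) *(1)] by auto
  moreover have "d0 = d" using row_insert_det[OF rsk_Cons.hyps(2)] *(2) calculation by blast
  ultimately have lt: "\<forall>z\<in>set (tail_word (row_len r Q) Q). z < n" using *(3) step(1) by simp
  have le: "\<forall>z\<in>set (concat Q). z \<le> n" using rsk_le_fst[OF rsk_Cons.hyps(1) rsk_Cons.prems] by simp
  have "key_bound a b P1 (add_cell n r Q) \<longleftrightarrow> \<not> (a \<le> n \<and> b \<le> x) \<and> (a \<le> n \<longrightarrow> key_bound a b P Q)"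
    using rsk_basic[OF rsk_Cons.hyps(1)] rsk_basic[OF full] rsk_tab[OF rsk_Cons.hyps(1) lex]
      rsk_tab[OF full rsk_Cons.prems] rsk_Cons.hyps(2) step
    by (intro key_bound_step le lt) auto
  also have "\<dots> \<longleftrightarrow> (\<forall>(i, j)\<in>set ((n, x) # w). \<not> (a \<le> i \<and> b \<le> j))"
  proof -
    have "\<forall>(i, j)\<in>set w. i \<le> n" using rsk_Cons.prems by (auto simp: lex_desc_def)
    then show ?thesis using rsk_Cons.IH[OF lex] by fastforce
  qed
  finally show ?case .
qed

section \<open>Inverting the correspondence\<close>

lemma remove_largest:
  "tab Q \<Longrightarrow> \<forall>z\<in>set (concat Q). z \<le> n \<Longrightarrow> n \<in> set (concat Q) \<Longrightarrow>
    \<exists>r Q0. Q = add_cell n r Q0 \<and> tab Q0 \<and> r \<le> length Q0 \<and> (\<forall>z\<in>set (tail_word (row_len r Q0) Q0). z < n)"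
proof (induction Q)
  case (Cons R T)
  show ?case
  proof (cases "n \<in> set R")
    case True
    \<comment> \<open>Copies of the largest letter form a horizontal strip. The one in the topmost
      row that contains \<open>n\<close> is the rightmost, and nothing lies to its right or below
      it.\<close>
    have ne: "R \<noteq> []" and srt: "sorted R" using Cons.prems by auto
    define S where "S = butlast R"
    have R: "R = S @ [last R]" using ne by (simp add: S_def)
    have "last R = n"
    proof (rule antisym)
      show "last R \<le> n" using Cons.prems ne by auto
      show "n \<le> last R" using True srt R by (metis Un_iff in_set_conv_decomp set_ConsD set_append sorted_append list.set_intros(1) empty_iff list.set(1) order_refl)
    qed
    then have R': "R = S @ [n]" using R by simp
    have noT: "length (hd T) \<le> length S" if "T \<noteq> []"
    proof (rule ccontr)
      assume "\<not> ?thesis"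
      then have "R ! length S < hd T ! length S" "length S < length (hd T)"
        using Cons.prems that by (cases T; auto)+
      moreover have "hd T ! length S \<in> set (concat (R # T))"
        using that calculation by (cases T) auto
      ultimately show False using Cons.prems(2) R' by (auto simp: not_le[symmetric])
    qed
    show ?thesis
    proof (cases "S = []")
      case True
      then have "T = []" using noT Cons.prems by (cases T) auto
      then show ?thesis using R' True by (intro exI[of _ 0] exI[of _ "[]"]) simp
    next
      case False
      have "dominates S T" using Cons.prems noT R' by (cases T) (auto simp: nth_append)
      then have tS: "tab (S # T)" using Cons.prems False srt R' by (simp add: sorted_append)
      moreover have "tail_word (length S) (S # T) = []" using tab_empty_tail[OF tS] by simp
      ultimately show ?thesis using R' by (intro exI[of _ 0] exI[of _ "S # T"]) simp
    qed
  next
    case False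
    then have "n \<in> set (concat T)" using Cons.prems by simp
    then obtain r Q0 where *: "T = add_cell n r Q0" "tab Q0" "r \<le> length Q0"
        "\<forall>z\<in>set (tail_word (row_len r Q0) Q0). z < n"
      using Cons by auto
    have "dominates R Q0"
    proof (cases Q0)
      case (Cons S Q1)
      have dom: "dominates R (add_cell n r (S # Q1))" using Cons \<open>tab (R # T)\<close> *(1) by simp
      show ?thesis
      proof (cases r)
        case 0
        have "R ! k < S ! k" if "k < length S" for k
        proof -
          have "R ! k < (S @ [n]) ! k" using dom 0 that by simp
          then show ?thesis using that by (simp add: nth_append)
        qed
        then show ?thesis using dom 0 Cons by simp
      qed (use dom Cons in auto)
    qed simp
    then have "tab (R # Q0)" using Cons.prems *(2) by simp
    moreover have "\<forall>z\<in>set (drop c R). z < n" for c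
      using False Cons.prems(2) by (auto dest!: in_set_dropD simp: less_le)
    ultimately show ?thesis using * by (intro exI[of _ "Suc r"] exI[of _ "R # Q0"]) auto
  qed
qed simp

lemma add_cell_corner:
  "tab Q \<Longrightarrow> r \<le> length Q \<Longrightarrow> r < length (add_cell n r Q) \<and>
    (Suc r < length (add_cell n r Q) \<longrightarrow> length (add_cell n r Q ! Suc r) < length (add_cell n r Q ! r))"
proof (induction n r Q rule: add_cell.induct)
  case (2 n R Q) then show ?case by (cases Q) auto
qed auto

lemma add_cell_shape_inj:
  "map length (add_cell n r A) = map length (add_cell m r B) \<Longrightarrow> [] \<notin> set A \<Longrightarrow> [] \<notin> set B \<Longrightarrow>
    r \<le> length A \<Longrightarrow> r \<le> length B \<Longrightarrow> map length A = map length B"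
proof (induction n r A arbitrary: B rule: add_cell.induct)
  case (1 n r) then show ?case by (cases B) auto
next
  case (2 n R A) then show ?case by (cases B) auto
next
  case (3 n r R A) then show ?case by (cases B) auto
qed

lemma add_cell_inj:
  "add_cell n r A = add_cell n r B \<Longrightarrow> [] \<notin> set A \<Longrightarrow> [] \<notin> set B \<Longrightarrow>
    r \<le> length A \<Longrightarrow> r \<le> length B \<Longrightarrow> A = B"
proof (induction n r A arbitrary: B rule: add_cell.induct)
  case (1 n r) then show ?case by (cases B) auto
next
  case (2 n R A) then show ?case by (cases B) auto
next
  case (3 n r R A) then show ?case by (cases B) auto
qed

lemma tab_no_empty_row: "tab T \<Longrightarrow> [] \<notin> set T"
  by (induction T) auto

text \<open>Undo the last step: remove the rightmost largest letter \<open>n\<close> of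
  \<open>Q\<close> and insert backwards from that corner of \<open>P\<close>. If the preceding pair
  were \<open>(n, x0)\<close> with \<open>x0 > x\<close>, row bumping would place its
  \<open>n\<close> weakly right of the removed one, against the choice of the cell.\<close>

theorem rsk_surj:
  "tab P \<Longrightarrow> tab Q \<Longrightarrow> map length P = map length Q \<Longrightarrow> \<exists>w. lex_desc w \<and> rsk w P Q"
proof (induction "length (concat Q)" arbitrary: P Q)
  case 0
  then have "Q = []" by (cases Q) auto
  then show ?case using 0 by (intro exI[of _ "[]"]) (auto simp: lex_desc_def rsk_Nil)
next
  case (Suc k)
  define n where "n = Max (set (concat Q))"
  have ne: "set (concat Q) \<noteq> {}" using Suc(2) by force
  have n: "n \<in> set (concat Q)" "\<forall>z\<in>set (concat Q). z \<le> n"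
    using Max_in[OF finite_set ne] Max_ge[OF finite_set] unfolding n_def by blast+
  obtain r Q0 where Q: "Q = add_cell n r Q0" "tab Q0" "r \<le> length Q0"
      "\<forall>z\<in>set (tail_word (row_len r Q0) Q0). z < n"
    using remove_largest[OF Suc(4) n(2,1)] by blast
  have sh: "map length P = map length (add_cell n r Q0)" using Suc Q by simp
  have ix: "length (P ! i) = length (add_cell n r Q0 ! i)" if "i < length P" for i
    using that sh by (metis length_map nth_map)
  have "length P = length (add_cell n r Q0)" using sh by (metis length_map)
  then obtain x q P0 d where ins: "row_insert x q P0 P r d" and tP0: "tab P0"
    using row_insert_backward[OF Suc(3), of r] add_cell_corner[OF Q(2,3), of n] ix[of r] ix[of "Suc r"]
    by (metis Suc_lessD)
  have sP: "map length (add_cell x r P0) = map length P" "r \<le> length P0" "d = row_len r P0"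
    using row_insert_shape[OF ins refl, of x] by (auto simp: row_len_def)
  have sh0: "map length P0 = map length Q0"
    using sP sh Q tP0 by (intro add_cell_shape_inj[of x r P0 n Q0] tab_no_empty_row) auto
  have "length (concat Q) = Suc (length (concat Q0))"
    using arg_cong[OF mset_add_cell[of n r Q0], of size] Q(1) by simp
  then obtain w where w: "lex_desc w" "rsk w P0 Q0" using Suc(1)[OF _ tP0 Q(2) sh0] Suc(2) by auto
  have d: "d = row_len r Q0" using rsk_step(1)[OF w(2) ins] .
  have "lex_desc ((n, x) # w)"
  proof (cases w)
    case (Cons p w0)
    obtain n0 x0 where p: "p = (n0, x0)" by (cases p)
    have "n0 \<in> set (map fst w)" using Cons p by simp
    then have "n0 \<in> set (concat Q0)" using rsk_basic[OF w(2)] by (metis set_mset_mset)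
    then have le: "n0 \<le> n" using n(2) Q(1) set_add_cell[of n r Q0] by auto
    have "x0 \<le> x" if "n0 = n"
    proof (rule ccontr)
      assume "\<not> x0 \<le> x"
      obtain P1 Q1 q1 r1 d1 where *: "rsk w0 P1 Q1" "row_insert x0 q1 P1 P0 r1 d1" "Q0 = add_cell n0 r1 Q1"
          "tab Q1"
        using rsk_tab[OF w(2,1)] Cons p by blast
      have "tab P1" using rsk_basic[OF *(1)] by simp
      then have "d \<le> d1" using row_bumping[OF *(2) ins] \<open>\<not> x0 \<le> x\<close> by simp
      moreover have "n0 \<in> set (tail_word d1 Q0)"
        unfolding *(3) rsk_step(1)[OF *(1,2)] using tail_word_add_cell_new[OF *(4), of r1 n0] by simp
      ultimately have "n0 \<in> set (tail_word d Q0)" using in_set_subseq[OF tail_word_antimono[of d d1 Q0]] by simp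
      then show False using Q(4) d that by auto
    qed
    then have "n0 < n \<or> n0 = n \<and> x0 \<le> x" using le by auto
    then show ?thesis using w(1) Cons p by (fastforce simp: lex_desc_def)
  qed (simp add: lex_desc_def)
  moreover have "rsk ((n, x) # w) P Q" using rsk_Cons[OF w(2) ins, of n] Q(1) by simp
  ultimately show ?case by blast
qed

lemma col_len_corner:
  "tab Q \<Longrightarrow> tab (add_cell n r Q) \<Longrightarrow> r \<le> length Q \<Longrightarrow> col_len (row_len r Q) (add_cell n r Q) = Suc r"
proof (induction n r Q rule: add_cell.induct)
  case (2 n R Q)
  then show ?case using tab_empty_tail[of R Q "length R"] by auto
next
  case (3 n r R Q)
  have IH: "col_len (row_len r Q) (add_cell n r Q) = Suc r" using 3 by auto
  obtain S Q' where S: "add_cell n r Q = S # Q'" by (cases "add_cell n r Q") (use IH in auto)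
  have tS: "tab (S # Q')" using 3(3) S by simp
  have "row_len r Q < length S"
  proof (rule ccontr)
    assume "\<not> row_len r Q < length S"
    then have "column_word (row_len r Q) (S # Q') = []" using tab_empty_tail[OF tS] by simp
    then show False using IH unfolding S by simp
  qed
  then have "row_len r Q < length R" using 3 S by auto
  then show ?case using IH by simp
qed auto

text \<open>The last cell can be read off from \<open>Q\<close>: its column is the rightmost one
  containing the largest letter, and the height of that column gives its row. Hence the last step is
  reversible without knowing the word.\<close>

theorem rsk_inj: "rsk w P Q \<Longrightarrow> lex_desc w \<Longrightarrow> rsk w' P Q \<Longrightarrow> lex_desc w' \<Longrightarrow> w' = w"
proof (induction w arbitrary: w' P Q)
  case Nil
  then have "P = []" by (auto elim: rsk.cases)
  then have "mset (map snd w') = {#}" using rsk_basic[OF Nil(3)] by simp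
  then show ?case by simp
next
  case (Cons p w)
  have "length w' = length (p # w)"
    using rsk_basic[OF Cons.prems(1)] rsk_basic[OF Cons.prems(3)] by (metis length_map size_mset)
  then obtain p' v where w': "w' = p' # v" by (cases w') auto
  obtain n x n' x' where p: "p = (n, x)" "p' = (n', x')" by (cases p; cases p')
  have fst_max: "m \<in> set (concat Q)" "\<forall>z\<in>set (concat Q). z \<le> m" if "rsk ((m, y) # u) P Q" "lex_desc ((m, y) # u)" for m y u
  proof -
    have "set (concat Q) = set (map fst ((m, y) # u))" using rsk_basic[OF that(1)] by (metis set_mset_mset)
    then show "m \<in> set (concat Q)" "\<forall>z\<in>set (concat Q). z \<le> m" using that(2) by (auto simp: lex_desc_def)
  qed
  have n: "n' = n"
    using fst_max[of n x w] fst_max[of n' x' v] Cons.prems w' p by (auto intro: antisym)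
  obtain P0 Q0 q r d where A: "rsk w P0 Q0" "row_insert x q P0 P r d" "Q = add_cell n r Q0" "tab Q0"
      "\<forall>z\<in>set (tail_word (Suc d) Q). z < n"
    using rsk_tab[OF Cons.prems(1,2)] p by blast
  obtain P1 Q1 q1 r1 d1 where B: "rsk v P1 Q1" "row_insert x' q1 P1 P r1 d1" "Q = add_cell n r1 Q1" "tab Q1"
      "\<forall>z\<in>set (tail_word (Suc d1) Q). z < n"
    using rsk_tab[OF Cons.prems(3,4)] p w' n by blast
  note sA = rsk_step(1,2)[OF A(1,2)] and sB = rsk_step(1,2)[OF B(1,2)]
  have in1: "n \<in> set (tail_word d Q)" "n \<in> set (tail_word d1 Q)"
    using tail_word_add_cell_new[OF A(4), of r n] tail_word_add_cell_new[OF B(4), of r1 n] sA(1) sB(1) A(3) B(3)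
    by simp_all
  have "\<not> d < d1" using A(5) in_set_subseq[OF tail_word_antimono[of "Suc d" d1 Q] in1(2)] by auto
  moreover have "\<not> d1 < d" using B(5) in_set_subseq[OF tail_word_antimono[of "Suc d1" d Q] in1(1)] by auto
  ultimately have d: "d1 = d" by simp
  have tQ: "tab Q" using rsk_tab[OF Cons.prems(1,2)] by simp
  have "col_len d Q = Suc r"
    unfolding A(3) sA(1) by (rule col_len_corner[OF A(4) tQ[unfolded A(3)] sA(2)])
  moreover have "col_len d1 Q = Suc r1"
    unfolding B(3) sB(1) by (rule col_len_corner[OF B(4) tQ[unfolded B(3)] sB(2)])
  ultimately have r: "r1 = r" using d by simp
  have "add_cell n r Q0 = add_cell n r Q1" using A(3) B(3) r by metis
  then have "Q0 = Q1"
    by (rule add_cell_inj[OF _ tab_no_empty_row[OF A(4)] tab_no_empty_row[OF B(4)] sA(2) sB(2)[unfolded r]])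
  moreover have "x' = x \<and> P1 = P0"
    using row_insert_backward_det[OF A(2)] B(2) r rsk_basic[OF A(1)] rsk_basic[OF B(1)] by blast
  ultimately have "v = w"
    using Cons.IH[OF A(1) _ _ ] B(1) Cons.prems(2,4) w' p by (auto simp: lex_desc_def)
  then show ?case using w' p n \<open>x' = x \<and> P1 = P0\<close> by simp
qed

section \<open>Multisets of pairs as sorted words\<close>

lemma lex_desc_insert: "lex_desc w \<Longrightarrow> \<exists>w'. mset w' = add_mset p (mset w) \<and> lex_desc w'"
proof (induction w)
  case Nil
  show ?case by (intro exI[of _ "[p]"]) (simp add: lex_desc_def)
next
  case (Cons a w)
  let ?R = "\<lambda>p q. fst q < fst p \<or> fst q = fst p \<and> snd q \<le> snd p"
  show ?case
  proof (cases "?R p a")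
    case True
    then have "lex_desc (p # a # w)" using Cons.prems by (fastforce simp: lex_desc_def)
    then show ?thesis by (intro exI[of _ "p # a # w"]) simp
  next
    case False
    obtain w' where w': "mset w' = add_mset p (mset w)" "lex_desc w'"
      using Cons by (auto simp: lex_desc_def)
    have "set w' = insert p (set w)" using w'(1) by (metis set_mset_add_mset_insert set_mset_mset)
    moreover have "?R a p" using False by auto
    ultimately have "lex_desc (a # w')" using w'(2) Cons.prems by (auto simp: lex_desc_def)
    then show ?thesis using w'(1) by (intro exI[of _ "a # w'"]) (simp add: add_mset_commute)
  qed
qed

lemma lex_desc_exists: "\<exists>w. mset w = A \<and> lex_desc w"
proof (induction A)
  case empty
  show ?case by (simp add: lex_desc_def)
next
  case (add p A)
  then show ?case using lex_desc_insert by metis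
qed

lemma lex_desc_unique: "lex_desc w \<Longrightarrow> lex_desc w' \<Longrightarrow> mset w = mset w' \<Longrightarrow> w = w'"
proof (induction w arbitrary: w')
  case (Cons p w)
  then obtain p' v where w': "w' = p' # v" by (cases w') auto
  have in2: "p \<in> set w'" "p' \<in> set (p # w)" using Cons.prems(3) w' by (metis list.set_intros(1) set_mset_mset)+
  have "p = p' \<or> fst p' < fst p \<or> fst p' = fst p \<and> snd p' \<le> snd p"
    using in2(2) Cons.prems(1) by (auto simp: lex_desc_def)
  moreover have "p = p' \<or> fst p < fst p' \<or> fst p = fst p' \<and> snd p \<le> snd p'"
    using in2(1) Cons.prems(2) w' by (auto simp: lex_desc_def)
  ultimately have "p = p'" by (auto simp: prod_eq_iff)
  then show ?case using Cons w' by (auto simp: lex_desc_def)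
qed simp

section \<open>Fillings, right keys and the correspondence\<close>

definition fill :: "'a list list \<Rightarrow> 'a filling" where
  "fill T = (\<lambda>(r, c). if r < length T \<and> c < length (T ! r) then Some (T ! r ! c) else None)"

lemma dom_fill: "dom (fill T) = {(r, c). r < length T \<and> c < length (T ! r)}"
  by (auto simp: fill_def split: if_splits)

lemma fill_nth: "r < length T \<Longrightarrow> c < length (T ! r) \<Longrightarrow> the (fill T (r, c)) = T ! r ! c"
  by (simp add: fill_def)

lemma tail_word_concat: "tail_word c T = concat (map (drop c) (rev T))"
  by (induction T) auto

lemma in_tail_word: "r < length T \<Longrightarrow> c < length (T ! r) \<Longrightarrow> T ! r ! c \<in> set (tail_word c T)"
  by (auto simp: tail_word_concat in_set_conv_nth[of "T ! r"] Cons_nth_drop_Suc[symmetric] intro!: bexI[of _ "T ! r"])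

lemma tab_nth_row: "tab T \<Longrightarrow> r < length T \<Longrightarrow> T ! r \<noteq> [] \<and> sorted (T ! r)"
  by (induction T arbitrary: r) (auto simp: nth_Cons')

lemma tab_nth_column:
  "tab T \<Longrightarrow> r < r' \<Longrightarrow> r' < length T \<Longrightarrow> c < length (T ! r') \<Longrightarrow>
    c < length (T ! r) \<and> T ! r ! c < T ! r' ! c"
proof (induction T arbitrary: r r')
  case (Cons R T)
  obtain k where k: "r' = Suc k" using Cons.prems by (cases r') auto
  show ?case
  proof (cases r)
    case 0
    have in_tw: "T ! k ! c \<in> set (tail_word c T)" using Cons.prems k by (intro in_tail_word) auto
    have "c < length R"
    proof (rule ccontr)
      assume "\<not> c < length R"
      then have "tail_word c (R # T) = []" using tab_empty_tail[OF Cons.prems(1)] by simp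
      then show False using in_tw by simp
    qed
    then show ?thesis using tab_below_greater[OF Cons.prems(1) _ in_tw] 0 k by simp
  next
    case (Suc j)
    then show ?thesis using Cons.IH[of j k] Cons.prems k by auto
  qed
qed simp

lemma tabI:
  "(\<And>r. r < length T \<Longrightarrow> T ! r \<noteq> [] \<and> sorted (T ! r)) \<Longrightarrow>
   (\<And>r. Suc r < length T \<Longrightarrow> length (T ! Suc r) \<le> length (T ! r) \<and>
      (\<forall>c<length (T ! Suc r). T ! r ! c < T ! Suc r ! c)) \<Longrightarrow> tab T"
proof (induction T)
  case (Cons R T)
  have "tab T" using Cons.prems(1)[of "Suc r" for r] Cons.prems(2)[of "Suc r" for r] by (intro Cons.IH) auto
  moreover have "dominates R T" using Cons.prems(2)[of 0] by (cases T) auto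
  ultimately show ?case using Cons.prems(1)[of 0] by simp
qed simp

lemma Tab_eq_fill:
  assumes "is_partition \<nu>"
  shows "Tab B \<nu> = fill ` {T. tab T \<and> map length T = \<nu> \<and> set (concat T) \<subseteq> B}"
proof (intro equalityI subsetI)
  fix F assume "F \<in> fill ` {T. tab T \<and> map length T = \<nu> \<and> set (concat T) \<subseteq> B}"
  then obtain T where T: "F = fill T" "tab T" "map length T = \<nu>" "set (concat T) \<subseteq> B" by auto
  have len: "length T = length \<nu>" "\<And>r. r < length T \<Longrightarrow> length (T ! r) = \<nu> ! r"
    using T(3) by (metis length_map, metis nth_map)
  have dom: "dom F = diagram \<nu>" using T(1) len by (auto simp: dom_fill diagram_def)
  have "ran F \<subseteq> B"
  proof
    fix z assume "z \<in> ran F"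
    then obtain r c where "r < length T" "c < length (T ! r)" "z = T ! r ! c"
      using T(1) by (auto simp: ran_def fill_def split: if_splits)
    then have "z \<in> set (concat T)" by (auto intro!: bexI[of _ "T ! r"])
    then show "z \<in> B" using T(4) by blast
  qed
  moreover have "the (F (r, c)) \<le> the (F (r, c'))"
    if "c < c'" "(r, c) \<in> dom F" "(r, c') \<in> dom F" for r c c'
    using that T(1) tab_nth_row[OF T(2), of r] by (auto simp: dom_fill fill_nth intro!: sorted_nth_mono)
  moreover have "the (F (r, c)) < the (F (r', c))"
    if "r < r'" "(r, c) \<in> dom F" "(r', c) \<in> dom F" for r r' c
    using that T(1) tab_nth_column[OF T(2), of r r' c] by (auto simp: dom_fill fill_nth)
  ultimately show "F \<in> Tab B \<nu>" using dom by (auto simp: Tab_def)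
next
  fix F assume F: "F \<in> Tab B \<nu>"
  have dom: "dom F = diagram \<nu>" and ran: "ran F \<subseteq> B"
    and row: "\<And>r c c'. c < c' \<Longrightarrow> (r, c) \<in> dom F \<Longrightarrow> (r, c') \<in> dom F \<Longrightarrow> the (F (r, c)) \<le> the (F (r, c'))"
    and col: "\<And>r r' c. r < r' \<Longrightarrow> (r, c) \<in> dom F \<Longrightarrow> (r', c) \<in> dom F \<Longrightarrow> the (F (r, c)) < the (F (r', c))"
    using F unfolding Tab_def by blast+
  define T where "T = map (\<lambda>r. map (\<lambda>c. the (F (r, c))) [0..<\<nu> ! r]) [0..<length \<nu>]"
  have len: "length T = length \<nu>" "\<And>r. r < length \<nu> \<Longrightarrow> length (T ! r) = \<nu> ! r"
    by (simp_all add: T_def)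
  have nth: "T ! r ! c = the (F (r, c))" if "(r, c) \<in> diagram \<nu>" for r c
    using that by (simp add: T_def diagram_def)
  have "F = fill T"
  proof
    fix p show "F p = fill T p"
    proof (cases "p \<in> diagram \<nu>")
      case True
      then have "p \<in> dom F" using dom by simp
      then have "F p = Some (the (F p))" by auto
      then show ?thesis using True nth len by (cases p) (auto simp: fill_def diagram_def)
    next
      case False
      then have "F p = None" using dom by auto
      then show ?thesis using False len by (cases p) (auto simp: fill_def diagram_def)
    qed
  qed
  moreover have "map length T = \<nu>" using len by (auto intro: nth_equalityI)
  moreover have "set (concat T) \<subseteq> B"
  proof
    fix z assume "z \<in> set (concat T)"
    then obtain r c where rc: "r < length \<nu>" "c < \<nu> ! r" "z = the (F (r, c))"
      by (auto simp: T_def)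
    then have "(r, c) \<in> dom F" using dom by (auto simp: diagram_def)
    then have "F (r, c) = Some z" using rc(3) by auto
    then have "z \<in> ran F" by (rule ranI)
    then show "z \<in> B" using ran by blast
  qed
  moreover have "tab T"
  proof (rule tabI)
    fix r assume r: "r < length T"
    have "\<nu> ! r > 0"
      using assms r len(1) unfolding is_partition_def by (metis gr0I nth_mem)
    then have "T ! r \<noteq> []" using len r by (metis length_greater_0_conv)
    moreover have "sorted (T ! r)"
      unfolding sorted_iff_nth_mono_less
    proof (intro allI impI)
      fix i j assume ij: "i < j" "j < length (T ! r)"
      then have "(r, i) \<in> diagram \<nu>" "(r, j) \<in> diagram \<nu>" using r len by (auto simp: diagram_def)
      then show "T ! r ! i \<le> T ! r ! j" using row[OF ij(1)] dom nth by simp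
    qed
    ultimately show "T ! r \<noteq> [] \<and> sorted (T ! r)" ..
  next
    fix r assume r: "Suc r < length T"
    have le: "\<nu> ! Suc r \<le> \<nu> ! r"
      using assms r len(1) unfolding is_partition_def by (auto simp: sorted_wrt_iff_nth_less)
    have "T ! r ! c < T ! Suc r ! c" if "c < length (T ! Suc r)" for c
    proof -
      have "(r, c) \<in> diagram \<nu>" "(Suc r, c) \<in> diagram \<nu>" using that r len le by (auto simp: diagram_def)
      then show ?thesis using col[of r "Suc r" c] dom nth by simp
    qed
    then show "length (T ! Suc r) \<le> length (T ! r) \<and> (\<forall>c<length (T ! Suc r). T ! r ! c < T ! Suc r ! c)"
      using le r len by simp
  qed
  ultimately show "F \<in> fill ` {T. tab T \<and> map length T = \<nu> \<and> set (concat T) \<subseteq> B}" by blast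
qed

lemma fill_inj:
  assumes "fill T = fill T'" "map length T = map length T'" shows "T = T'"
proof (rule nth_equalityI)
  show len: "length T = length T'" using assms(2) by (metis length_map)
  fix r assume r: "r < length T"
  have l: "length (T ! r) = length (T' ! r)" using assms(2) r len by (metis nth_map)
  show "T ! r = T' ! r"
  proof (rule nth_equalityI[OF l])
    fix c assume "c < length (T ! r)"
    then show "T ! r ! c = T' ! r ! c"
      using fill_nth[of r T c] fill_nth[of r T' c] assms(1) r len l by simp
  qed
qed

section \<open>Right keys of fillings and entrywise bounds\<close>

lemma reading_word_fill:
  assumes "tab T" shows "reading_word (fill T) c = tail_word c T"
proof -
  have fd: "fst ` dom (fill T) = {0..<length T}"
  proof
    show "{0..<length T} \<subseteq> fst ` dom (fill T)"
    proof
      fix r assume "r \<in> {0..<length T}"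
      then have "(r, 0) \<in> dom (fill T)" using tab_nth_row[OF assms, of r] by (simp add: dom_fill)
      then show "r \<in> fst ` dom (fill T)" by force
    qed
  qed (auto simp: dom_fill)
  have rowset: "{k. c \<le> k \<and> (r, k) \<in> dom (fill T)} = {c..<length (T ! r)}" if "r < length T" for r
    using that by (auto simp: dom_fill)
  have row: "map (\<lambda>k. the (fill T (r, k))) (sorted_list_of_set {k. c \<le> k \<and> (r, k) \<in> dom (fill T)}) = drop c (T ! r)"
    if "r < length T" for r
    unfolding rowset[OF that] using that by (intro nth_equalityI) (auto simp: fill_nth)
  have "map (\<lambda>r. map (\<lambda>k. the (fill T (r, k))) (sorted_list_of_set {k. c \<le> k \<and> (r, k) \<in> dom (fill T)}))
      (rev [0..<length T]) = map (\<lambda>r. drop c (T ! r)) (rev [0..<length T])"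
    by (rule map_cong) (simp_all add: row)
  then have "reading_word (fill T) c = concat (map (\<lambda>r. drop c (T ! r)) (rev [0..<length T]))"
    unfolding reading_word_def fd by (simp only: sorted_list_of_set_range)
  also have "map (\<lambda>r. drop c (T ! r)) (rev [0..<length T]) = map (drop c) (map ((!) T) (rev [0..<length T]))"
    by simp
  also have "map ((!) T) (rev [0..<length T]) = rev T"
    by (simp only: rev_map[symmetric] map_nth)
  finally show ?thesis by (simp add: tail_word_concat)
qed

text \<open>Turns entrywise comparison of sorted columns into the counts supplied by
  \<open>card_key_set\<close>: the right side says that at most \<open>i\<close> elements lie below
  \<open>v\<close>.\<close>

lemma le_nth_sorted_list_of_set:
  assumes "finite (A :: 'a::linorder set)" "i < card A"
  shows "v \<le> sorted_list_of_set A ! i \<longleftrightarrow> card A \<le> i + card (A \<inter> {v..})"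
proof -
  let ?L = "sorted_list_of_set A"
  have L: "sorted ?L" "distinct ?L" "set ?L = A" "length ?L = card A" using assms(1) by auto
  have sub: "card (set (drop k ?L)) = card A - k" for k
    using L distinct_card[of "drop k ?L"] by simp
  show ?thesis
  proof
    assume v: "v \<le> ?L ! i"
    have "set (drop i ?L) \<subseteq> A \<inter> {v..}"
    proof
      fix z assume "z \<in> set (drop i ?L)"
      then obtain k where k: "k < length (drop i ?L)" "z = drop i ?L ! k" by (metis in_set_conv_nth)
      then have "z = ?L ! (i + k)" "i + k < length ?L" by auto
      then have "?L ! i \<le> z" "z \<in> A"
        using sorted_nth_mono[OF L(1), of i "i + k"] nth_mem[of "i + k" ?L] L(3) by simp_all
      then show "z \<in> A \<inter> {v..}" using v by auto
    qed
    then have "card (set (drop i ?L)) \<le> card (A \<inter> {v..})" using assms(1) by (intro card_mono) auto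
    then have "card A - i \<le> card (A \<inter> {v..})" using sub[of i] by simp
    then show "card A \<le> i + card (A \<inter> {v..})" by simp
  next
    assume le: "card A \<le> i + card (A \<inter> {v..})"
    show "v \<le> ?L ! i"
    proof (rule ccontr)
      assume "\<not> v \<le> ?L ! i"
      have "A \<inter> {v..} \<subseteq> set (drop (Suc i) ?L)"
      proof
        fix z assume z: "z \<in> A \<inter> {v..}"
        then obtain k where k: "k < length ?L" "z = ?L ! k" using L(3) by (metis IntD1 in_set_conv_nth)
        have "i < k"
        proof (rule ccontr)
          assume "\<not> i < k"
          then have "?L ! k \<le> ?L ! i" using L assms(2) by (intro sorted_nth_mono) auto
          then show False using z k \<open>\<not> v \<le> ?L ! i\<close> by auto
        qed
        then have "z = drop (Suc i) ?L ! (k - Suc i)" "k - Suc i < length (drop (Suc i) ?L)" using k by auto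
        then show "z \<in> set (drop (Suc i) ?L)" by (metis nth_mem)
      qed
      then have "card (A \<inter> {v..}) \<le> card A - Suc i" using sub[of "Suc i"] by (metis card_mono finite_set)
      then show False using le assms(2) by simp
    qed
  qed
qed

text \<open>Entries are compared through thresholds: at index \<open>i\<close> either side reaches
  \<open>v\<close> iff some chain in letters \<open>\<ge> v\<close> is longer than \<open>i\<close>.
  For the supremum, a word with such a letter is cut off behind index \<open>i\<close>, its earlier
  letters being larger still.\<close>

lemma sup_words_eq: "sup_words (decreasing_subwords u) = rev (sorted_list_of_set (key_set u))"
proof (rule nth_equalityI)
  let ?W = "decreasing_subwords u" and ?K = "key_set u"
  have sub: "length w \<le> length u" "set w \<subseteq> set u" if "w \<in> ?W" for w
    using that by (auto simp: decreasing_subwords_def dest: list_emb_length in_set_subseq)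
  have "?W \<subseteq> {w. set w \<subseteq> set u \<and> length w \<le> length u}" using sub by blast
  then have finW: "finite ?W" by (rule finite_subset) (rule finite_lists_length_le, simp)
  have neW: "[] \<in> ?W" by (simp add: decreasing_subwords_def)
  have cK: "card ?K = dec_len UNIV u" using card_key_set[OF upset_UNIV, of u] by simp
  have "Max (length ` ?W) = dec_len UNIV u"
  proof (rule Max_eqI)
    show "finite (length ` ?W)" using finW by simp
    show "y \<le> dec_len UNIV u" if "y \<in> length ` ?W" for y
      using that dec_len_ge[of _ u UNIV] by (auto simp: decreasing_subwords_def)
    show "dec_len UNIV u \<in> length ` ?W"
      using dec_len_witness[of u UNIV] by (force simp: decreasing_subwords_def image_iff)
  qed
  then show len: "length (sup_words ?W) = length (rev (sorted_list_of_set ?K))"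
    by (simp add: sup_words_def cK)
  fix i assume "i < length (sup_words ?W)"
  then have i: "i < card ?K" using len by simp
  let ?E = "{w ! i |w. w \<in> ?W \<and> i < length w}"
  have nth: "sup_words ?W ! i = Max ?E" using i len by (simp add: sup_words_def)
  have finE: "finite ?E" by (rule finite_subset[of _ "(\<lambda>w. w ! i) ` ?W"]) (use finW in auto)
  obtain s where "subseq s u" "sorted_wrt (>) s" "length s = dec_len UNIV u"
    using dec_len_witness[of u UNIV] by blast
  then have neE: "?E \<noteq> {}" using i cK by (auto simp: decreasing_subwords_def)
  have "v \<le> Max ?E \<longleftrightarrow> i < dec_len {v..} u" for v
  proof -
    have "v \<le> Max ?E \<longleftrightarrow> (\<exists>w\<in>?W. i < length w \<and> v \<le> w ! i)"
      using Max_ge_iff[OF finE neE] by blast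
    also have "\<dots> \<longleftrightarrow> i < dec_len {v..} u"
    proof
      assume "\<exists>w\<in>?W. i < length w \<and> v \<le> w ! i"
      then obtain w where w: "subseq w u" "sorted_wrt (>) w" "i < length w" "v \<le> w ! i"
        by (auto simp: decreasing_subwords_def)
      have "subseq (take (Suc i) w) u" using w(1) by (metis append_take_drop_id list_emb_append2 prefix_imp_subseq subseq_order.trans take_is_prefix)
      moreover have "sorted_wrt (>) (take (Suc i) w)" using w(2) by (rule sorted_wrt_take)
      moreover have "set (take (Suc i) w) \<subseteq> {v..}"
      proof
        fix z assume "z \<in> set (take (Suc i) w)"
        then obtain k where k: "k \<le> i" "z = w ! k" by (auto simp: in_set_conv_nth less_Suc_eq_le)
        then have "w ! i \<le> z" using w(2,3) by (cases "k = i") (auto simp: sorted_wrt_iff_nth_less intro: less_imp_le)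
        then show "z \<in> {v..}" using w(4) by simp
      qed
      ultimately have "length (take (Suc i) w) \<le> dec_len {v..} u" by (rule dec_len_ge)
      then show "i < dec_len {v..} u" using w(3) by simp
    next
      assume a: "i < dec_len {v..} u"
      obtain s where s: "subseq s u" "sorted_wrt (>) s" "set s \<subseteq> {v..}" "length s = dec_len {v..} u"
        using dec_len_witness by blast
      have "s ! i \<in> set s" using s(4) a by simp
      then have "v \<le> s ! i" using s(3) by auto
      then show "\<exists>w\<in>?W. i < length w \<and> v \<le> w ! i" using s a by (auto simp: decreasing_subwords_def)
    qed
    finally show ?thesis .
  qed
  moreover have "v \<le> rev (sorted_list_of_set ?K) ! i \<longleftrightarrow> i < dec_len {v..} u" for v
  proof -
    have "rev (sorted_list_of_set ?K) ! i = sorted_list_of_set ?K ! (card ?K - Suc i)"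
      using i by (simp add: rev_nth)
    then show ?thesis
      using le_nth_sorted_list_of_set[of ?K "card ?K - Suc i" v] i card_key_set[OF upset_atLeast, of u v] by auto
  qed
  ultimately have "v \<le> Max ?E \<longleftrightarrow> v \<le> rev (sorted_list_of_set ?K) ! i" for v by blast
  then show "sup_words ?W ! i = rev (sorted_list_of_set ?K) ! i"
    unfolding nth by (meson antisym order_refl)
qed

abbreviation key_col :: "nat \<Rightarrow> 'a::linorder list list \<Rightarrow> 'a set" where
  "key_col c T \<equiv> key_set (tail_word c T)"

lemma right_key_fill:
  "tab T \<Longrightarrow> right_key (fill T) = filling_of_columns (\<lambda>c. sorted_list_of_set (key_col c T))"
  by (simp add: right_key_def reading_word_fill sup_words_eq)

lemma filling_of_columns_eq_iff: "filling_of_columns v = filling_of_columns w \<longleftrightarrow> v = w"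
proof
  assume eq: "filling_of_columns v = filling_of_columns w"
  show "v = w"
  proof
    fix c
    have e: "(if r < length (v c) then Some (v c ! r) else None) = (if r < length (w c) then Some (w c ! r) else None)" for r
      using fun_cong[OF eq, of "(r, c)"] by (simp add: filling_of_columns_def)
    have "r < length (v c) \<longleftrightarrow> r < length (w c)" for r using e[of r] by (auto split: if_splits)
    then have l: "length (v c) = length (w c)" by (metis linorder_neqE_nat less_irrefl)
    then show "v c = w c" using e by (intro nth_equalityI) (auto split: if_splits, metis option.inject)
  qed
qed simp

lemma map_filling_of_columns: "map_filling f (filling_of_columns w) = filling_of_columns (\<lambda>c. map f (w c))"
  by (auto simp: map_filling_def filling_of_columns_def)

lemma reverse_filling_of_columns: "reverse_columns (filling_of_columns w) = filling_of_columns (\<lambda>c. rev (w c))"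
proof -
  have "column (filling_of_columns w) c = w c" for c
  proof -
    have "{r. (r, c) \<in> dom (filling_of_columns w)} = {0..<length (w c)}"
      by (auto simp: filling_of_columns_def split: if_splits)
    then have "column (filling_of_columns w) c = map (\<lambda>r. the (filling_of_columns w (r, c))) [0..<length (w c)]"
      by (simp add: column_def)
    also have "\<dots> = map ((!) (w c)) [0..<length (w c)]" by (auto simp: filling_of_columns_def)
    finally show ?thesis by (simp add: map_nth)
  qed
  then show ?thesis by (simp add: reverse_columns_def)
qed

lemma filling_le_of_columns:
  "filling_le (filling_of_columns v) (filling_of_columns w) \<longleftrightarrow>
    (\<forall>c. length (v c) = length (w c) \<and> (\<forall>i<length (v c). v c ! i \<le> w c ! i))"
proof -
  have d: "dom (filling_of_columns u) = {(r, c). r < length (u c)}" for u :: "nat \<Rightarrow> 'b list"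
    by (auto simp: filling_of_columns_def split: if_splits)
  have "{(r, c). r < length (v c)} = {(r, c). r < length (w c)} \<longleftrightarrow> (\<forall>c. length (v c) = length (w c))"
  proof
    assume eq: "{(r, c). r < length (v c)} = {(r, c). r < length (w c)}"
    show "\<forall>c. length (v c) = length (w c)"
    proof
      fix c
      have "r < length (v c) \<longleftrightarrow> r < length (w c)" for r using eq by blast
      then show "length (v c) = length (w c)" by (metis linorder_neqE_nat less_irrefl)
    qed
  qed auto
  then show ?thesis unfolding filling_le_def d by (auto simp: filling_of_columns_def)
qed

text \<open>For \<open>l = lam m\<close> this is \<open>B_plus_lam_comp m \<gamma>\<close>.\<close>

definition key_bound_filling :: "(nat \<Rightarrow> 'b::linorder) \<Rightarrow> (nat \<Rightarrow>\<^sub>0 nat) \<Rightarrow> 'b filling" where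
  "key_bound_filling l \<gamma> = reverse_columns (map_filling l (key_tableau \<gamma>))"

lemma key_bound_filling_columns:
  "key_bound_filling l \<gamma> =
    filling_of_columns (\<lambda>c. rev (map l (sorted_list_of_set {i. c + 1 \<le> Poly_Mapping.lookup \<gamma> i})))"
  by (simp add: key_bound_filling_def key_tableau_def map_filling_of_columns reverse_filling_of_columns)

lemma finite_key_column: "finite {i. c + 1 \<le> Poly_Mapping.lookup (\<gamma> :: 'a \<Rightarrow>\<^sub>0 nat) i}"
  by (rule finite_subset[of _ "Poly_Mapping.keys \<gamma>"]) (auto simp: in_keys_iff)

text \<open>A violation at one index supplies the two compared entries as thresholds
  \<open>a\<close> and \<open>b\<close>. Conversely, thresholds with too large a total give a
  violation at the index of the smallest element of \<open>A\<close> that is \<open>\<ge> b\<close>.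
  Thresholds suit an \<open>l\<close> that repeats values, as \<open>lam m\<close> does beyond
  \<open>m\<close>.\<close>

lemma antimono_bound_iff:
  fixes A :: "'b::linorder set" and B :: "'a::linorder set" and l :: "'a \<Rightarrow> 'b"
  assumes fin: "finite A" "finite B" and card: "card A = card B" and l: "antimono l"
  shows "(\<forall>i<card A. sorted_list_of_set A ! i \<le> rev (map l (sorted_list_of_set B)) ! i) \<longleftrightarrow>
    (\<forall>a b. l a < b \<longrightarrow> card (B \<inter> {a..}) + card (A \<inter> {b..}) \<le> card A)"
proof -
  have nth: "rev (map l (sorted_list_of_set B)) ! i = l (sorted_list_of_set B ! (card B - Suc i))"
    if "i < card A" for i
    using that fin card by (simp add: rev_nth)
  show ?thesis
  proof (intro iffI allI impI)
    fix a b assume le: "\<forall>i<card A. sorted_list_of_set A ! i \<le> rev (map l (sorted_list_of_set B)) ! i"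
      and ab: "l a < b"
    show "card (B \<inter> {a..}) + card (A \<inter> {b..}) \<le> card A"
    proof (rule ccontr)
      assume n: "\<not> ?thesis"
      have c: "card (A \<inter> {b..}) \<le> card A" "card (B \<inter> {a..}) \<le> card A"
        using card_mono[OF fin(1), of "A \<inter> {b..}"] card_mono[OF fin(2), of "B \<inter> {a..}"] card
        by simp_all
      define i where "i = card A - card (A \<inter> {b..})"
      have i: "i < card A" using n c by (simp add: i_def)
      have "b \<le> sorted_list_of_set A ! i"
        using le_nth_sorted_list_of_set[OF fin(1) i, of b] c by (simp add: i_def)
      moreover have "a \<le> sorted_list_of_set B ! (card B - Suc i)"
        using le_nth_sorted_list_of_set[OF fin(2), of "card B - Suc i" a] i card n c by (simp add: i_def)
      then have "l (sorted_list_of_set B ! (card B - Suc i)) \<le> l a" using l by (simp add: antimono_def)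
      ultimately show False using le nth[OF i] i ab by fastforce
    qed
  next
    fix i assume le: "\<forall>a b. l a < b \<longrightarrow> card (B \<inter> {a..}) + card (A \<inter> {b..}) \<le> card A" and i: "i < card A"
    show "sorted_list_of_set A ! i \<le> rev (map l (sorted_list_of_set B)) ! i"
    proof (rule ccontr)
      define a b where "a = sorted_list_of_set B ! (card B - Suc i)" and "b = sorted_list_of_set A ! i"
      assume "\<not> ?thesis"
      then have "l a < b" using nth[OF i] by (simp add: a_def b_def)
      then have "card (B \<inter> {a..}) + card (A \<inter> {b..}) \<le> card A" using le by blast
      moreover have "card A \<le> i + card (A \<inter> {b..})"
        using le_nth_sorted_list_of_set[OF fin(1) i, of b] by (simp add: b_def)
      moreover have "card B \<le> card B - Suc i + card (B \<inter> {a..})"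
        using le_nth_sorted_list_of_set[OF fin(2), of "card B - Suc i" a] i card by (simp add: a_def)
      ultimately show False using i card by simp
    qed
  qed
qed

lemma key_bound_iff_card:
  assumes "tab P" "tab Q" "map length P = map length Q"
  shows "key_bound a b P Q \<longleftrightarrow>
    (\<forall>c. card (key_col c Q \<inter> {a..}) + card (key_col c P \<inter> {b..}) \<le> card (key_col c P))"
proof -
  have e: "card (key_col c Q \<inter> {a..}) = dec_len {a..} (tail_word c Q)"
    "card (key_col c P \<inter> {b..}) = dec_len {b..} (tail_word c P)" "card (key_col c P) = col_len c P" for c
    using card_key_set[OF upset_UNIV, of "tail_word c P"] col_len_eq[OF assms(1)]
    by (simp_all add: card_key_set)
  show ?thesis
    unfolding key_bound_def e using low_len_add[OF assms(1)] by (metis add.commute add_le_cancel_left)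
qed

lemma card_key_col: "tab T \<Longrightarrow> card (key_col c T) = col_len c T"
  using card_key_set[OF upset_UNIV, of "tail_word c T"] col_len_eq[of T c] by simp

lemma right_key_le_iff:
  assumes tP: "tab P" and tQ: "tab Q" and sh: "map length P = map length Q" and l: "antimono l"
    and key: "\<And>c. key_col c Q = {i. c + 1 \<le> Poly_Mapping.lookup \<gamma> i}"
  shows "filling_le (right_key (fill P)) (key_bound_filling l \<gamma>) \<longleftrightarrow>
    (\<forall>a b. l a < b \<longrightarrow> key_bound a b P Q)"
proof -
  have card: "card (key_col c P) = card (key_col c Q)" for c
    using card_key_col[OF tP] card_key_col[OF tQ] col_len_shape[OF sh] by simp
  have "filling_le (right_key (fill P)) (key_bound_filling l \<gamma>) \<longleftrightarrow>
    (\<forall>c. \<forall>i<card (key_col c P).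
      sorted_list_of_set (key_col c P) ! i \<le> rev (map l (sorted_list_of_set (key_col c Q))) ! i)"
    unfolding right_key_fill[OF tP] key_bound_filling_columns filling_le_of_columns key[symmetric]
    by (simp add: card)
  also have "\<dots> \<longleftrightarrow> (\<forall>c. \<forall>a b. l a < b \<longrightarrow>
      card (key_col c Q \<inter> {a..}) + card (key_col c P \<inter> {b..}) \<le> card (key_col c P))"
    using antimono_bound_iff[OF finite_key_set finite_key_set card l] by simp
  also have "\<dots> \<longleftrightarrow> (\<forall>a b. l a < b \<longrightarrow> key_bound a b P Q)"
    unfolding key_bound_iff_card[OF tP tQ sh] by blast
  finally show ?thesis .
qed

lemma key_col_empty: "tab T \<Longrightarrow> length (concat T) \<le> c \<Longrightarrow> key_col c T = {}"
proof (cases T)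
  case (Cons R T')
  assume "tab T" "length (concat T) \<le> c"
  then have "tail_word c T = []" using tab_empty_tail[of R T' c] Cons by simp
  then show ?thesis by simp
qed simp

text \<open>The content of the right key, that is, the composition whose key tableau is the right
  key of \<open>T\<close>.\<close>

definition key_comp :: "nat list list \<Rightarrow> (nat \<Rightarrow>\<^sub>0 nat)" where
  "key_comp T = Abs_poly_mapping (\<lambda>i. card {c. i \<in> key_col c T})"

text \<open>By nestedness the key columns that contain \<open>i\<close> form an initial segment, so
  their number determines them.\<close>

lemma key_comp:
  assumes "tab T" shows "key_col c T = {i. c + 1 \<le> Poly_Mapping.lookup (key_comp T) i}"
proof -
  have sub: "{c. i \<in> key_col c T} \<subseteq> {..<length (concat T)}" for i
  proof
    fix c assume "c \<in> {c. i \<in> key_col c T}"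
    then have "key_col c T \<noteq> {}" by auto
    then show "c \<in> {..<length (concat T)}"
      using key_col_empty[OF assms, of c] by (meson lessThan_iff not_le)
  qed
  have fin: "finite {c. i \<in> key_col c T}" for i by (rule finite_subset[OF sub]) simp
  have "{i. card {c. i \<in> key_col c T} \<noteq> 0} \<subseteq> set (concat T)"
  proof
    fix i assume "i \<in> {i. card {c. i \<in> key_col c T} \<noteq> 0}"
    then have "card {c. i \<in> key_col c T} \<noteq> 0" by simp
    then have "{c. i \<in> key_col c T} \<noteq> {}" by (rule contrapos_nn) (simp only: card.empty)
    then obtain c where "i \<in> key_col c T" by blast
    then show "i \<in> set (concat T)" using key_set_subset[of "tail_word c T"] set_tail_word[of c T] by blast
  qed
  then have "finite {i. card {c. i \<in> key_col c T} \<noteq> 0}" by (rule finite_subset) simp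
  then have lk: "Poly_Mapping.lookup (key_comp T) i = card {c. i \<in> key_col c T}" for i
    unfolding key_comp_def by (simp add: Abs_poly_mapping_inverse)
  have iff: "i \<in> key_col c T \<longleftrightarrow> c < card {c. i \<in> key_col c T}" for i
  proof
    assume i: "i \<in> key_col c T"
    have "{..c} \<subseteq> {c. i \<in> key_col c T}"
    proof
      fix k assume "k \<in> {..c}"
      then have "key_col c T \<subseteq> key_col k T" using key_set_tail_mono[OF assms, of k c] by simp
      then show "k \<in> {c. i \<in> key_col c T}" using i by blast
    qed
    then have "card {..c} \<le> card {c. i \<in> key_col c T}" by (rule card_mono[OF fin])
    then show "c < card {c. i \<in> key_col c T}" by simp
  next
    assume c: "c < card {c. i \<in> key_col c T}"
    show "i \<in> key_col c T"
    proof (rule ccontr)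
      assume "i \<notin> key_col c T"
      have "{c. i \<in> key_col c T} \<subseteq> {..<c}"
      proof
        fix k assume "k \<in> {c. i \<in> key_col c T}"
        then have "\<not> key_col k T \<subseteq> key_col c T" using \<open>i \<notin> key_col c T\<close> by blast
        then show "k \<in> {..<c}" using key_set_tail_mono[OF assms, of c k] by (cases "k < c") simp_all
      qed
      then have "card {c. i \<in> key_col c T} \<le> card {..<c}" by (intro card_mono) auto
      then show False using c by simp
    qed
  qed
  show ?thesis
  proof (rule set_eqI)
    fix i show "i \<in> key_col c T \<longleftrightarrow> i \<in> {i. c + 1 \<le> Poly_Mapping.lookup (key_comp T) i}"
      unfolding mem_Collect_eq lk Suc_eq_plus1[symmetric] Suc_le_eq by (rule iff)
  qed
qed

text \<open>Compares conjugate partitions: the multiplicity of a part is the difference of two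
  consecutive column lengths.\<close>

lemma partition_eqI:
  assumes "is_partition \<mu>" "is_partition \<nu>" "\<And>c. length (filter (\<lambda>k. c < k) \<mu>) = length (filter (\<lambda>k. c < k) \<nu>)"
  shows "\<mu> = \<nu>"
proof -
  have cnt: "length (filter (\<lambda>j. k - 1 < j) l) = count (mset l) k + length (filter (\<lambda>j. k < j) l)"
    if "k > 0" for k :: nat and l
    using that by (induction l) auto
  have "count (mset \<mu>) k = count (mset \<nu>) k" for k
  proof (cases "k = 0")
    case True
    then show ?thesis using assms(1,2) by (simp add: is_partition_def count_eq_zero_iff[THEN iffD2])
  next
    case False
    then show ?thesis using cnt[of k \<mu>] cnt[of k \<nu>] assms(3) by simp
  qed
  then have m: "mset \<mu> = mset \<nu>" by (simp add: multiset_eq_iff)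
  have s: "sorted (rev \<mu>)" "sorted (rev \<nu>)"
    using assms(1,2) by (auto simp: is_partition_def sorted_wrt_rev)
  have "rev \<mu> = rev \<nu>" using m s by (metis mset_rev properties_for_sort)
  then show ?thesis by simp
qed

lemma tab_partition: "tab T \<Longrightarrow> is_partition (map length T)"
proof (induction T)
  case (Cons R T)
  have "length S \<le> length R" if "S \<in> set T" for S
  proof -
    from that obtain r where r: "r < length T" "S = T ! r" by (auto simp: in_set_conv_nth)
    show ?thesis
    proof (rule ccontr)
      assume "\<not> ?thesis"
      then have "length R < length ((R # T) ! Suc r)" using r(2) by simp
      then have "length R < length ((R # T) ! 0)"
        using tab_nth_column[OF Cons.prems, of 0 "Suc r" "length R"] r(1) by simp
      then show False by simp
    qed
  qed
  then show ?case using Cons by (auto simp: is_partition_def)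
qed (simp add: is_partition_def)

lemma col_len_filter: "col_len c T = length (filter (\<lambda>k. c < k) (map length T))"
  by (induction T) auto

lemma sorted_composition_props:
  "is_partition (sorted_composition \<gamma>)"
  "mset (sorted_composition \<gamma>) = image_mset (Poly_Mapping.lookup \<gamma>) (mset_set (Poly_Mapping.keys \<gamma>))"
  "length (filter (\<lambda>k. c < k) (sorted_composition \<gamma>)) = card {i. c + 1 \<le> Poly_Mapping.lookup \<gamma> i}"
proof -
  show m: "mset (sorted_composition \<gamma>) = image_mset (Poly_Mapping.lookup \<gamma>) (mset_set (Poly_Mapping.keys \<gamma>))"
    by (simp add: sorted_composition_def)
  have "set (sorted_composition \<gamma>) = Poly_Mapping.lookup \<gamma> ` Poly_Mapping.keys \<gamma>"
    using arg_cong[OF m, of set_mset] by simp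
  then have "0 \<notin> set (sorted_composition \<gamma>)" by (auto simp: in_keys_iff)
  then show "is_partition (sorted_composition \<gamma>)"
    by (simp add: is_partition_def sorted_composition_def sorted_wrt_rev)
  have "length (filter (\<lambda>k. c < k) (sorted_composition \<gamma>)) = size (filter_mset (\<lambda>k. c < k) (mset (sorted_composition \<gamma>)))"
    by (metis mset_filter size_mset)
  also have "\<dots> = card {i \<in> Poly_Mapping.keys \<gamma>. c < Poly_Mapping.lookup \<gamma> i}"
    unfolding m by (simp add: filter_mset_image_mset)
  also have "{i \<in> Poly_Mapping.keys \<gamma>. c < Poly_Mapping.lookup \<gamma> i} = {i. c + 1 \<le> Poly_Mapping.lookup \<gamma> i}"
    by (auto simp: in_keys_iff)
  finally show "length (filter (\<lambda>k. c < k) (sorted_composition \<gamma>)) = card {i. c + 1 \<le> Poly_Mapping.lookup \<gamma> i}" .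
qed

lemma sorted_composition_key_comp:
  assumes "tab T" shows "sorted_composition (key_comp T) = map length T"
proof (rule partition_eqI[OF sorted_composition_props(1) tab_partition[OF assms]])
  fix c
  show "length (filter (\<lambda>k. c < k) (sorted_composition (key_comp T))) = length (filter (\<lambda>k. c < k) (map length T))"
    by (simp only: sorted_composition_props(3) col_len_filter[symmetric] key_comp[OF assms, symmetric]
        card_key_col[OF assms])
qed

section \<open>The correspondence under an antitone bound\<close>

definition bounded_pairs :: "('a::linorder \<Rightarrow> 'b::linorder) \<Rightarrow> 'a set \<Rightarrow> 'b set \<Rightarrow> ('b list list \<times> 'a list list) set" where
  "bounded_pairs l V W = {(P, Q). tab P \<and> tab Q \<and> map length P = map length Q \<and>
     set (concat Q) \<subseteq> V \<and> set (concat P) \<subseteq> W \<and> (\<forall>a b. l a < b \<longrightarrow> key_bound a b P Q)}"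

definition region :: "('a::linorder \<Rightarrow> 'b::linorder) \<Rightarrow> 'a set \<Rightarrow> 'b set \<Rightarrow> ('a \<times> 'b) set" where
  "region l V W = {(i, j). i \<in> V \<and> j \<in> W \<and> j \<le> l i}"

theorem rsk_bounded:
  assumes "antimono l"
  shows "\<exists>f. bij_betw f {A. set_mset A \<subseteq> region l V W} (bounded_pairs l V W) \<and>
    (\<forall>A. mset (concat (fst (f A))) = image_mset snd A \<and> mset (concat (snd (f A))) = image_mset fst A)"
proof -
  define w where "w = (\<lambda>A :: ('a \<times> 'b) multiset. SOME w. mset w = A \<and> lex_desc w)"
  have w: "mset (w A) = A" "lex_desc (w A)" for A
    using someI_ex[OF lex_desc_exists[of A]] unfolding w_def by blast+
  define f where "f = (\<lambda>A. SOME (P, Q). rsk (w A) P Q)"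
  have f: "rsk (w A) (fst (f A)) (snd (f A))" for A
    using someI_ex[of "\<lambda>(P, Q). rsk (w A) P Q"] rsk_exists[of "w A"]
    unfolding f_def by (auto simp: case_prod_unfold)
  \<comment> \<open>For antitone \<open>l\<close> the complement of \<open>j \<le> l i\<close> is
    the union of the quadrants with \<open>l a < b\<close>: a pair outside the region lies in the
    quadrant whose corner it is.\<close>
  have supp: "(\<forall>a b. l a < b \<longrightarrow> (\<forall>(i, j)\<in>S. \<not> (a \<le> i \<and> b \<le> j))) \<longleftrightarrow> (\<forall>(i, j)\<in>S. j \<le> l i)" for S
  proof
    assume *: "\<forall>a b. l a < b \<longrightarrow> (\<forall>(i, j)\<in>S. \<not> (a \<le> i \<and> b \<le> j))"
    show "\<forall>(i, j)\<in>S. j \<le> l i"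
    proof clarify
      fix i j assume ij: "(i, j) \<in> S"
      show "j \<le> l i"
      proof (rule ccontr)
        assume "\<not> j \<le> l i"
        then have "\<forall>(i', j')\<in>S. \<not> (i \<le> i' \<and> j \<le> j')" using * by simp
        then show False using ij by auto
      qed
    qed
  next
    assume *: "\<forall>(i, j)\<in>S. j \<le> l i"
    show "\<forall>a b. l a < b \<longrightarrow> (\<forall>(i, j)\<in>S. \<not> (a \<le> i \<and> b \<le> j))"
    proof (intro allI impI ballI, clarify)
      fix a b i j assume "l a < b" "(i, j) \<in> S" "a \<le> i" "b \<le> j"
      moreover have "l i \<le> l a" using assms \<open>a \<le> i\<close> by (simp add: antimono_def)
      ultimately show False using * by fastforce
    qed
  qed
  have cond: "set v \<subseteq> region l V W \<longleftrightarrow> (P, Q) \<in> bounded_pairs l V W"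
    if r: "rsk v P Q" and lex: "lex_desc v" for v P Q
  proof -
    have basic: "tab P" "tab Q" "map length P = map length Q" "mset (concat P) = mset (map snd v)"
        "mset (concat Q) = mset (map fst v)"
      using rsk_basic[OF r] rsk_tab[OF r lex] by simp_all
    have sets: "set (concat Q) = fst ` set v" "set (concat P) = snd ` set v"
      using basic(4,5) by (metis set_map set_mset_mset)+
    have "set v \<subseteq> region l V W \<longleftrightarrow> fst ` set v \<subseteq> V \<and> snd ` set v \<subseteq> W \<and> (\<forall>(i, j)\<in>set v. j \<le> l i)"
      by (auto simp: region_def)
    also have "(\<forall>(i, j)\<in>set v. j \<le> l i) \<longleftrightarrow> (\<forall>a b. l a < b \<longrightarrow> key_bound a b P Q)"
      by (simp only: supp rsk_key_bound[OF r lex])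
    also have "fst ` set v \<subseteq> V \<and> snd ` set v \<subseteq> W \<and> (\<forall>a b. l a < b \<longrightarrow> key_bound a b P Q) \<longleftrightarrow>
        (P, Q) \<in> bounded_pairs l V W"
      unfolding bounded_pairs_def mem_Collect_eq prod.case sets using basic(1-3) by blast
    finally show ?thesis .
  qed
  have "bij_betw f {A. set_mset A \<subseteq> region l V W} (bounded_pairs l V W)"
    unfolding bij_betw_def
  proof (intro conjI inj_onI equalityI subsetI)
    fix A B assume "f A = f B"
    then have "w A = w B" using rsk_inj[OF f[of B] w(2) _ w(2), of A] f[of A] by simp
    then show "A = B" using w(1) by metis
  next
    fix p assume "p \<in> f ` {A. set_mset A \<subseteq> region l V W}"
    then obtain A where A: "p = f A" "set_mset A \<subseteq> region l V W" by blast
    have "set (w A) \<subseteq> region l V W" using A(2) w(1)[of A] by (metis set_mset_mset)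
    then show "p \<in> bounded_pairs l V W" using cond[OF f w(2), of A] A(1) by simp
  next
    fix p assume p: "p \<in> bounded_pairs l V W"
    obtain P Q where pq: "p = (P, Q)" by (cases p)
    obtain v where v: "lex_desc v" "rsk v P Q"
      using rsk_surj[of P Q] p pq by (auto simp: bounded_pairs_def)
    have "w (mset v) = v" using lex_desc_unique[OF w(2) v(1)] w(1) by simp
    then have "f (mset v) = p" using rsk_det[OF v(2)] f[of "mset v"] pq by (simp add: prod_eq_iff)
    moreover have "set_mset (mset v) \<subseteq> region l V W" using cond[OF v(2,1)] p pq by simp
    ultimately show "p \<in> f ` {A. set_mset A \<subseteq> region l V W}" by blast
  qed
  moreover have "mset (concat (fst (f A))) = image_mset snd A \<and> mset (concat (snd (f A))) = image_mset fst A" for A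
    using rsk_basic[OF f[of A]] w(1)[of A] by (metis mset_map)
  ultimately show ?thesis by blast
qed

section \<open>Generating functions as power series\<close>

definition monom_series :: "('v \<Rightarrow>\<^sub>0 nat) \<Rightarrow> 'v mfps" where
  "monom_series \<mu> = Abs_mfps (\<lambda>\<nu>. if \<nu> = \<mu> then 1 else 0)"

text \<open>\<open>card\<close> is \<open>0\<close> on infinite sets, so this is the intended series
  only under \<open>finite_fibres\<close>. That condition accompanies all sums and products
  below.\<close>

definition gen_fun :: "'t set \<Rightarrow> ('t \<Rightarrow> ('v \<Rightarrow>\<^sub>0 nat)) \<Rightarrow> 'v mfps" where
  "gen_fun S w = Abs_mfps (\<lambda>\<mu>. int (card {s \<in> S. w s = \<mu>}))"

definition finite_fibres :: "'t set \<Rightarrow> ('t \<Rightarrow> 'c) \<Rightarrow> bool" where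
  "finite_fibres S w \<longleftrightarrow> (\<forall>\<mu>. finite {s \<in> S. w s = \<mu>})"

lemma mcoeff_Abs [simp]: "mcoeff (Abs_mfps f) = f"
  by (rule Abs_mfps_inverse) simp

lemma mcoeff_monom_series: "mcoeff (monom_series \<mu>) \<nu> = (if \<nu> = \<mu> then 1 else 0)"
  and mcoeff_gen_fun: "mcoeff (gen_fun S w) \<mu> = int (card {s \<in> S. w s = \<mu>})"
  by (simp_all add: monom_series_def gen_fun_def)

lemma mcoeff_add: "mcoeff (f + g) \<mu> = mcoeff f \<mu> + mcoeff g \<mu>"
  and mcoeff_zero: "mcoeff 0 \<mu> = 0"
  and mcoeff_one: "mcoeff 1 \<mu> = (if \<mu> = 0 then 1 else 0)"
  and mcoeff_times: "mcoeff (f * g) \<mu> = (\<Sum>(a, b) | a + b = \<mu>. mcoeff f a * mcoeff g b)"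
  by (simp_all add: plus_mfps.rep_eq zero_mfps.rep_eq one_mfps.rep_eq times_mfps.rep_eq)

lemma mcoeff_sum: "mcoeff (sum f A) \<mu> = (\<Sum>a\<in>A. mcoeff (f a) \<mu>)"
  by (induction A rule: infinite_finite_induct) (simp_all add: mcoeff_add mcoeff_zero)

lemma gen_fun_times:
  assumes "finite_fibres S w" "finite_fibres T w'"
  shows "gen_fun S w * gen_fun T w' = gen_fun (S \<times> T) (\<lambda>(s, t). w s + w' t)"
proof (rule mfps_eqI)
  fix \<mu>
  let ?A = "\<lambda>(a, b). {s \<in> S. w s = a} \<times> {t \<in> T. w' t = b}"
  have "{p \<in> S \<times> T. (case p of (s, t) \<Rightarrow> w s + w' t) = \<mu>} = (\<Union>p\<in>{(a, b). a + b = \<mu>}. ?A p)"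
    by auto
  also have "card \<dots> = (\<Sum>p\<in>{(a, b). a + b = \<mu>}. card (?A p))"
    using finite_splits[of \<mu>] assms
    by (intro card_UN_disjoint) (auto simp: finite_fibres_def)
  finally have "int (card {p \<in> S \<times> T. (case p of (s, t) \<Rightarrow> w s + w' t) = \<mu>}) =
      (\<Sum>p\<in>{(a, b). a + b = \<mu>}. int (card (?A p)))" by simp
  also have "\<dots> = mcoeff (gen_fun S w * gen_fun T w') \<mu>"
    unfolding mcoeff_times mcoeff_gen_fun
    by (intro sum.cong) (auto simp: card_cartesian_product)
  finally show "mcoeff (gen_fun S w * gen_fun T w') \<mu> = mcoeff (gen_fun (S \<times> T) (\<lambda>(s, t). w s + w' t)) \<mu>"
    by (simp add: mcoeff_gen_fun)
qed

lemma gen_fun_bij: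
  assumes "bij_betw f S T" "\<And>s. s \<in> S \<Longrightarrow> w' (f s) = w s"
  shows "gen_fun S w = gen_fun T w'"
proof (rule mfps_eqI)
  fix \<mu>
  have "bij_betw f {s \<in> S. w s = \<mu>} {t \<in> T. w' t = \<mu>}"
    using assms unfolding bij_betw_def by (auto intro: inj_on_subset)
  then show "mcoeff (gen_fun S w) \<mu> = mcoeff (gen_fun T w') \<mu>"
    by (simp add: mcoeff_gen_fun bij_betw_same_card)
qed

lemma finite_fibres_bij:
  assumes "bij_betw f S T" "\<And>s. s \<in> S \<Longrightarrow> w' (f s) = w s" "finite_fibres S w"
  shows "finite_fibres T w'"
  unfolding finite_fibres_def
proof
  fix \<mu>
  have "{t \<in> T. w' t = \<mu>} \<subseteq> f ` {s \<in> S. w s = \<mu>}"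
    using assms(1,2) unfolding bij_betw_def by auto
  then show "finite {t \<in> T. w' t = \<mu>}"
    using assms(3) unfolding finite_fibres_def by (meson finite_imageI finite_subset)
qed

lemma finite_fibres_subset:
  assumes "finite_fibres T w" "S \<subseteq> T" shows "finite_fibres S w"
  unfolding finite_fibres_def
proof
  fix \<mu>
  show "finite {s \<in> S. w s = \<mu>}"
    by (rule finite_subset[of _ "{s \<in> T. w s = \<mu>}"]) (use assms in \<open>auto simp: finite_fibres_def\<close>)
qed

lemma gen_fun_singleton: "gen_fun {s} w = monom_series (w s)"
proof (rule mfps_eqI)
  fix \<mu>
  have "{s' \<in> {s}. w s' = \<mu>} = (if \<mu> = w s then {s} else {})" by auto
  then show "mcoeff (gen_fun {s} w) \<mu> = mcoeff (monom_series (w s)) \<mu>"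
    by (simp add: mcoeff_gen_fun mcoeff_monom_series)
qed

lemma finite_fibres_finite: "finite S \<Longrightarrow> finite_fibres S w"
  by (simp add: finite_fibres_def)

lemma gen_fun_shift:
  assumes "finite_fibres S w"
  shows "monom_series \<mu> * gen_fun S w = gen_fun S (\<lambda>s. \<mu> + w s)"
proof -
  have "monom_series \<mu> * gen_fun S w = gen_fun {()} (\<lambda>_. \<mu>) * gen_fun S w"
    by (simp add: gen_fun_singleton)
  also have "\<dots> = gen_fun ({()} \<times> S) (\<lambda>(u, s). \<mu> + w s)"
    by (rule gen_fun_times[OF finite_fibres_finite assms]) simp
  also have "\<dots> = gen_fun S (\<lambda>s. \<mu> + w s)"
    by (rule gen_fun_bij[where f = snd]) (auto simp: bij_betw_def inj_on_def)
  finally show ?thesis .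
qed

lemma gen_fun_Un:
  assumes "finite_fibres S w" "finite_fibres T w" "S \<inter> T = {}"
  shows "gen_fun (S \<union> T) w = gen_fun S w + gen_fun T w"
proof (rule mfps_eqI)
  fix \<mu>
  have "{s \<in> S \<union> T. w s = \<mu>} = {s \<in> S. w s = \<mu>} \<union> {s \<in> T. w s = \<mu>}" by auto
  then show "mcoeff (gen_fun (S \<union> T) w) \<mu> = mcoeff (gen_fun S w + gen_fun T w) \<mu>"
    using assms by (simp add: mcoeff_gen_fun mcoeff_add finite_fibres_def card_Un_disjoint disjoint_iff)
qed

lemma monom_series_times: "monom_series \<mu> * monom_series \<nu> = monom_series (\<mu> + \<nu>)"
  using gen_fun_shift[of "{()}" "\<lambda>_. \<nu>" \<mu>] by (simp add: gen_fun_singleton finite_fibres_finite)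

lemma monom_series_0: "monom_series 0 = 1"
  by (rule mfps_eqI) (simp add: mcoeff_monom_series mcoeff_one)

lemma mvar_monom: "mvar v = monom_series (Poly_Mapping.single v 1)"
  by (simp add: mvar_def monom_series_def)

text \<open>A neighbourhood restricts finitely many coefficients only, so the union of their finite
  index sets is a common threshold.\<close>

lemma tendsto_coeffI:
  assumes "\<And>\<mu>. \<exists>F. finite F \<and> F \<subseteq> I \<and> (\<forall>G. finite G \<and> F \<subseteq> G \<and> G \<subseteq> I \<longrightarrow> mcoeff (\<Phi> G) \<mu> = mcoeff P \<mu>)"
  shows "(\<Phi> \<longlongrightarrow> P) (finite_subsets_at_top I)"
proof (rule topological_tendstoI)
  fix U assume "open U" "P \<in> U"
  then obtain M where M: "finite M" "\<And>g. \<forall>\<mu>\<in>M. mcoeff g \<mu> = mcoeff P \<mu> \<Longrightarrow> g \<in> U"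
    unfolding open_mfps_def by blast
  obtain F where F: "\<And>\<mu>. finite (F \<mu>) \<and> F \<mu> \<subseteq> I \<and>
      (\<forall>G. finite G \<and> F \<mu> \<subseteq> G \<and> G \<subseteq> I \<longrightarrow> mcoeff (\<Phi> G) \<mu> = mcoeff P \<mu>)"
    using assms by metis
  show "eventually (\<lambda>G. \<Phi> G \<in> U) (finite_subsets_at_top I)"
    unfolding eventually_finite_subsets_at_top
  proof (intro exI[of _ "\<Union>\<mu>\<in>M. F \<mu>"] conjI allI impI)
    show "finite (\<Union>\<mu>\<in>M. F \<mu>)" using M(1) F by simp
    show "(\<Union>\<mu>\<in>M. F \<mu>) \<subseteq> I" using F by blast
    fix G assume G: "finite G \<and> (\<Union>\<mu>\<in>M. F \<mu>) \<subseteq> G \<and> G \<subseteq> I"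
    show "\<Phi> G \<in> U"
    proof (rule M(2), rule ballI)
      fix \<mu> assume "\<mu> \<in> M"
      then have "F \<mu> \<subseteq> G" using G by blast
      then show "mcoeff (\<Phi> G) \<mu> = mcoeff P \<mu>" using F[of \<mu>] G by blast
    qed
  qed
qed

lemma has_sum_gen_fun_Sigma:
  assumes "finite_fibres (SIGMA i:I. S i) (\<lambda>(i, s). w i s)"
  shows "((\<lambda>i. gen_fun (S i) (w i)) has_sum gen_fun (SIGMA i:I. S i) (\<lambda>(i, s). w i s)) I"
  unfolding has_sum_def
proof (rule tendsto_coeffI)
  fix \<mu>
  let ?T = "{p \<in> (SIGMA i:I. S i). (case p of (i, s) \<Rightarrow> w i s) = \<mu>}"
  have fin: "finite ?T" using assms by (simp add: finite_fibres_def)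
  have "mcoeff (\<Sum>i\<in>G. gen_fun (S i) (w i)) \<mu> = int (card ?T)"
    if G: "finite G" "fst ` ?T \<subseteq> G" "G \<subseteq> I" for G
  proof -
    have T: "?T = (SIGMA i:G. {s \<in> S i. w i s = \<mu>})" using G(2,3) by force
    have "finite {s \<in> S i. w i s = \<mu>}" if "i \<in> G" for i
    proof -
      have "{s \<in> S i. w i s = \<mu>} \<subseteq> snd ` ?T" using that G(3) by force
      then show ?thesis using fin by (meson finite_imageI finite_subset)
    qed
    then show ?thesis using G(1) unfolding T by (simp add: mcoeff_sum mcoeff_gen_fun)
  qed
  moreover have "fst ` ?T \<subseteq> I" by auto
  ultimately show "\<exists>F. finite F \<and> F \<subseteq> I \<and> (\<forall>G. finite G \<and> F \<subseteq> G \<and> G \<subseteq> I \<longrightarrow>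
      mcoeff (\<Sum>i\<in>G. gen_fun (S i) (w i)) \<mu> =
      mcoeff (gen_fun (SIGMA i:I. S i) (\<lambda>(i, s). w i s)) \<mu>)"
    using fin by (intro exI[of _ "fst ` ?T"]) (simp add: mcoeff_gen_fun)
qed

lemma infsum_monom_series:
  assumes "finite_fibres S w"
  shows "(\<Sum>\<^sub>\<infinity>s\<in>S. monom_series (w s)) = gen_fun S w"
proof (rule infsumI)
  have b: "bij_betw (\<lambda>s. (s, ())) S (SIGMA s:S. {()})" by (auto simp: bij_betw_def inj_on_def)
  have "finite_fibres (SIGMA s:S. {()}) (\<lambda>(s, u). w s)"
    by (rule finite_fibres_bij[OF b _ assms]) simp
  from has_sum_gen_fun_Sigma[OF this] show "((\<lambda>s. monom_series (w s)) has_sum gen_fun S w) S"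
    using gen_fun_bij[OF b, of "\<lambda>(s, u). w s" w] by (simp add: gen_fun_singleton)
qed

section \<open>Weights of multisets and tableaux\<close>

definition mset_monom :: "('k \<Rightarrow> 'v) \<Rightarrow> 'k multiset \<Rightarrow> ('v \<Rightarrow>\<^sub>0 nat)" where
  "mset_monom z M = (\<Sum>k\<in>#M. Poly_Mapping.single (z k) 1)"

lemma mset_monom_simps [simp]: "mset_monom z {#} = 0"
    "mset_monom z (add_mset k M) = Poly_Mapping.single (z k) 1 + mset_monom z M"
    "mset_monom z (M + N) = mset_monom z M + mset_monom z N"
  by (simp_all add: mset_monom_def)

lemma lookup_mset_monom: "inj z \<Longrightarrow> Poly_Mapping.lookup (mset_monom z M) (z k) = count M k"
  by (induction M) (auto simp: lookup_add lookup_single when_def inj_eq)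

lemma mset_monom_inj:
  assumes "inj z" shows "mset_monom z M = mset_monom z N \<longleftrightarrow> M = N"
proof
  assume "mset_monom z M = mset_monom z N"
  then have "count M k = count N k" for k
    using lookup_mset_monom[OF assms, of M k] lookup_mset_monom[OF assms, of N k] by simp
  then show "M = N" by (rule multiset_eqI)
qed simp

lemma concat_shape_inj: "map length T = map length T' \<Longrightarrow> concat T = concat T' \<Longrightarrow> T = T'"
proof (induction T arbitrary: T')
  case (Cons R T)
  then show ?case by (cases T') auto
qed simp

text \<open>A tableau is determined by its concatenated rows and its shape. No row is empty, so the
  size of \<open>M\<close> bounds both lists.\<close>

lemma finite_tabs_mset: "finite {T. tab T \<and> mset (concat T) = M}"
proof -
  let ?f = "\<lambda>T :: 'a list list. (concat T, map length T)"
  have inj: "inj_on ?f {T. tab T \<and> mset (concat T) = M}"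
  proof (rule inj_onI)
    fix T T' :: "'a list list" assume "?f T = ?f T'"
    then show "T = T'" by (intro concat_shape_inj) simp_all
  qed
  have "?f ` {T. tab T \<and> mset (concat T) = M} \<subseteq>
      {xs. set xs \<subseteq> set_mset M \<and> length xs \<le> size M} \<times> {ns. set ns \<subseteq> {..size M} \<and> length ns \<le> size M}"
  proof
    fix p assume "p \<in> ?f ` {T. tab T \<and> mset (concat T) = M}"
    then obtain T where T: "p = ?f T" "tab T" "mset (concat T) = M" by auto
    have len: "length (concat T) = size M" using T(3) by (metis size_mset)
    have sets: "set (concat T) = set_mset M" using T(3) by (metis set_mset_mset)
    have "length T \<le> length (concat T)" using tab_no_empty_row[OF T(2)]
    proof (induction T)
      case (Cons R T)
      then show ?case by (cases R) auto
    qed simp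
    moreover have "length R \<le> length (concat T)" if "R \<in> set T" for R
      using that by (induction T) auto
    ultimately show "p \<in> {xs. set xs \<subseteq> set_mset M \<and> length xs \<le> size M} \<times>
        {ns. set ns \<subseteq> {..size M} \<and> length ns \<le> size M}"
      unfolding T(1) using len sets by (auto simp del: set_concat length_concat)
  qed
  moreover have "finite ({xs. set xs \<subseteq> set_mset M \<and> length xs \<le> size M} \<times>
      {ns. set ns \<subseteq> {..size M} \<and> length ns \<le> size M})"
    by (intro finite_cartesian_product finite_lists_length_le) auto
  ultimately show ?thesis using inj by (meson finite_imageD finite_subset)
qed

lemma finite_fibres_tabs:
  assumes "inj z" "\<And>T. T \<in> S \<Longrightarrow> tab T"
  shows "finite_fibres S (\<lambda>T. mset_monom z (mset (concat T)))"
  unfolding finite_fibres_def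
proof
  fix \<mu>
  show "finite {T \<in> S. mset_monom z (mset (concat T)) = \<mu>}"
  proof (cases "\<exists>M. mset_monom z M = \<mu>")
    case True
    then obtain M where "mset_monom z M = \<mu>" by blast
    have "{T \<in> S. mset_monom z (mset (concat T)) = \<mu>} \<subseteq> {T. tab T \<and> mset (concat T) = M}"
    proof
      fix T assume "T \<in> {T \<in> S. mset_monom z (mset (concat T)) = \<mu>}"
      then have "T \<in> S" "mset_monom z (mset (concat T)) = mset_monom z M"
        using \<open>mset_monom z M = \<mu>\<close> by simp_all
      then show "T \<in> {T. tab T \<and> mset (concat T) = M}"
        using assms(2) by (simp only: mset_monom_inj[OF assms(1)] mem_Collect_eq simp_thms)
    qed
    then show ?thesis by (rule finite_subset[OF _ finite_tabs_mset])
  next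
    case False
    then have "{T \<in> S. mset_monom z (mset (concat T)) = \<mu>} = {}" by blast
    then show ?thesis by (simp only: finite.emptyI)
  qed
qed

section \<open>Products of geometric series\<close>

definition degree_of :: "('v \<Rightarrow>\<^sub>0 nat) \<Rightarrow> nat" where
  "degree_of \<mu> = (\<Sum>v\<in>Poly_Mapping.keys \<mu>. Poly_Mapping.lookup \<mu> v)"

lemma degree_of_superset:
  "finite A \<Longrightarrow> Poly_Mapping.keys \<mu> \<subseteq> A \<Longrightarrow> degree_of \<mu> = (\<Sum>v\<in>A. Poly_Mapping.lookup \<mu> v)"
  unfolding degree_of_def by (rule sum.mono_neutral_left) (auto simp: in_keys_iff)

lemma degree_of_add: "degree_of (\<mu> + \<nu>) = degree_of \<mu> + degree_of \<nu>"
proof -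
  let ?A = "Poly_Mapping.keys \<mu> \<union> Poly_Mapping.keys \<nu>"
  have "Poly_Mapping.keys (\<mu> + \<nu>) \<subseteq> ?A" by (auto simp: in_keys_iff lookup_add)
  then show ?thesis
    by (simp add: degree_of_superset[of ?A] lookup_add sum.distrib)
qed

lemma degree_of_pos: "\<mu> \<noteq> 0 \<Longrightarrow> degree_of \<mu> > 0"
  unfolding degree_of_def by (rule sum_pos) (auto simp: in_keys_iff)

text \<open>Convergence condition for a product of geometric series: only finitely many of the
  monomials divide a given one, and none of them is constant.\<close>

definition locally_finite :: "'i set \<Rightarrow> ('i \<Rightarrow> ('v \<Rightarrow>\<^sub>0 nat)) \<Rightarrow> bool" where
  "locally_finite I u \<longleftrightarrow> (\<forall>\<mu>. finite {e \<in> I. \<exists>\<nu>. u e + \<nu> = \<mu>}) \<and> (\<forall>e\<in>I. u e \<noteq> 0)"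

definition mset_weight :: "('i \<Rightarrow> ('v \<Rightarrow>\<^sub>0 nat)) \<Rightarrow> 'i multiset \<Rightarrow> ('v \<Rightarrow>\<^sub>0 nat)" where
  "mset_weight u A = (\<Sum>e\<in>#A. u e)"

abbreviation mset_series :: "'i set \<Rightarrow> ('i \<Rightarrow> ('v \<Rightarrow>\<^sub>0 nat)) \<Rightarrow> 'v mfps" where
  "mset_series I u \<equiv> gen_fun {A. set_mset A \<subseteq> I} (mset_weight u)"

lemma mset_weight_member:
  assumes "e \<in># A" shows "\<exists>\<nu>. u e + \<nu> = mset_weight u A"
proof -
  obtain B where "A = add_mset e B" using assms by (metis multi_member_split)
  then show ?thesis by (auto simp: mset_weight_def)
qed

lemma size_le_degree: "(\<And>e. e \<in># A \<Longrightarrow> u e \<noteq> 0) \<Longrightarrow> size A \<le> degree_of (mset_weight u A)"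
proof (induction A)
  case (add e A)
  have "degree_of (u e) > 0" using add.prems by (intro degree_of_pos) simp
  then show ?case using add by (simp add: mset_weight_def degree_of_add)
qed simp

lemma finite_fibres_msets:
  assumes "locally_finite I u"
  shows "finite_fibres {A. set_mset A \<subseteq> I} (mset_weight u)"
  unfolding finite_fibres_def
proof
  fix \<mu>
  let ?E = "{e \<in> I. \<exists>\<nu>. u e + \<nu> = \<mu>}"
  have "{A \<in> {A. set_mset A \<subseteq> I}. mset_weight u A = \<mu>} \<subseteq> mset ` {xs. set xs \<subseteq> ?E \<and> length xs \<le> degree_of \<mu>}"
  proof
    fix A assume A: "A \<in> {A \<in> {A. set_mset A \<subseteq> I}. mset_weight u A = \<mu>}"
    obtain xs where xs: "A = mset xs" by (metis ex_mset)
    have "set xs \<subseteq> ?E" using A xs mset_weight_member[of _ A u] by auto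
    moreover have "length xs \<le> degree_of \<mu>"
      using size_le_degree[of A u] A xs assms by (auto simp: locally_finite_def)
    ultimately show "A \<in> mset ` {xs. set xs \<subseteq> ?E \<and> length xs \<le> degree_of \<mu>}" using xs by blast
  qed
  moreover have "finite {xs. set xs \<subseteq> ?E \<and> length xs \<le> degree_of \<mu>}"
    using assms by (intro finite_lists_length_le) (simp add: locally_finite_def)
  ultimately show "finite {A \<in> {A. set_mset A \<subseteq> I}. mset_weight u A = \<mu>}"
    by (meson finite_imageI finite_subset)
qed

lemma locally_finite_subset:
  assumes "locally_finite I u" "J \<subseteq> I" shows "locally_finite J u"
proof -
  have "finite {e \<in> J. \<exists>\<nu>. u e + \<nu> = \<mu>}" for \<mu>
    by (rule finite_subset[of _ "{e \<in> I. \<exists>\<nu>. u e + \<nu> = \<mu>}"])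
      (use assms in \<open>auto simp: locally_finite_def\<close>)
  then show ?thesis using assms by (auto simp: locally_finite_def)
qed

text \<open>A multiset either avoids \<open>e\<close> or arises from a unique one by adding a copy
  of \<open>e\<close>. The geometric factor thus appears without any expansion of an
  inverse.\<close>

lemma mset_series_insert:
  assumes lf: "locally_finite (insert e I) u" and e: "e \<notin> I"
  shows "(1 - monom_series (u e)) * mset_series (insert e I) u = mset_series I u"
proof -
  let ?S = "{A. set_mset A \<subseteq> insert e I}" and ?B = "{A. set_mset A \<subseteq> I}"
  let ?w = "mset_weight u"
  have fin: "finite_fibres ?S ?w" by (rule finite_fibres_msets[OF lf])
  have un: "?S = ?B \<union> {A \<in> ?S. e \<in># A}" by auto
  have "gen_fun ?S ?w = gen_fun (?B \<union> {A \<in> ?S. e \<in># A}) ?w"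
    by (simp only: un[symmetric])
  also have "\<dots> = gen_fun ?B ?w + gen_fun {A \<in> ?S. e \<in># A} ?w"
    using e by (intro gen_fun_Un finite_fibres_subset[OF fin]) auto
  also have "gen_fun {A \<in> ?S. e \<in># A} ?w = gen_fun ?S (\<lambda>A. u e + ?w A)"
  proof (rule gen_fun_bij[symmetric, where f = "add_mset e"])
    show "bij_betw (add_mset e) ?S {A \<in> ?S. e \<in># A}"
      unfolding bij_betw_def
    proof
      show "add_mset e ` ?S = {A \<in> ?S. e \<in># A}"
      proof (intro equalityI subsetI)
        fix A assume A: "A \<in> {A \<in> ?S. e \<in># A}"
        then have "A = add_mset e (A - {#e#})" by simp
        moreover have "A - {#e#} \<in> ?S" using A by (auto dest: in_diffD)
        ultimately show "A \<in> add_mset e ` ?S" by blast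
      qed auto
    qed (simp add: inj_on_def)
  qed (simp add: mset_weight_def)
  also have "\<dots> = monom_series (u e) * gen_fun ?S ?w"
    by (rule gen_fun_shift[OF fin, symmetric])
  finally have "gen_fun ?S ?w = gen_fun ?B ?w + monom_series (u e) * gen_fun ?S ?w" .
  then have "gen_fun ?S ?w - monom_series (u e) * gen_fun ?S ?w = gen_fun ?B ?w"
    by (subst diff_eq_eq)
  then show ?thesis by (simp only: left_diff_distrib mult_1_left)
qed

lemma inverse_mfps_eqI: "(f :: 'v mfps) * g = 1 \<Longrightarrow> inverse f = g"
  unfolding inverse_mfps_def by (rule the_equality) (simp, metis mult.commute mult.left_commute mult.right_neutral)

lemma mset_series_empty: "gen_fun {{#}} (mset_weight u) = 1"
  by (simp add: gen_fun_singleton mset_weight_def monom_series_0)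

lemma inverse_one_minus_monom:
  assumes "locally_finite {e} u"
  shows "(1 - monom_series (u e)) * (1 / (1 - monom_series (u e))) = 1"
proof -
  have "(1 - monom_series (u e)) * mset_series {e} u = 1"
    using mset_series_insert[of e "{}" u] assms by (simp add: mset_series_empty)
  then show ?thesis by (simp add: divide_mfps_def inverse_mfps_eqI)
qed

lemma mset_series_insert_eq:
  assumes "locally_finite (insert e I) u" "e \<notin> I"
  shows "mset_series (insert e I) u = mset_series I u * (1 / (1 - monom_series (u e)))"
proof -
  have "locally_finite {e} u" by (rule locally_finite_subset[OF assms(1)]) simp
  note inv = inverse_one_minus_monom[OF this]
  have "mset_series I u * (1 / (1 - monom_series (u e))) =
      ((1 - monom_series (u e)) * (1 / (1 - monom_series (u e)))) * mset_series (insert e I) u"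
    unfolding mset_series_insert[OF assms, symmetric] by (simp only: ac_simps)
  then show ?thesis unfolding inv by simp
qed

lemma mset_series_Un:
  assumes "finite J" "locally_finite (I \<union> J) u" "I \<inter> J = {}"
  shows "mset_series (I \<union> J) u = mset_series I u * (\<Prod>e\<in>J. 1 / (1 - monom_series (u e)))"
  using assms
proof (induction J)
  case (insert e J)
  have "locally_finite (I \<union> J) u" by (rule locally_finite_subset[OF insert.prems(1)]) auto
  then have IH: "mset_series (I \<union> J) u = mset_series I u * (\<Prod>e\<in>J. 1 / (1 - monom_series (u e)))"
    using insert by auto
  have "mset_series (insert e (I \<union> J)) u = mset_series (I \<union> J) u * (1 / (1 - monom_series (u e)))"
    using insert by (intro mset_series_insert_eq) auto
  then show ?case using IH insert.hyps by (simp add: ac_simps)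
qed simp

text \<open>As soon as \<open>G\<close> contains all indices whose monomial divides
  \<open>\<mu>\<close>, no further multiset of weight \<open>\<mu>\<close> can appear, so the
  coefficient is stationary.\<close>

lemma has_product_mset_series:
  assumes "locally_finite I u"
  shows "has_product (\<lambda>e. 1 / (1 - monom_series (u e))) I (mset_series I u)"
  unfolding has_product_def
proof (rule tendsto_coeffI)
  fix \<mu>
  let ?F = "{e \<in> I. \<exists>\<nu>. u e + \<nu> = \<mu>}"
  have "mcoeff (\<Prod>e\<in>G. 1 / (1 - monom_series (u e))) \<mu> = mcoeff (mset_series I u) \<mu>"
    if G: "finite G" "?F \<subseteq> G" "G \<subseteq> I" for G
  proof -
    have "mset_series ({} \<union> G) u = mset_series {} u * (\<Prod>e\<in>G. 1 / (1 - monom_series (u e)))"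
      using G locally_finite_subset[OF assms] by (intro mset_series_Un) auto
    then have "(\<Prod>e\<in>G. 1 / (1 - monom_series (u e))) = mset_series G u"
      by (simp add: mset_series_empty)
    moreover have "{A \<in> {A. set_mset A \<subseteq> G}. mset_weight u A = \<mu>} =
        {A \<in> {A. set_mset A \<subseteq> I}. mset_weight u A = \<mu>}"
      using G(2,3) mset_weight_member[of _ _ u] by blast
    ultimately show ?thesis by (simp add: mcoeff_gen_fun)
  qed
  then show "\<exists>F. finite F \<and> F \<subseteq> I \<and> (\<forall>G. finite G \<and> F \<subseteq> G \<and> G \<subseteq> I \<longrightarrow>
      mcoeff (\<Prod>e\<in>G. 1 / (1 - monom_series (u e))) \<mu> = mcoeff (mset_series I u) \<mu>)"
    using assms by (intro exI[of _ ?F]) (auto simp: locally_finite_def)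
qed

section \<open>Polynomials and the exchange of variables\<close>

definition poly_gf :: "'t set \<Rightarrow> ('t \<Rightarrow> (nat \<Rightarrow>\<^sub>0 nat)) \<Rightarrow> xpoly" where
  "poly_gf S w = (\<Sum>s\<in>S. Poly_Mapping.single (w s) 1)"

lemma inj_adjacent [simp]: "inj (Transposition.transpose i (i + 1 :: nat))"
  by (rule inj_on_subset[of _ UNIV]) (auto simp: inj_def dest: arg_cong[where f = "Transposition.transpose i (i + 1)"])

lemma lookup_swap_exponents:
  "Poly_Mapping.lookup (swap_exponents i \<alpha>) k = Poly_Mapping.lookup \<alpha> (Transposition.transpose i (i + 1) k)"
  unfolding swap_exponents_def by (subst map_key.rep_eq) simp_all

lemma swap_exponents_swap [simp]: "swap_exponents i (swap_exponents i \<alpha>) = \<alpha>"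
  by (rule poly_mapping_eqI) (simp add: lookup_swap_exponents)

lemma inj_swap_exponents [simp]: "inj (swap_exponents i)"
  by (metis injI swap_exponents_swap)

lemma swap_exponents_add: "swap_exponents i (\<alpha> + \<beta>) = swap_exponents i \<alpha> + swap_exponents i \<beta>"
  by (rule poly_mapping_eqI) (simp add: lookup_swap_exponents lookup_add)

lemma swap_exponents_mset_monom:
  "swap_exponents i (mset_monom id M) = mset_monom id (image_mset (Transposition.transpose i (i + 1)) M)"
proof (induction M)
  case empty
  show ?case by (rule poly_mapping_eqI) (simp add: lookup_swap_exponents)
next
  case (add x M)
  have "swap_exponents i (Poly_Mapping.single x 1) = Poly_Mapping.single (Transposition.transpose i (i + 1) x) 1"
    by (rule poly_mapping_eqI) (auto simp: lookup_swap_exponents lookup_single when_def)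
  then show ?case using add by (simp add: swap_exponents_add)
qed

lemma lookup_swap_vars: "Poly_Mapping.lookup (swap_vars i f) \<mu> = Poly_Mapping.lookup f (swap_exponents i \<mu>)"
  unfolding swap_vars_def by (subst map_key.rep_eq) simp_all

lemma swap_vars_add: "swap_vars i (f + g) = swap_vars i f + swap_vars i g"
  and swap_vars_0: "swap_vars i 0 = 0"
  by (rule poly_mapping_eqI, simp add: lookup_swap_vars lookup_add)+

lemma swap_vars_sum: "swap_vars i (sum f A) = (\<Sum>a\<in>A. swap_vars i (f a))"
  by (induction A rule: infinite_finite_induct) (simp_all add: swap_vars_add swap_vars_0)

lemma swap_vars_of_nat: "swap_vars i (of_nat c * f) = of_nat c * swap_vars i f"
  by (induction c) (simp_all add: swap_vars_add swap_vars_0 distrib_right)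

lemma swap_vars_single: "swap_vars i (Poly_Mapping.single \<mu> c) = Poly_Mapping.single (swap_exponents i \<mu>) c"
proof (rule poly_mapping_eqI)
  fix \<nu>
  have "\<mu> = swap_exponents i \<nu> \<longleftrightarrow> swap_exponents i \<mu> = \<nu>" by auto
  then show "Poly_Mapping.lookup (swap_vars i (Poly_Mapping.single \<mu> c)) \<nu> =
      Poly_Mapping.lookup (Poly_Mapping.single (swap_exponents i \<mu>) c) \<nu>"
    by (simp add: lookup_swap_vars lookup_single when_def)
qed

lemma swap_vars_poly_gf: "swap_vars i (poly_gf S w) = poly_gf S (\<lambda>s. swap_exponents i (w s))"
  by (simp add: poly_gf_def swap_vars_sum swap_vars_single)

lemma poly_gf_bij:
  assumes "bij_betw f S T" "\<And>s. s \<in> S \<Longrightarrow> w' (f s) = w s"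
  shows "poly_gf S w = poly_gf T w'"
  unfolding poly_gf_def using assms(2) by (subst sum.reindex_bij_betw[OF assms(1), symmetric]) simp

lemma pvar_poly_gf: "pvar i * poly_gf S w = poly_gf S (\<lambda>s. Poly_Mapping.single i 1 + w s)"
  by (simp add: poly_gf_def pvar_def sum_distrib_left mult_single)

lemma poly_gf_Un: "finite S \<Longrightarrow> finite T \<Longrightarrow> S \<inter> T = {} \<Longrightarrow> poly_gf (S \<union> T) w = poly_gf S w + poly_gf T w"
  by (simp add: poly_gf_def sum.union_disjoint)

lemma lookup_poly_gf: "finite S \<Longrightarrow> Poly_Mapping.lookup (poly_gf S w) \<mu> = int (card {s \<in> S. w s = \<mu>})"
proof (induction S rule: finite_induct)
  case (insert x S)
  have "{s \<in> insert x S. w s = \<mu>} = (if w x = \<mu> then insert x {s \<in> S. w s = \<mu>} else {s \<in> S. w s = \<mu>})"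
    by auto
  then show ?case using insert by (simp add: poly_gf_def lookup_add lookup_single when_def)
qed (simp add: poly_gf_def)

section \<open>Tableaux with a given right key\<close>

text \<open>Column \<open>c\<close> of the key tableau of \<open>\<alpha>\<close>, as a set.\<close>

abbreviation level :: "nat \<Rightarrow> (nat \<Rightarrow>\<^sub>0 nat) \<Rightarrow> nat set" where
  "level c \<alpha> \<equiv> {i. c + 1 \<le> Poly_Mapping.lookup \<alpha> i}"

definition key_tabs :: "(nat \<Rightarrow>\<^sub>0 nat) \<Rightarrow> nat list list set" where
  "key_tabs \<alpha> = {Q. tab Q \<and> set (concat Q) \<subseteq> {1..} \<and> key_comp Q = \<alpha>}"

definition atom_poly :: "(nat \<Rightarrow>\<^sub>0 nat) \<Rightarrow> xpoly" where
  "atom_poly \<alpha> = poly_gf (key_tabs \<alpha>) (\<lambda>Q. mset_monom id (mset (concat Q)))"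

lemma set_tail_word_0: "set (tail_word 0 T) = set (concat T)"
  by (induction T) auto

text \<open>A single letter is already a chain. This bounds the entries of a tableau by its key and
  makes \<open>key_tabs \<alpha>\<close> finite.\<close>

lemma entry_le_key:
  assumes "tab T" "z \<in> set (tail_word c T)" shows "\<exists>k\<in>key_col c T. z \<le> k"
proof -
  have "length [z] \<le> dec_len {z..} (tail_word c T)"
    using assms(2) by (intro dec_len_ge) (auto simp: subseq_singleton_left)
  then have "card (key_col c T \<inter> {z..}) \<noteq> 0" by (simp add: card_key_set)
  then have "key_col c T \<inter> {z..} \<noteq> {}" by (rule contrapos_nn) (simp only: card.empty)
  then show ?thesis by auto
qed

lemma length_concat_composition:
  assumes "map length T = sorted_composition \<alpha>" shows "length (concat T) = degree_of \<alpha>"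
proof -
  have "length (concat T) = sum_mset (mset (sorted_composition \<alpha>))"
    by (simp add: length_concat assms sum_mset_sum_list)
  also have "\<dots> = degree_of \<alpha>"
    by (simp add: sorted_composition_props(2) degree_of_def sum_unfold_sum_mset)
  finally show ?thesis .
qed

lemma finite_key_tabs: "finite (key_tabs \<alpha>)"
proof -
  have "concat ` key_tabs \<alpha> \<subseteq> {xs. set xs \<subseteq> {..Max (Poly_Mapping.keys \<alpha>)} \<and> length xs \<le> degree_of \<alpha>}"
  proof
    fix xs assume "xs \<in> concat ` key_tabs \<alpha>"
    then obtain Q where Q: "xs = concat Q" "tab Q" "key_comp Q = \<alpha>" by (auto simp: key_tabs_def)
    have "z \<le> Max (Poly_Mapping.keys \<alpha>)" if "z \<in> set xs" for z
    proof -
      have "z \<in> set (tail_word 0 Q)" using that Q(1) by (simp only: set_tail_word_0)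
      then obtain k where k: "k \<in> key_col 0 Q" "z \<le> k" using entry_le_key[OF Q(2)] by blast
      then have "k \<in> Poly_Mapping.keys \<alpha>" using key_comp[OF Q(2), of 0] Q(3) by (simp add: in_keys_iff)
      then show ?thesis using k(2) by (meson Max_ge finite_keys order_trans)
    qed
    moreover have "length xs \<le> degree_of \<alpha>"
      using length_concat_composition[of Q \<alpha>] sorted_composition_key_comp[OF Q(2)] Q(1,3) by simp
    ultimately show "xs \<in> {xs. set xs \<subseteq> {..Max (Poly_Mapping.keys \<alpha>)} \<and> length xs \<le> degree_of \<alpha>}"
      by (simp add: subset_eq)
  qed
  then have "finite (concat ` key_tabs \<alpha>)"
    by (rule finite_subset) (rule finite_lists_length_le, simp)
  moreover have "inj_on concat (key_tabs \<alpha>)"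
  proof (rule inj_onI)
    fix T T' assume TT: "T \<in> key_tabs \<alpha>" "T' \<in> key_tabs \<alpha>" "concat T = concat T'"
    have "map length T = map length T'"
      using TT(1,2) sorted_composition_key_comp[of T] sorted_composition_key_comp[of T']
      by (simp add: key_tabs_def)
    then show "T = T'" using TT(3) by (rule concat_shape_inj)
  qed
  ultimately show ?thesis by (rule finite_imageD)
qed

lemma card_level: "length (filter (\<lambda>k. c < k) (sorted_composition \<alpha>)) = card (level c \<alpha>)"
  by (rule sorted_composition_props(3))

lemma sorted_composition_cong:
  assumes "\<And>c. card (level c \<alpha>) = card (level c \<beta>)" shows "sorted_composition \<alpha> = sorted_composition \<beta>"
  by (rule partition_eqI[OF sorted_composition_props(1) sorted_composition_props(1)])
    (simp only: card_level assms)

section \<open>Key tableaux\<close>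

lemma partition_filter_iff:
  "is_partition \<nu> \<Longrightarrow> r < length (filter (\<lambda>k. c < k) \<nu>) \<longleftrightarrow> r < length \<nu> \<and> c < \<nu> ! r"
proof (induction \<nu> arbitrary: r)
  case (Cons a \<nu>)
  have p: "is_partition \<nu>" "\<forall>k\<in>set \<nu>. k \<le> a" using Cons.prems by (auto simp: is_partition_def)
  show ?case
  proof (cases "c < a")
    case True
    then show ?thesis using Cons.IH[OF p(1)] by (cases r) auto
  next
    case False
    then have "filter (\<lambda>k. c < k) \<nu> = []" using p(2) by (auto simp: filter_empty_conv)
    moreover have "\<not> c < (a # \<nu>) ! r" if "r < length (a # \<nu>)"
    proof (cases r)
      case (Suc k)
      then have "\<nu> ! k \<in> set \<nu>" using that by simp
      then have "\<nu> ! k \<le> a" using p(2) by blast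
      then show ?thesis using False Suc by simp
    qed (use False in simp)
    ultimately show ?thesis using False by auto
  qed
qed simp

lemma nth_sorted_list_of_set_mono:
  assumes "finite (A :: nat set)" "B \<subseteq> A" "r < card B"
  shows "sorted_list_of_set A ! r \<le> sorted_list_of_set B ! r"
proof -
  have fB: "finite B" using assms by (meson finite_subset)
  let ?v = "sorted_list_of_set A ! r"
  have r: "r < card A" using assms card_mono[OF assms(1,2)] by simp
  have "card A \<le> r + card (A \<inter> {?v..})" using le_nth_sorted_list_of_set[OF assms(1) r, of ?v] by simp
  moreover have "card A = card (A \<inter> {?v..}) + card (A - {?v..})"
    using assms(1) by (metis Int_Diff_Un Int_Diff_disjoint card_Un_disjoint finite_Diff finite_Int)
  moreover have "card B = card (B \<inter> {?v..}) + card (B - {?v..})"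
    using fB by (metis Int_Diff_Un Int_Diff_disjoint card_Un_disjoint finite_Diff finite_Int)
  moreover have "card (B - {?v..}) \<le> card (A - {?v..})" using assms by (intro card_mono) auto
  ultimately have "card B \<le> r + card (B \<inter> {?v..})" by linarith
  then show ?thesis using le_nth_sorted_list_of_set[OF fB assms(3), of ?v] by simp
qed

lemma key_tableau_in_Tab:
  assumes "Poly_Mapping.lookup \<gamma> 0 = 0"
  shows "key_tableau \<gamma> \<in> Tab {1..} (sorted_composition \<gamma>)"
proof -
  let ?K = "key_tableau \<gamma>" and ?s = "\<lambda>c. sorted_list_of_set (level c \<gamma>)"
  have K: "?K (r, c) = (if r < card (level c \<gamma>) then Some (?s c ! r) else None)" for r c
    by (simp add: key_tableau_def filling_of_columns_def)
  have dom: "dom ?K = diagram (sorted_composition \<gamma>)"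
  proof -
    have "(r, c) \<in> dom ?K \<longleftrightarrow> (r, c) \<in> diagram (sorted_composition \<gamma>)" for r c
      using partition_filter_iff[OF sorted_composition_props(1), of r c \<gamma>] card_level[of c \<gamma>]
      by (simp add: K diagram_def dom_def)
    then show ?thesis by auto
  qed
  have "ran ?K \<subseteq> {1..}"
  proof
    fix z assume "z \<in> ran ?K"
    then obtain r c where "r < card (level c \<gamma>)" "z = ?s c ! r"
      by (auto simp: ran_def K split: if_splits)
    then have "z \<in> set (?s c)" using nth_mem[of r "?s c"] by simp
    then have "z \<in> level c \<gamma>" using finite_key_column[of c \<gamma>] by simp
    then show "z \<in> {1..}" using assms by (cases "z = 0") auto
  qed
  moreover have "the (?K (r, c)) \<le> the (?K (r, c'))"
    if "c < c'" "(r, c) \<in> dom ?K" "(r, c') \<in> dom ?K" for r c c'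
  proof -
    have r: "r < card (level c \<gamma>)" "r < card (level c' \<gamma>)"
      using that(2,3) by (auto simp: K dom_def split: if_splits)
    have "level c' \<gamma> \<subseteq> level c \<gamma>" using that(1) by auto
    then show ?thesis
      using nth_sorted_list_of_set_mono[OF finite_key_column _ r(2)] r by (simp add: K)
  qed
  moreover have "the (?K (r, c)) < the (?K (r', c))"
    if "r < r'" "(r, c) \<in> dom ?K" "(r', c) \<in> dom ?K" for r r' c
  proof -
    have "r' < card (level c \<gamma>)" using that(3) by (auto simp: K dom_def split: if_splits)
    moreover have "?s c ! r < ?s c ! r'"
      using that(1) calculation sorted_wrt_nth_less[OF strict_sorted_list_of_set[of "level c \<gamma>"]] by simp
    ultimately show ?thesis using that(1) by (simp add: K)
  qed
  ultimately show ?thesis using dom unfolding Tab_def by blast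
qed

lemma set_column_word_iff: "z \<in> set (column_word c T) \<longleftrightarrow> (\<exists>r<length T. c < length (T ! r) \<and> T ! r ! c = z)"
proof (induction T)
  case (Cons R T)
  have "(\<exists>r<length (R # T). c < length ((R # T) ! r) \<and> (R # T) ! r ! c = z) \<longleftrightarrow>
      (c < length R \<and> R ! c = z) \<or> (\<exists>r<length T. c < length (T ! r) \<and> T ! r ! c = z)"
    by (auto simp: Ex_less_Suc2)
  then show ?case using Cons by auto
qed simp

lemma key_tableau_exists:
  assumes "Poly_Mapping.lookup \<gamma> 0 = 0"
  shows "\<exists>T. tab T \<and> set (concat T) \<subseteq> {1..} \<and> map length T = sorted_composition \<gamma> \<and>
    (\<forall>c. set (column_word c T) = level c \<gamma>)"
proof -
  obtain T where T: "key_tableau \<gamma> = fill T" "tab T" "map length T = sorted_composition \<gamma>"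
      "set (concat T) \<subseteq> {1..}"
    using key_tableau_in_Tab[OF assms] unfolding Tab_eq_fill[OF sorted_composition_props(1)] by auto
  have "set (column_word c T) = level c \<gamma>" for c
  proof (rule set_eqI)
    fix z
    have "z \<in> set (column_word c T) \<longleftrightarrow> (\<exists>r. fill T (r, c) = Some z)"
      unfolding set_column_word_iff fill_def by auto
    also have "\<dots> \<longleftrightarrow> (\<exists>r<length (sorted_list_of_set (level c \<gamma>)). sorted_list_of_set (level c \<gamma>) ! r = z)"
      unfolding T(1)[symmetric] key_tableau_def filling_of_columns_def by auto
    also have "\<dots> \<longleftrightarrow> z \<in> set (sorted_list_of_set (level c \<gamma>))" by (simp only: in_set_conv_nth)
    also have "\<dots> \<longleftrightarrow> z \<in> level c \<gamma>" by (simp only: set_sorted_list_of_set[OF finite_key_column])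
    finally show "z \<in> set (column_word c T) \<longleftrightarrow> z \<in> level c \<gamma>" .
  qed
  then show ?thesis using T by blast
qed

lemma tail_word_columns: "z \<in> set (tail_word c T) \<Longrightarrow> \<exists>k\<ge>c. z \<in> set (column_word k T)"
proof (induction T)
  case (Cons R T)
  show ?case
  proof (cases "z \<in> set (drop c R)")
    case True
    then obtain j where j: "j < length (drop c R)" "drop c R ! j = z" by (metis in_set_conv_nth)
    then have "c + j < length R" "R ! (c + j) = z" by auto
    then show ?thesis by (intro exI[of _ "c + j"]) simp
  next
    case False
    then obtain k where "k \<ge> c" "z \<in> set (column_word k T)" using Cons by auto
    then show ?thesis by (intro exI[of _ k]) simp
  qed
qed simp

text \<open>A column is a decreasing subword of the word that starts with it. The letters of the
  tableau above a threshold are therefore at most as many as those of its key.\<close>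

lemma filter_column_le:
  assumes "tab T" shows "length (filter (\<lambda>z. z \<in> U) (column_word c T)) \<le> dec_len U (tail_word c T)"
proof -
  have "subseq (column_word c T) (tail_word c T)"
  proof (induction T)
    case (Cons R T)
    have "subseq (if c < length R then [R ! c] else []) (drop c R)"
      by (auto simp: Cons_nth_drop_Suc[symmetric])
    then show ?case using Cons.IH by (simp only: column_word.simps tail_word.simps list_emb_append_mono)
  qed simp
  then have "subseq (filter (\<lambda>z. z \<in> U) (column_word c T)) (tail_word c T)"
    by (rule subseq_order.trans[OF subseq_filter_left])
  then show ?thesis
    using sorted_column_word[OF assms, of c] by (intro dec_len_ge) (auto simp: sorted_wrt_filter)
qed

lemma card_column: "tab T \<Longrightarrow> length (filter (\<lambda>z. z \<in> U) (column_word c T)) = card (set (column_word c T) \<inter> U)"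
proof -
  assume "tab T"
  then have "distinct (column_word c T)" using sorted_column_word[of T c]
    by (metis distinct_rev rev_rev_ident sorted_wrt_rev strict_sorted_iff)
  then show ?thesis
    by (simp add: distinct_card[symmetric] distinct_filter Int_def conj_commute)
qed

text \<open>A key tableau is its own right key: columns are nested, so every letter of the word
  already occurs in column \<open>c\<close>, and a chain has distinct letters.\<close>

lemma key_col_of_columns:
  assumes "tab T" "\<And>c. set (column_word c T) = level c \<gamma>"
  shows "key_col c T = level c \<gamma>"
proof (rule key_set_eqI[OF finite_key_column])
  fix v
  show "dec_len {v..} (tail_word c T) = card (level c \<gamma> \<inter> {v..})"
  proof (rule antisym)
    obtain s where s: "subseq s (tail_word c T)" "sorted_wrt (>) s" "set s \<subseteq> {v..}"
        "length s = dec_len {v..} (tail_word c T)"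
      using dec_len_witness by blast
    have "set s \<subseteq> level c \<gamma> \<inter> {v..}"
    proof
      fix z assume z: "z \<in> set s"
      obtain k where k: "k \<ge> c" "z \<in> set (column_word k T)"
        using tail_word_columns[OF in_set_subseq[OF s(1) z]] by blast
      then have "z \<in> level k \<gamma>" using assms(2) by simp
      then show "z \<in> level c \<gamma> \<inter> {v..}" using k(1) z s(3) by auto
    qed
    moreover have "distinct s" using s(2)
      by (metis distinct_rev rev_rev_ident sorted_wrt_rev strict_sorted_iff)
    ultimately have "length s \<le> card (level c \<gamma> \<inter> {v..})"
      using finite_key_column[of c \<gamma>] by (metis card_mono distinct_card finite_Int)
    then show "dec_len {v..} (tail_word c T) \<le> card (level c \<gamma> \<inter> {v..})" using s(4) by simp
    show "card (level c \<gamma> \<inter> {v..}) \<le> dec_len {v..} (tail_word c T)"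
      using filter_column_le[OF assms(1), of "{v..}" c] card_column[OF assms(1), of "{v..}" c] assms(2)[of c]
      by simp
  qed
qed

lemma key_comp_of_columns:
  assumes "tab T" "\<And>c. set (column_word c T) = level c \<gamma>"
  shows "key_comp T = \<gamma>"
proof (rule poly_mapping_eqI)
  fix i
  have "level c (key_comp T) = level c \<gamma>" for c
    using key_comp[OF assms(1), of c] key_col_of_columns[OF assms] by simp
  then have "c < Poly_Mapping.lookup (key_comp T) i \<longleftrightarrow> c < Poly_Mapping.lookup \<gamma> i" for c
    by (auto simp: set_eq_iff Suc_le_eq)
  then show "Poly_Mapping.lookup (key_comp T) i = Poly_Mapping.lookup \<gamma> i"
    by (metis linorder_neqE_nat less_irrefl)
qed

lemma size_filter_columns:
  "(\<forall>R\<in>set T. length R \<le> K) \<Longrightarrow>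
    size (filter_mset (\<lambda>z. z \<in> U) (mset (concat T))) = (\<Sum>c<K. length (filter (\<lambda>z. z \<in> U) (column_word c T)))"
proof (induction T)
  case (Cons R T)
  have "length (filter (\<lambda>z. z \<in> U) R) = card {c. c < length R \<and> R ! c \<in> U}"
    by (rule length_filter_conv_card)
  also have "{c. c < length R \<and> R ! c \<in> U} = {c \<in> {..<K}. c < length R \<and> R ! c \<in> U}"
    using Cons.prems by auto
  also have "card \<dots> = (\<Sum>c<K. length (filter (\<lambda>z. z \<in> U) (if c < length R then [R ! c] else [])))"
    unfolding card_eq_sum sum.inter_filter[OF finite_lessThan] by (intro sum.cong) auto
  finally have "size (filter_mset (\<lambda>z. z \<in> U) (mset R)) =
      (\<Sum>c<K. length (filter (\<lambda>z. z \<in> U) (if c < length R then [R ! c] else [])))"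
    by (simp add: mset_filter[symmetric] del: mset_filter)
  then show ?case using Cons by (simp add: sum.distrib)
qed simp

lemma sum_card_swap:
  assumes "finite A" "finite B"
  shows "(\<Sum>c\<in>A. card {k \<in> B. r c k}) = (\<Sum>k\<in>B. card {c \<in> A. r c k})"
  unfolding card_eq_sum sum.inter_filter[OF assms(1)] sum.inter_filter[OF assms(2)]
  by (rule sum.swap)

section \<open>The kernel of a region as a polynomial\<close>

abbreviation (input) adj :: "nat \<Rightarrow> nat \<Rightarrow> nat" where
  "adj i \<equiv> Transposition.transpose i (i + 1)"

definition region_msets :: "(nat \<Rightarrow> nat) \<Rightarrow> nat multiset \<Rightarrow> (nat \<times> nat) multiset set" where
  "region_msets l \<eta> = {A. set_mset A \<subseteq> region l {1..} {1..} \<and> image_mset snd A = \<eta>}"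

text \<open>The coefficient of the monomial with exponent multiset \<open>\<eta>\<close> in the
  second variables of the product over the region; what remains is a polynomial in the first
  variables.\<close>

definition kernel :: "(nat \<Rightarrow> nat) \<Rightarrow> nat multiset \<Rightarrow> xpoly" where
  "kernel l \<eta> = poly_gf (region_msets l \<eta>) (\<lambda>A. mset_monom id (image_mset fst A))"

text \<open>\<open>key_bound\<close> for all admissible thresholds, with \<open>Q\<close> entering
  only through the content \<open>\<alpha>\<close> of its key. For fixed \<open>\<alpha>\<close> the
  choices of \<open>P\<close> and \<open>Q\<close> become independent.\<close>

definition comp_bound :: "('a::linorder \<Rightarrow> 'b::linorder) \<Rightarrow> 'b list list \<Rightarrow> ('a \<Rightarrow>\<^sub>0 nat) \<Rightarrow> bool" where
  "comp_bound l P \<alpha> \<longleftrightarrow> (\<forall>a b. l a < b \<longrightarrow> (\<forall>c.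
     card ({i. c + 1 \<le> Poly_Mapping.lookup \<alpha> i} \<inter> {a..}) + card (key_col c P \<inter> {b..}) \<le> card (key_col c P)))"

definition bound_tabs :: "(nat \<Rightarrow> nat) \<Rightarrow> (nat \<Rightarrow>\<^sub>0 nat) \<Rightarrow> nat multiset \<Rightarrow> nat list list set" where
  "bound_tabs l \<alpha> \<eta> = {P. tab P \<and> set (concat P) \<subseteq> {1..} \<and> map length P = sorted_composition \<alpha> \<and>
     mset (concat P) = \<eta> \<and> comp_bound l P \<alpha>}"

definition comps :: "nat \<Rightarrow> nat \<Rightarrow> (nat \<Rightarrow>\<^sub>0 nat) set" where
  "comps n N = {\<alpha>. Poly_Mapping.keys \<alpha> \<subseteq> {1..n} \<and> degree_of \<alpha> = N}"

lemma finite_region_msets: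
  assumes "finite (region l {1..} {1..})" shows "finite (region_msets l \<eta>)"
proof -
  have "region_msets l \<eta> \<subseteq> mset ` {xs. set xs \<subseteq> region l {1..} {1..} \<and> length xs \<le> size \<eta>}"
  proof
    fix A assume A: "A \<in> region_msets l \<eta>"
    obtain xs where xs: "A = mset xs" by (metis ex_mset)
    have "size A = size \<eta>" using A unfolding region_msets_def by auto
    then show "A \<in> mset ` {xs. set xs \<subseteq> region l {1..} {1..} \<and> length xs \<le> size \<eta>}"
      using A xs by (auto simp: region_msets_def)
  qed
  then show ?thesis using finite_lists_length_le[OF assms] by (meson finite_imageI finite_subset)
qed

lemma finite_bound_tabs: "finite (bound_tabs l \<alpha> \<eta>)"
  by (rule finite_subset[OF _ finite_tabs_mset[of \<eta>]]) (auto simp: bound_tabs_def)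

lemma lookup_le_degree: "Poly_Mapping.lookup \<alpha> k \<le> degree_of \<alpha>"
proof (cases "k \<in> Poly_Mapping.keys \<alpha>")
  case True
  then show ?thesis unfolding degree_of_def by (intro member_le_sum) auto
qed (simp add: in_keys_iff)

lemma finite_comps: "finite (comps n N)"
proof -
  have "Poly_Mapping.lookup ` comps n N \<subseteq> {f. \<forall>x. (x \<in> {1..n} \<longrightarrow> f x \<in> {..N}) \<and> (x \<notin> {1..n} \<longrightarrow> f x = 0)}"
  proof
    fix f assume "f \<in> Poly_Mapping.lookup ` comps n N"
    then obtain \<alpha> where a: "f = Poly_Mapping.lookup \<alpha>" "Poly_Mapping.keys \<alpha> \<subseteq> {1..n}" "degree_of \<alpha> = N"
      by (auto simp: comps_def)
    have "f x \<le> N" for x using lookup_le_degree[of \<alpha> x] a by simp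
    moreover have "f x = 0" if "x \<notin> {1..n}" for x
      using that a(1,2) by (metis in_keys_iff subsetD)
    ultimately show "f \<in> {f. \<forall>x. (x \<in> {1..n} \<longrightarrow> f x \<in> {..N}) \<and> (x \<notin> {1..n} \<longrightarrow> f x = 0)}" by simp
  qed
  then have "finite (Poly_Mapping.lookup ` comps n N)"
    by (rule finite_subset) (rule finite_set_of_finite_funs, auto)
  moreover have "inj_on Poly_Mapping.lookup (comps n N)"
    by (rule inj_onI) (simp add: poly_mapping.lookup_inject)
  ultimately show ?thesis by (rule finite_imageD)
qed

lemma comp_bound_iff:
  assumes "tab P" "tab Q" "map length P = map length Q"
  shows "comp_bound l P (key_comp Q) \<longleftrightarrow> (\<forall>a b. l a < b \<longrightarrow> key_bound a b P Q)"
  unfolding comp_bound_def key_bound_iff_card[OF assms] key_comp[OF assms(2)] ..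

text \<open>Group the pairs \<open>(P, Q)\<close> by the key of \<open>Q\<close>; each group is a
  product of \<open>bound_tabs\<close> and \<open>key_tabs\<close>. Second letters start at
  \<open>1\<close>, so \<open>l k = 0\<close> excludes first letters beyond \<open>n\<close>, which
  confines \<open>\<alpha>\<close> to a finite set.\<close>

theorem kernel_expansion:
  assumes l: "antimono l" "\<And>k. k > n \<Longrightarrow> l k = 0"
  shows "kernel l \<eta> = (\<Sum>\<alpha>\<in>comps n (size \<eta>). of_nat (card (bound_tabs l \<alpha> \<eta>)) * atom_poly \<alpha>)"
proof -
  let ?BP = "bounded_pairs l {1..} {1..}"
  let ?m = "\<lambda>Q. mset_monom id (mset (concat Q))"
  obtain f where f: "bij_betw f {A. set_mset A \<subseteq> region l {1..} {1..}} ?BP"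
      "\<And>A. mset (concat (fst (f A))) = image_mset snd A" "\<And>A. mset (concat (snd (f A))) = image_mset fst A"
    using rsk_bounded[OF l(1), of "{1..}" "{1..}"] by blast
  let ?E = "{p \<in> ?BP. mset (concat (fst p)) = \<eta>}"
  let ?S = "SIGMA \<alpha>:comps n (size \<eta>). bound_tabs l \<alpha> \<eta> \<times> key_tabs \<alpha>"
  have "bij_betw f (region_msets l \<eta>) ?E"
    unfolding bij_betw_def
  proof
    show "inj_on f (region_msets l \<eta>)"
      by (rule inj_on_subset[OF bij_betw_imp_inj_on[OF f(1)]]) (auto simp: region_msets_def)
    show "f ` region_msets l \<eta> = ?E"
    proof (intro equalityI subsetI)
      fix p assume "p \<in> f ` region_msets l \<eta>"
      then obtain A where A: "p = f A" "set_mset A \<subseteq> region l {1..} {1..}" "image_mset snd A = \<eta>"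
        by (auto simp: region_msets_def)
      then show "p \<in> ?E" using f(2) bij_betw_apply[OF f(1), of A] by simp
    next
      fix p assume p: "p \<in> ?E"
      then obtain A where A: "p = f A" "set_mset A \<subseteq> region l {1..} {1..}"
        using bij_betw_imp_surj_on[OF f(1)] by blast
      then show "p \<in> f ` region_msets l \<eta>" using p f(2)[of A] by (auto simp: region_msets_def)
    qed
  qed
  then have "kernel l \<eta> = poly_gf ?E (\<lambda>p. ?m (snd p))"
    unfolding kernel_def by (rule poly_gf_bij) (simp add: f(3))
  also have "\<dots> = poly_gf ?S (\<lambda>(\<alpha>, P, Q). ?m Q)"
  proof (rule poly_gf_bij[where f = "\<lambda>(P, Q). (key_comp Q, P, Q)"])
    show "bij_betw (\<lambda>(P, Q). (key_comp Q, P, Q)) ?E ?S"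
      unfolding bij_betw_def
    proof
      show "(\<lambda>(P, Q). (key_comp Q, P, Q)) ` ?E = ?S"
      proof (intro equalityI subsetI)
        fix t assume "t \<in> (\<lambda>(P, Q). (key_comp Q, P, Q)) ` ?E"
        then obtain P Q where t: "t = (key_comp Q, P, Q)" and PQ: "(P, Q) \<in> ?BP" "mset (concat P) = \<eta>" by auto
        have tabs: "tab P" "tab Q" "map length P = map length Q" "set (concat Q) \<subseteq> {1..}"
            "set (concat P) \<subseteq> {1..}" "\<forall>a b. l a < b \<longrightarrow> key_bound a b P Q"
          using PQ(1) by (simp_all add: bounded_pairs_def)
        have "(P, Q) \<in> f ` {A. set_mset A \<subseteq> region l {1..} {1..}}"
          unfolding bij_betw_imp_surj_on[OF f(1)] by (rule PQ(1))
        then obtain A where A: "f A = (P, Q)" "set_mset A \<subseteq> region l {1..} {1..}" by auto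
        have sz: "size A = size \<eta>" using f(2)[of A] A(1) PQ(2) by (metis fst_conv size_image_mset)
        have sQ: "mset (concat Q) = image_mset fst A" using f(3)[of A] A(1) by simp
        have rows: "set (concat Q) \<subseteq> {1..n}"
        proof
          fix z assume "z \<in> set (concat Q)"
          then have "z \<in># mset (concat Q)" by (simp only: set_mset_mset)
          then obtain j where "(z, j) \<in># A" unfolding sQ by auto
          then have zj: "(z, j) \<in> region l {1..} {1..}" using A(2) by blast
          then have "l z \<noteq> 0" by (auto simp: region_def)
          then show "z \<in> {1..n}" using l(2)[of z] zj by (cases "n < z") (auto simp: region_def)
        qed
        have "Poly_Mapping.keys (key_comp Q) \<subseteq> {1..n}"
        proof
          fix k assume "k \<in> Poly_Mapping.keys (key_comp Q)"
          then have "k \<in> key_col 0 Q" unfolding key_comp[OF tabs(2)] by (simp add: in_keys_iff)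
          then have "k \<in> set (concat Q)" using key_set_subset[of "tail_word 0 Q"] unfolding set_tail_word_0 by blast
          then show "k \<in> {1..n}" using rows by blast
        qed
        moreover have "degree_of (key_comp Q) = size \<eta>"
          using length_concat_composition[OF sorted_composition_key_comp[OF tabs(2), symmetric]] sQ sz
          by (metis size_image_mset size_mset)
        ultimately have "key_comp Q \<in> comps n (size \<eta>)" by (simp add: comps_def)
        moreover have "P \<in> bound_tabs l (key_comp Q) \<eta>"
          using tabs PQ(2) comp_bound_iff[OF tabs(1-3)] sorted_composition_key_comp[OF tabs(2)]
          by (simp add: bound_tabs_def)
        moreover have "Q \<in> key_tabs (key_comp Q)" using tabs by (simp add: key_tabs_def)
        ultimately show "t \<in> ?S" using t by simp
      next
        fix t assume "t \<in> ?S"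
        then obtain \<alpha> P Q where t: "t = (\<alpha>, P, Q)" "P \<in> bound_tabs l \<alpha> \<eta>" "Q \<in> key_tabs \<alpha>" by auto
        have Q: "tab Q" "set (concat Q) \<subseteq> {1..}" "key_comp Q = \<alpha>" using t(3) by (simp_all add: key_tabs_def)
        have P: "tab P" "set (concat P) \<subseteq> {1..}" "map length P = sorted_composition \<alpha>"
            "mset (concat P) = \<eta>" "comp_bound l P \<alpha>" using t(2) by (simp_all add: bound_tabs_def)
        have sh: "map length P = map length Q" using P(3) sorted_composition_key_comp[OF Q(1)] Q(3) by simp
        have "(P, Q) \<in> ?E"
          using P Q sh comp_bound_iff[OF P(1) Q(1) sh, of l] by (simp add: bounded_pairs_def)
        then show "t \<in> (\<lambda>(P, Q). (key_comp Q, P, Q)) ` ?E" using t(1) Q(3) by force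
      qed
    qed (auto simp: inj_on_def)
  qed auto
  also have "\<dots> = (\<Sum>\<alpha>\<in>comps n (size \<eta>). \<Sum>(P, Q)\<in>bound_tabs l \<alpha> \<eta> \<times> key_tabs \<alpha>. Poly_Mapping.single (?m Q) 1)"
    unfolding poly_gf_def
    by (subst sum.Sigma) (simp_all add: finite_comps finite_bound_tabs finite_key_tabs case_prod_unfold)
  also have "\<dots> = (\<Sum>\<alpha>\<in>comps n (size \<eta>). of_nat (card (bound_tabs l \<alpha> \<eta>)) * atom_poly \<alpha>)"
    by (simp add: sum.cartesian_product[symmetric] atom_poly_def poly_gf_def)
  finally show ?thesis .
qed

section \<open>Staircases\<close>

definition stair :: "nat \<Rightarrow> nat \<Rightarrow> nat" where
  "stair n k = n + 1 - k"

text \<open>Rows \<open>i\<close> and \<open>i + 1\<close> of this region have equal length, so its kernel is symmetric in the variables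
  \<open>i\<close> and \<open>i + 1\<close>; it is the staircase with the cell \<open>(i + 1, n + 1 - i)\<close> added.\<close>

definition stair_plus :: "nat \<Rightarrow> nat \<Rightarrow> nat \<Rightarrow> nat" where
  "stair_plus n i k = (if k = i + 1 then n + 1 - i else n + 1 - k)"

lemma antimono_stair: "antimono (stair n)" "antimono (stair_plus n i)"
  by (auto simp: stair_def stair_plus_def intro!: antimonoI)

context
  fixes n i :: nat
  assumes i: "1 \<le> i" "i + 1 \<le> n"
begin

lemma region_stair_plus:
  "region (stair_plus n i) {1..} {1..} = insert (i + 1, n + 1 - i) (region (stair n) {1..} {1..})"
  "(i + 1, n + 1 - i) \<notin> region (stair n) {1..} {1..}"
  using i by (auto simp: region_def stair_def stair_plus_def split: if_splits)

lemma finite_region_stair: "finite (region (stair n) {1..} {1..})" "finite (region (stair_plus n i) {1..} {1..})"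
proof -
  show "finite (region (stair n) {1..} {1..})"
    by (rule finite_subset[of _ "{..n} \<times> {..n + 1}"]) (auto simp: region_def stair_def)
  then show "finite (region (stair_plus n i) {1..} {1..})" by (simp only: region_stair_plus(1) finite_insert)
qed

text \<open>The added cell contributes one geometric factor: a multiset avoids it or contains a copy
  that can be removed.\<close>

lemma kernel_stair_plus:
  "kernel (stair_plus n i) \<eta> = kernel (stair n) \<eta> +
    (if n + 1 - i \<in># \<eta> then pvar (i + 1) * kernel (stair_plus n i) (\<eta> - {#n + 1 - i#}) else 0)"
proof -
  let ?e = "(i + 1, n + 1 - i)" and ?l = "stair_plus n i"
  let ?w = "\<lambda>A :: (nat \<times> nat) multiset. mset_monom id (image_mset fst A)"
  let ?T = "{A \<in> region_msets ?l \<eta>. ?e \<in># A}"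
  have split: "region_msets ?l \<eta> = region_msets (stair n) \<eta> \<union> ?T"
    using region_stair_plus by (auto simp: region_msets_def)
  have disj: "region_msets (stair n) \<eta> \<inter> ?T = {}"
    using region_stair_plus(2) by (auto simp: region_msets_def)
  have fin: "finite (region_msets ?l \<kappa>)" for \<kappa> by (rule finite_region_msets[OF finite_region_stair(2)])
  have "kernel ?l \<eta> = poly_gf (region_msets (stair n) \<eta> \<union> ?T) ?w"
    unfolding kernel_def using split by simp
  also have "\<dots> = kernel (stair n) \<eta> + poly_gf ?T ?w"
    unfolding kernel_def using fin[of \<eta>] finite_region_msets[OF finite_region_stair(1)] disj
    by (intro poly_gf_Un) auto
  also have "poly_gf ?T ?w = (if n + 1 - i \<in># \<eta> then pvar (i + 1) * kernel ?l (\<eta> - {#n + 1 - i#}) else 0)"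
  proof (cases "n + 1 - i \<in># \<eta>")
    case True
    have "bij_betw (add_mset ?e) (region_msets ?l (\<eta> - {#n + 1 - i#})) ?T"
      unfolding bij_betw_def
    proof
      show "add_mset ?e ` region_msets ?l (\<eta> - {#n + 1 - i#}) = ?T"
      proof (intro equalityI subsetI)
        fix A assume "A \<in> add_mset ?e ` region_msets ?l (\<eta> - {#n + 1 - i#})"
        then obtain B where B: "A = add_mset ?e B" "B \<in> region_msets ?l (\<eta> - {#n + 1 - i#})" by blast
        then show "A \<in> ?T" using True region_stair_plus(1) by (simp add: region_msets_def)
      next
        fix A assume A: "A \<in> ?T"
        then have eq: "A = add_mset ?e (A - {#?e#})" by simp
        have "image_mset snd A = \<eta>" using A by (simp add: region_msets_def)
        then have "add_mset (n + 1 - i) (image_mset snd (A - {#?e#})) = \<eta>"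
          using eq by (metis image_mset_add_mset snd_conv)
        then have "image_mset snd (A - {#?e#}) = \<eta> - {#n + 1 - i#}" by (metis add_mset_remove_trivial)
        moreover have "set_mset (A - {#?e#}) \<subseteq> region ?l {1..} {1..}"
          using A by (auto simp: region_msets_def dest: in_diffD)
        ultimately show "A \<in> add_mset ?e ` region_msets ?l (\<eta> - {#n + 1 - i#})"
          using eq by (simp add: region_msets_def)
      qed
    qed (simp add: inj_on_def)
    then have "poly_gf ?T ?w = poly_gf (region_msets ?l (\<eta> - {#n + 1 - i#}))
        (\<lambda>A. Poly_Mapping.single (i + 1) 1 + ?w A)"
      by (rule poly_gf_bij[symmetric]) simp
    then show ?thesis using True by (simp add: kernel_def pvar_poly_gf)
  next
    case False
    have "?T = {}"
    proof (rule ccontr)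
      assume "?T \<noteq> {}"
      then obtain A where "A \<in> region_msets ?l \<eta>" "?e \<in># A" by blast
      then have "n + 1 - i \<in># image_mset snd A" "image_mset snd A = \<eta>"
        by (force simp: region_msets_def)+
      then show False using False by simp
    qed
    then show ?thesis using False by (simp only: poly_gf_def sum.empty if_False)
  qed
  finally show ?thesis .
qed

lemma swap_kernel_stair_plus: "swap_vars i (kernel (stair_plus n i) \<eta>) = kernel (stair_plus n i) \<eta>"
proof -
  let ?l = "stair_plus n i" and ?f = "image_mset (map_prod (adj i) id) :: (nat \<times> nat) multiset \<Rightarrow> _"
  have "swap_vars i (kernel ?l \<eta>) =
      poly_gf (region_msets ?l \<eta>) (\<lambda>A. mset_monom id (image_mset (adj i) (image_mset fst A)))"
    by (simp only: kernel_def swap_vars_poly_gf swap_exponents_mset_monom)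
  also have "\<dots> = kernel ?l \<eta>"
    unfolding kernel_def
  proof (rule poly_gf_bij)
    have inv: "?f (?f A) = A" for A
      by (simp add: multiset.map_comp comp_def map_prod_def case_prod_unfold)
    have mem: "?f A \<in> region_msets ?l \<eta>" if A: "A \<in> region_msets ?l \<eta>" for A
    proof -
      have "(adj i k, j) \<in> region ?l {1..} {1..}" if "(k, j) \<in> region ?l {1..} {1..}" for k j
        using that i by (auto simp: region_def stair_plus_def Transposition.transpose_def split: if_splits)
      then have "set_mset (?f A) \<subseteq> region ?l {1..} {1..}" using A by (force simp: region_msets_def)
      moreover have "image_mset snd (?f A) = image_mset snd A" by (simp add: multiset.map_comp comp_def)
      ultimately show ?thesis using A by (simp add: region_msets_def)
    qed
    show "bij_betw ?f (region_msets ?l \<eta>) (region_msets ?l \<eta>)"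
      by (rule bij_betw_byWitness[where f' = ?f]) (use inv mem in auto)
    show "mset_monom id (image_mset fst (?f A)) = mset_monom id (image_mset (adj i) (image_mset fst A))" for A
      by (simp add: multiset.map_comp comp_def)
  qed
  finally show ?thesis .
qed

text \<open>Write \<open>K\<close> and \<open>K'\<close> for the two kernels at
  \<open>\<eta>\<close>. The added cell gives \<open>K' = K + pvar (i + 1) * T\<close>. As
  \<open>K'\<close> and \<open>T\<close> are symmetric, exchanging the variables gives
  \<open>K' = swap_vars i K + pvar i * T\<close>, and \<open>T\<close> is eliminated.\<close>

lemma kernel_exchange:
  "pvar i * kernel (stair n) \<eta> - pvar (i + 1) * swap_vars i (kernel (stair n) \<eta>) =
    (pvar i - pvar (i + 1)) * kernel (stair_plus n i) \<eta>"
proof -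
  define T where "T = (if n + 1 - i \<in># \<eta> then kernel (stair_plus n i) (\<eta> - {#n + 1 - i#}) else 0)"
  have swT: "swap_vars i (pvar (i + 1) * T) = pvar i * T"
  proof (cases "n + 1 - i \<in># \<eta>")
    case True
    let ?l = "stair_plus n i" and ?\<kappa> = "\<eta> - {#n + 1 - i#}"
    let ?w = "\<lambda>A :: (nat \<times> nat) multiset. mset_monom id (image_mset fst A)"
    have sg: "swap_exponents i (Poly_Mapping.single (i + 1) 1) = Poly_Mapping.single i 1"
      using swap_exponents_mset_monom[of i "{#i + 1#}"] by simp
    have "swap_vars i (pvar (i + 1) * T) =
        poly_gf (region_msets ?l ?\<kappa>) (\<lambda>A. Poly_Mapping.single i 1 + swap_exponents i (?w A))"
      using True by (simp only: T_def if_True kernel_def pvar_poly_gf swap_vars_poly_gf swap_exponents_add sg)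
    also have "\<dots> = pvar i * swap_vars i T"
      using True by (simp only: T_def if_True kernel_def pvar_poly_gf swap_vars_poly_gf)
    also have "swap_vars i T = T" using True by (simp add: T_def swap_kernel_stair_plus)
    finally show ?thesis .
  qed (simp add: T_def swap_vars_0)
  have K: "kernel (stair_plus n i) \<eta> = kernel (stair n) \<eta> + pvar (i + 1) * T"
    using kernel_stair_plus[of \<eta>] by (simp add: T_def)
  have K': "kernel (stair_plus n i) \<eta> = swap_vars i (kernel (stair n) \<eta>) + pvar i * T"
    using arg_cong[OF K, of "swap_vars i"] by (simp only: swap_kernel_stair_plus swap_vars_add swT)
  have "kernel (stair n) \<eta> = kernel (stair_plus n i) \<eta> - pvar (i + 1) * T"
    "swap_vars i (kernel (stair n) \<eta>) = kernel (stair_plus n i) \<eta> - pvar i * T"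
    using K K' by (simp_all add: eq_diff_eq)
  then show ?thesis by (simp only:) (simp add: algebra_simps)
qed

section \<open>Effect of the added cell on the bounds and the expansion\<close>

lemma level_swap: "level c (swap_exponents i \<alpha>) = adj i ` level c \<alpha>"
proof (rule set_eqI)
  fix k
  have "k \<in> adj i ` level c \<alpha> \<longleftrightarrow> adj i k \<in> level c \<alpha>"
  proof
    assume "k \<in> adj i ` level c \<alpha>"
    then obtain m where "k = adj i m" "m \<in> level c \<alpha>" by (rule imageE)
    then show "adj i k \<in> level c \<alpha>" by (simp only: transpose_involutory)
  next
    assume "adj i k \<in> level c \<alpha>"
    then show "k \<in> adj i ` level c \<alpha>" by (rule image_eqI[rotated]) (simp only: transpose_involutory)
  qed
  then show "k \<in> level c (swap_exponents i \<alpha>) \<longleftrightarrow> k \<in> adj i ` level c \<alpha>"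
    by (simp add: lookup_swap_exponents)
qed

lemma sorted_composition_swap: "sorted_composition (swap_exponents i \<alpha>) = sorted_composition \<alpha>"
  by (rule sorted_composition_cong) (simp only: level_swap card_image[OF inj_on_subset[OF inj_adjacent subset_UNIV]])

text \<open>The exchange preserves \<open>{a..}\<close> unless \<open>a = i + 1\<close>. For that
  threshold the condition at \<open>i\<close> is stronger, since \<open>stair_plus n i\<close> takes
  the same value at \<open>i\<close> and \<open>i + 1\<close>.\<close>

lemma comp_bound_swap_imp:
  assumes "comp_bound (stair_plus n i) P \<alpha>" shows "comp_bound (stair_plus n i) P (swap_exponents i \<alpha>)"
  unfolding comp_bound_def
proof (intro allI impI)
  fix a b c assume ab: "stair_plus n i a < b"
  have inv: "card (adj i ` level c \<alpha> \<inter> {d..}) = card (level c \<alpha> \<inter> {d..})" if "d \<noteq> i + 1" for d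
  proof -
    have "adj i ` level c \<alpha> \<inter> {d..} = adj i ` (level c \<alpha> \<inter> {d..})"
    proof -
      have "adj i k \<in> {d..} \<longleftrightarrow> k \<in> {d..}" for k
        using that by (auto simp: Transposition.transpose_def)
      then show ?thesis by blast
    qed
    then show ?thesis by (simp only: card_image[OF inj_on_subset[OF inj_adjacent subset_UNIV]])
  qed
  have fin: "finite (adj i ` level c \<alpha>)" using finite_key_column[of c \<alpha>] by (rule finite_imageI)
  have "card (adj i ` level c \<alpha> \<inter> {a..}) + card (key_col c P \<inter> {b..}) \<le> card (key_col c P)"
  proof (cases "a = i + 1")
    case False
    then show ?thesis using assms ab inv[of a] unfolding comp_bound_def by simp
  next
    case True
    have "stair_plus n i i < b" using ab True by (simp add: stair_plus_def)
    then have "card (adj i ` level c \<alpha> \<inter> {i..}) + card (key_col c P \<inter> {b..}) \<le> card (key_col c P)"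
      using assms inv[of i] unfolding comp_bound_def by simp
    moreover have "card (adj i ` level c \<alpha> \<inter> {a..}) \<le> card (adj i ` level c \<alpha> \<inter> {i..})"
      using True fin by (intro card_mono) auto
    ultimately show ?thesis by simp
  qed
  then show "card (level c (swap_exponents i \<alpha>) \<inter> {a..}) + card (key_col c P \<inter> {b..}) \<le> card (key_col c P)"
    by (simp only: level_swap)
qed

lemma bound_tabs_swap: "bound_tabs (stair_plus n i) (swap_exponents i \<alpha>) \<eta> = bound_tabs (stair_plus n i) \<alpha> \<eta>"
  using comp_bound_swap_imp[of _ \<alpha>] comp_bound_swap_imp[of _ "swap_exponents i \<alpha>"]
  by (auto simp: bound_tabs_def sorted_composition_swap)

text \<open>The only thresholds tested for \<open>stair n\<close> but not for
  \<open>stair_plus n i\<close> are \<open>a = i + 1\<close> and \<open>b = n + 1 - i\<close>. If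
  the column contains \<open>i + 1\<close>, it contains \<open>i\<close> too, and the condition at
  \<open>i\<close> and \<open>b + 1\<close> has one more element on the first count and at most one
  fewer on the second. Otherwise the condition at \<open>i + 2\<close> and \<open>b\<close> is the
  required one.\<close>

lemma comp_bound_stair_plus_imp:
  assumes ge: "Poly_Mapping.lookup \<alpha> (i + 1) \<le> Poly_Mapping.lookup \<alpha> i"
    and cb: "comp_bound (stair_plus n i) P \<alpha>"
  shows "comp_bound (stair n) P \<alpha>"
  unfolding comp_bound_def
proof (intro allI impI)
  fix a b c assume ab: "stair n a < b"
  note use = cb[unfolded comp_bound_def, rule_format]
  have finL: "finite (level c \<alpha>)" by (rule finite_key_column)
  show "card (level c \<alpha> \<inter> {a..}) + card (key_col c P \<inter> {b..}) \<le> card (key_col c P)"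
  proof (cases "stair_plus n i a < b")
    case True
    then show ?thesis by (rule use)
  next
    case False
    then have a: "a = i + 1" and b: "b = n + 1 - i"
      using ab i by (auto simp: stair_def stair_plus_def split: if_splits)
    show ?thesis
    proof (cases "i + 1 \<in> level c \<alpha>")
      case True
      then have il: "i \<in> level c \<alpha>" using ge by simp
      have "stair_plus n i i < b + 1" using b by (simp add: stair_plus_def)
      then have 1: "card (level c \<alpha> \<inter> {i..}) + card (key_col c P \<inter> {b + 1..}) \<le> card (key_col c P)" by (rule use)
      have "level c \<alpha> \<inter> {i..} = insert i (level c \<alpha> \<inter> {a..})" using il a by auto
      moreover have "i \<notin> level c \<alpha> \<inter> {a..}" using a by simp
      ultimately have 2: "card (level c \<alpha> \<inter> {i..}) = Suc (card (level c \<alpha> \<inter> {a..}))"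
        using finL by (simp only: card_insert_disjoint finite_Int simp_thms)
      have "key_col c P \<inter> {b..} \<subseteq> insert b (key_col c P \<inter> {b + 1..})" by auto
      then have "card (key_col c P \<inter> {b..}) \<le> card (insert b (key_col c P \<inter> {b + 1..}))"
        by (intro card_mono) auto
      also have "\<dots> \<le> Suc (card (key_col c P \<inter> {b + 1..}))" by (simp add: card_insert_if)
      finally show ?thesis using 1 2 by simp
    next
      case False
      have "level c \<alpha> \<inter> {a..} = level c \<alpha> \<inter> {i + 2..}"
      proof (rule set_eqI)
        fix k show "k \<in> level c \<alpha> \<inter> {a..} \<longleftrightarrow> k \<in> level c \<alpha> \<inter> {i + 2..}"
          using False a by (cases "k = i + 1") auto
      qed
      moreover have "stair_plus n i (i + 2) < b" using b i by (simp add: stair_plus_def)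
      then have "card (level c \<alpha> \<inter> {i + 2..}) + card (key_col c P \<inter> {b..}) \<le> card (key_col c P)" by (rule use)
      ultimately show ?thesis by simp
    qed
  qed
qed

lemma bound_tabs_stair_plus:
  assumes "Poly_Mapping.lookup \<alpha> (i + 1) \<le> Poly_Mapping.lookup \<alpha> i"
  shows "bound_tabs (stair_plus n i) \<alpha> \<eta> = bound_tabs (stair n) \<alpha> \<eta>"
proof -
  have "comp_bound (stair_plus n i) P \<alpha>" if "comp_bound (stair n) P \<alpha>" for P :: "nat list list"
  proof -
    have "stair n a < b" if "stair_plus n i a < b" for a b
      using that by (auto simp: stair_def stair_plus_def split: if_splits)
    then show ?thesis using that unfolding comp_bound_def by blast
  qed
  then show ?thesis using comp_bound_stair_plus_imp[OF assms] unfolding bound_tabs_def by blast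
qed

lemma degree_swap: "degree_of (swap_exponents i \<alpha>) = degree_of \<alpha>"
proof -
  have d: "degree_of \<beta> = sum_list (sorted_composition \<beta>)" for \<beta> :: "nat \<Rightarrow>\<^sub>0 nat"
    using sorted_composition_props(2)[of \<beta>]
    by (metis degree_of_def sum_mset_sum_list sum_unfold_sum_mset)
  show ?thesis unfolding d sorted_composition_swap ..
qed

lemma swap_comps: "\<alpha> \<in> comps n N \<Longrightarrow> swap_exponents i \<alpha> \<in> comps n N"
proof -
  assume a: "\<alpha> \<in> comps n N"
  have "k \<in> {1..n}" if "k \<in> Poly_Mapping.keys (swap_exponents i \<alpha>)" for k
  proof -
    have "adj i k \<in> Poly_Mapping.keys \<alpha>" using that by (simp add: in_keys_iff lookup_swap_exponents)
    then have "adj i k \<in> {1..n}" using a by (auto simp: comps_def)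
    then show ?thesis using i by (auto simp: Transposition.transpose_def split: if_splits)
  qed
  then show ?thesis using a by (auto simp: comps_def degree_swap)
qed

text \<open>In the expansion of \<open>kernel (stair_plus n i)\<close> a composition and its
  exchange have the same coefficient. Their atoms are collected at the member whose larger part
  comes first, where that coefficient is also the one for \<open>stair n\<close>; the other member
  receives \<open>0\<close>.\<close>

definition atom_pair :: "(nat \<Rightarrow>\<^sub>0 nat) \<Rightarrow> xpoly" where
  "atom_pair \<alpha> = (if Poly_Mapping.lookup \<alpha> (i + 1) < Poly_Mapping.lookup \<alpha> i
     then atom_poly \<alpha> + atom_poly (swap_exponents i \<alpha>)
     else if Poly_Mapping.lookup \<alpha> (i + 1) = Poly_Mapping.lookup \<alpha> i then atom_poly \<alpha> else 0)"

lemma kernel_stair_plus_expansion: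
  "kernel (stair_plus n i) \<eta> =
    (\<Sum>\<alpha>\<in>comps n (size \<eta>). of_nat (card (bound_tabs (stair n) \<alpha> \<eta>)) * atom_pair \<alpha>)"
proof -
  let ?D = "comps n (size \<eta>)"
  let ?lk = "Poly_Mapping.lookup :: (nat \<Rightarrow>\<^sub>0 nat) \<Rightarrow> _"
  let ?F = "\<lambda>\<alpha>. of_nat (card (bound_tabs (stair n) \<alpha> \<eta>)) :: xpoly"
  let ?G = "\<lambda>\<alpha>. of_nat (card (bound_tabs (stair_plus n i) \<alpha> \<eta>)) :: xpoly"
  let ?gt = "{\<alpha> \<in> ?D. ?lk \<alpha> (i + 1) < ?lk \<alpha> i}" and ?eq = "{\<alpha> \<in> ?D. ?lk \<alpha> (i + 1) = ?lk \<alpha> i}"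
    and ?lt = "{\<alpha> \<in> ?D. ?lk \<alpha> i < ?lk \<alpha> (i + 1)}"
  have fin: "finite ?D" by (rule finite_comps)
  have D: "?D = ?gt \<union> (?eq \<union> ?lt)" by auto
  have sum3: "(\<Sum>\<alpha>\<in>?D. h \<alpha>) = (\<Sum>\<alpha>\<in>?gt. h \<alpha>) + ((\<Sum>\<alpha>\<in>?eq. h \<alpha>) + (\<Sum>\<alpha>\<in>?lt. h \<alpha>))"
    for h :: "(nat \<Rightarrow>\<^sub>0 nat) \<Rightarrow> xpoly"
  proof -
    have "(\<Sum>\<alpha>\<in>?D. h \<alpha>) = (\<Sum>\<alpha>\<in>?gt \<union> (?eq \<union> ?lt). h \<alpha>)" using D by (rule sum.cong) simp
    also have "\<dots> = (\<Sum>\<alpha>\<in>?gt. h \<alpha>) + (\<Sum>\<alpha>\<in>?eq \<union> ?lt. h \<alpha>)"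
      by (rule sum.union_disjoint) (use fin in auto)
    also have "(\<Sum>\<alpha>\<in>?eq \<union> ?lt. h \<alpha>) = (\<Sum>\<alpha>\<in>?eq. h \<alpha>) + (\<Sum>\<alpha>\<in>?lt. h \<alpha>)"
      by (rule sum.union_disjoint) (use fin in auto)
    finally show ?thesis .
  qed
  have "kernel (stair_plus n i) \<eta> = (\<Sum>\<alpha>\<in>?D. ?G \<alpha> * atom_poly \<alpha>)"
    using i by (intro kernel_expansion antimono_stair) (auto simp: stair_plus_def)
  also have "\<dots> = (\<Sum>\<alpha>\<in>?gt. ?G \<alpha> * atom_poly \<alpha>) +
      ((\<Sum>\<alpha>\<in>?eq. ?G \<alpha> * atom_poly \<alpha>) + (\<Sum>\<alpha>\<in>?lt. ?G \<alpha> * atom_poly \<alpha>))" by (rule sum3)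
  also have "(\<Sum>\<alpha>\<in>?gt. ?G \<alpha> * atom_poly \<alpha>) = (\<Sum>\<alpha>\<in>?gt. ?F \<alpha> * atom_poly \<alpha>)"
    by (rule sum.cong) (simp_all add: bound_tabs_stair_plus)
  also have "(\<Sum>\<alpha>\<in>?eq. ?G \<alpha> * atom_poly \<alpha>) = (\<Sum>\<alpha>\<in>?eq. ?F \<alpha> * atom_poly \<alpha>)"
    by (rule sum.cong) (simp_all add: bound_tabs_stair_plus)
  also have "(\<Sum>\<alpha>\<in>?lt. ?G \<alpha> * atom_poly \<alpha>) = (\<Sum>\<alpha>\<in>?gt. ?F \<alpha> * atom_poly (swap_exponents i \<alpha>))"
  proof (rule sum.reindex_bij_witness[where i = "swap_exponents i" and j = "swap_exponents i"])
    show "swap_exponents i \<alpha> \<in> ?gt" if "\<alpha> \<in> ?lt" for \<alpha>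
      using that swap_comps by (simp add: lookup_swap_exponents)
    show "swap_exponents i \<alpha> \<in> ?lt" if "\<alpha> \<in> ?gt" for \<alpha>
      using that swap_comps by (simp add: lookup_swap_exponents)
    show "?F (swap_exponents i \<alpha>) * atom_poly (swap_exponents i (swap_exponents i \<alpha>)) = ?G \<alpha> * atom_poly \<alpha>"
      if "\<alpha> \<in> ?lt" for \<alpha>
    proof -
      have "Poly_Mapping.lookup (swap_exponents i \<alpha>) (i + 1) \<le> Poly_Mapping.lookup (swap_exponents i \<alpha>) i"
        using that by (simp add: lookup_swap_exponents)
      from bound_tabs_stair_plus[OF this, of \<eta>] show ?thesis by (simp add: bound_tabs_swap)
    qed
  qed simp_all
  also have "(\<Sum>\<alpha>\<in>?gt. ?F \<alpha> * atom_poly \<alpha>) + ((\<Sum>\<alpha>\<in>?eq. ?F \<alpha> * atom_poly \<alpha>) +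
      (\<Sum>\<alpha>\<in>?gt. ?F \<alpha> * atom_poly (swap_exponents i \<alpha>))) =
      (\<Sum>\<alpha>\<in>?gt. ?F \<alpha> * atom_pair \<alpha>) + ((\<Sum>\<alpha>\<in>?eq. ?F \<alpha> * atom_pair \<alpha>) + (\<Sum>\<alpha>\<in>?lt. ?F \<alpha> * atom_pair \<alpha>))"
  proof -
    have "(\<Sum>\<alpha>\<in>?gt. ?F \<alpha> * atom_pair \<alpha>) =
        (\<Sum>\<alpha>\<in>?gt. ?F \<alpha> * atom_poly \<alpha> + ?F \<alpha> * atom_poly (swap_exponents i \<alpha>))"
      by (rule sum.cong) (simp_all add: atom_pair_def distrib_left)
    moreover have "(\<Sum>\<alpha>\<in>?eq. ?F \<alpha> * atom_pair \<alpha>) = (\<Sum>\<alpha>\<in>?eq. ?F \<alpha> * atom_poly \<alpha>)"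
      by (rule sum.cong) (simp_all add: atom_pair_def)
    moreover have "(\<Sum>\<alpha>\<in>?lt. ?F \<alpha> * atom_pair \<alpha>) = 0"
      by (rule sum.neutral) (auto simp: atom_pair_def)
    ultimately show ?thesis by (simp add: sum.distrib ac_simps)
  qed
  also have "\<dots> = (\<Sum>\<alpha>\<in>?D. ?F \<alpha> * atom_pair \<alpha>)" by (rule sum3[symmetric])
  finally show ?thesis .
qed

text \<open>Both expansions are substituted into \<open>kernel_exchange\<close>. The coefficients
  agree, so each \<open>\<alpha>\<close> carries a factor free of \<open>\<eta>\<close>, to which
  independence applies.\<close>

lemma exchange_combination:
  "(\<Sum>\<alpha>\<in>comps n (size \<eta>). of_nat (card (bound_tabs (stair n) \<alpha> \<eta>)) *
    (pvar i * atom_poly \<alpha> - pvar (i + 1) * swap_vars i (atom_poly \<alpha>) - (pvar i - pvar (i + 1)) * atom_pair \<alpha>)) = 0"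
proof -
  let ?D = "comps n (size \<eta>)"
  let ?F = "\<lambda>\<alpha>. of_nat (card (bound_tabs (stair n) \<alpha> \<eta>)) :: xpoly"
  have K: "kernel (stair n) \<eta> = (\<Sum>\<alpha>\<in>?D. ?F \<alpha> * atom_poly \<alpha>)"
    by (intro kernel_expansion antimono_stair) (simp add: stair_def)
  have "(\<Sum>\<alpha>\<in>?D. ?F \<alpha> * (pvar i * atom_poly \<alpha> - pvar (i + 1) * swap_vars i (atom_poly \<alpha>)
      - (pvar i - pvar (i + 1)) * atom_pair \<alpha>)) =
      pvar i * (\<Sum>\<alpha>\<in>?D. ?F \<alpha> * atom_poly \<alpha>) - pvar (i + 1) * (\<Sum>\<alpha>\<in>?D. ?F \<alpha> * swap_vars i (atom_poly \<alpha>))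
      - (pvar i - pvar (i + 1)) * (\<Sum>\<alpha>\<in>?D. ?F \<alpha> * atom_pair \<alpha>)"
    by (simp only: sum_distrib_left sum_subtractf[symmetric]) (intro sum.cong refl, simp only: right_diff_distrib mult.left_commute)
  also have "(\<Sum>\<alpha>\<in>?D. ?F \<alpha> * swap_vars i (atom_poly \<alpha>)) = swap_vars i (kernel (stair n) \<eta>)"
    by (simp only: K swap_vars_sum swap_vars_of_nat)
  finally show ?thesis
    unfolding K[symmetric] kernel_stair_plus_expansion[symmetric] kernel_exchange by simp
qed

end

section \<open>Independence and the recursion for the atoms\<close>

text \<open>Partial sums give the dominance order on compositions, with respect to which the numbers
  of bounded tableaux are triangular.\<close>

definition psum :: "nat \<Rightarrow> (nat \<Rightarrow>\<^sub>0 nat) \<Rightarrow> nat" where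
  "psum t \<alpha> = (\<Sum>k\<in>{1..t}. Poly_Mapping.lookup \<alpha> k)"

lemma psum_le_degree: "psum t \<alpha> \<le> degree_of \<alpha>"
proof -
  let ?A = "{1..t} \<union> Poly_Mapping.keys \<alpha>"
  have "degree_of \<alpha> = (\<Sum>k\<in>?A. Poly_Mapping.lookup \<alpha> k)" by (rule degree_of_superset) auto
  then show ?thesis unfolding psum_def by (simp only:) (rule sum_mono2, auto)
qed

lemma psum_inj:
  assumes "Poly_Mapping.keys \<alpha> \<subseteq> {1..n}" "Poly_Mapping.keys \<beta> \<subseteq> {1..n}" "\<forall>t\<in>{1..n}. psum t \<alpha> = psum t \<beta>"
  shows "\<alpha> = \<beta>"
proof (rule poly_mapping_eqI)
  fix k
  show "Poly_Mapping.lookup \<alpha> k = Poly_Mapping.lookup \<beta> k"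
  proof (cases "k \<in> {1..n}")
    case True
    then obtain j where j: "k = Suc j" by (cases k) auto
    have step: "psum k \<gamma> = psum j \<gamma> + Poly_Mapping.lookup \<gamma> k" for \<gamma> by (simp add: psum_def j)
    have "psum j \<alpha> = psum j \<beta>"
    proof (cases "j = 0")
      case False
      then show ?thesis using assms(3) True j by simp
    qed (simp add: psum_def)
    then show ?thesis using step[of \<alpha>] step[of \<beta>] assms(3) True by simp
  next
    case False
    then show ?thesis using assms(1,2) by (metis in_keys_iff subsetD)
  qed
qed

lemma card_lt: "card {c \<in> {..<K :: nat}. c + 1 \<le> m} = min K m"
proof -
  have "{c \<in> {..<K}. c + 1 \<le> m} = {..<min K m}" by auto
  then show ?thesis by simp
qed

text \<open>At thresholds \<open>t + 1\<close> and \<open>n + 1 - t\<close> the bound leaves room in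
  a key column of \<open>P\<close> for at most as many letters \<open>\<ge> n + 1 - t\<close> as
  \<open>\<alpha>\<close> has letters \<open>\<le> t\<close> in its key column. The entries of
  \<open>P\<close> are controlled by its key, and summation over the columns gives the partial
  sum.\<close>

lemma bound_tabs_filter_le:
  assumes P: "P \<in> bound_tabs (stair n) \<alpha> \<eta>" and keys: "Poly_Mapping.keys \<alpha> \<subseteq> {1..n}" and t: "t \<in> {1..n}"
  shows "size (filter_mset (\<lambda>z. z \<in> {n + 1 - t..}) \<eta>) \<le> psum t \<alpha>"
proof -
  let ?b = "n + 1 - t"
  have tP: "tab P" "map length P = sorted_composition \<alpha>" "mset (concat P) = \<eta>" "comp_bound (stair n) P \<alpha>"
    using P by (simp_all add: bound_tabs_def)
  define K where "K = length (concat P)"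
  have rows: "\<forall>R\<in>set P. length R \<le> K" unfolding K_def by (induction P) auto
  have bd: "length (filter (\<lambda>z. z \<in> {?b..}) (column_word c P)) \<le> card {k \<in> {1..t}. c + 1 \<le> Poly_Mapping.lookup \<alpha> k}" for c
  proof -
    have finL: "finite (level c \<alpha>)" by (rule finite_key_column)
    have "stair n (t + 1) < ?b" using t unfolding stair_def atLeastAtMost_iff by arith
    then have "card (level c \<alpha> \<inter> {t + 1..}) + card (key_col c P \<inter> {?b..}) \<le> card (key_col c P)"
      using tP(4) unfolding comp_bound_def by blast
    moreover have "card (key_col c P) = card (level c \<alpha>)"
      using card_key_col[OF tP(1)] col_len_filter[of c P] card_level[of c \<alpha>] tP(2) by simp
    moreover have "card (level c \<alpha>) = card (level c \<alpha> \<inter> {t + 1..}) + card (level c \<alpha> - {t + 1..})"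
      using finL by (metis Int_Diff_Un Int_Diff_disjoint card_Un_disjoint finite_Diff finite_Int)
    moreover have "level c \<alpha> - {t + 1..} \<subseteq> {k \<in> {1..t}. c + 1 \<le> Poly_Mapping.lookup \<alpha> k}"
    proof
      fix k assume k: "k \<in> level c \<alpha> - {t + 1..}"
      then have "k \<in> Poly_Mapping.keys \<alpha>" by (simp add: in_keys_iff)
      then have "1 \<le> k" using keys by auto
      then show "k \<in> {k \<in> {1..t}. c + 1 \<le> Poly_Mapping.lookup \<alpha> k}" using k by auto
    qed
    then have "card (level c \<alpha> - {t + 1..}) \<le> card {k \<in> {1..t}. c + 1 \<le> Poly_Mapping.lookup \<alpha> k}"
      by (rule card_mono[rotated]) simp
    moreover have "length (filter (\<lambda>z. z \<in> {?b..}) (column_word c P)) \<le> card (key_col c P \<inter> {?b..})"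
      using filter_column_le[OF tP(1), of "{?b..}" c] by (simp add: card_key_set)
    ultimately show ?thesis by linarith
  qed
  have "size (filter_mset (\<lambda>z. z \<in> {?b..}) \<eta>) = (\<Sum>c<K. length (filter (\<lambda>z. z \<in> {?b..}) (column_word c P)))"
    unfolding tP(3)[symmetric] by (rule size_filter_columns[OF rows])
  also have "\<dots> \<le> (\<Sum>c<K. card {k \<in> {1..t}. c + 1 \<le> Poly_Mapping.lookup \<alpha> k})"
    by (rule sum_mono) (rule bd)
  also have "\<dots> = (\<Sum>k\<in>{1..t}. card {c \<in> {..<K}. c + 1 \<le> Poly_Mapping.lookup \<alpha> k})"
    by (rule sum_card_swap) simp_all
  also have "\<dots> \<le> psum t \<alpha>" unfolding psum_def card_lt by (rule sum_mono) simp
  finally show ?thesis .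
qed

text \<open>Witness: the key tableau of the reversed composition attains all the bounds of
  \<open>bound_tabs_filter_le\<close>.\<close>

lemma bound_tabs_extremal:
  assumes keys: "Poly_Mapping.keys \<alpha> \<subseteq> {1..n}"
  shows "\<exists>\<eta>. bound_tabs (stair n) \<alpha> \<eta> \<noteq> {} \<and> size \<eta> = degree_of \<alpha> \<and>
    (\<forall>t\<in>{1..n}. size (filter_mset (\<lambda>z. z \<in> {n + 1 - t..}) \<eta>) = psum t \<alpha>)"
proof -
  let ?lk = "Poly_Mapping.lookup \<alpha>"
  define \<gamma> where "\<gamma> = Abs_poly_mapping (\<lambda>j. if j \<in> {1..n} then ?lk (n + 1 - j) else 0)"
  have "finite {j. (if j \<in> {1..n} then ?lk (n + 1 - j) else 0) \<noteq> 0}"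
    by (rule finite_subset[of _ "{1..n}"]) auto
  then have lk: "Poly_Mapping.lookup \<gamma> j = (if j \<in> {1..n} then ?lk (n + 1 - j) else 0)" for j
    unfolding \<gamma>_def by (simp add: Abs_poly_mapping_inverse)
  have out: "?lk k = 0" if "k \<notin> {1..n}" for k using that keys by (metis in_keys_iff subsetD)
  have lev: "level c \<gamma> = (\<lambda>k. n + 1 - k) ` level c \<alpha>" for c
  proof (rule set_eqI)
    fix j
    show "j \<in> level c \<gamma> \<longleftrightarrow> j \<in> (\<lambda>k. n + 1 - k) ` level c \<alpha>"
    proof
      assume "j \<in> level c \<gamma>"
      then have j: "j \<in> {1..n}" "n + 1 - j \<in> level c \<alpha>" by (auto simp: lk split: if_splits)
      then show "j \<in> (\<lambda>k. n + 1 - k) ` level c \<alpha>" by (intro image_eqI[of _ _ "n + 1 - j"]) auto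
    next
      assume "j \<in> (\<lambda>k. n + 1 - k) ` level c \<alpha>"
      then obtain k where k: "j = n + 1 - k" "k \<in> level c \<alpha>" by (rule imageE)
      then have "k \<in> {1..n}" using out[of k] by (cases "k \<in> {1..n}") auto
      then have "j \<in> {1..n}" "n + 1 - j = k" using k(1) unfolding atLeastAtMost_iff by arith+
      then show "j \<in> level c \<gamma>" using k(2) by (simp add: lk)
    qed
  qed
  have injl: "inj_on (\<lambda>k. n + 1 - k) (level c \<alpha>)" for c
  proof (rule inj_onI)
    fix x y assume "x \<in> level c \<alpha>" "y \<in> level c \<alpha>" "n + 1 - x = n + 1 - y"
    then show "x = y" using out[of x] out[of y] by (cases "x \<in> {1..n}"; cases "y \<in> {1..n}") auto
  qed
  obtain P where P: "tab P" "set (concat P) \<subseteq> {1..}" "map length P = sorted_composition \<gamma>"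
      "\<And>c. set (column_word c P) = level c \<gamma>"
    using key_tableau_exists[of \<gamma>] lk[of 0] by auto
  have sc: "sorted_composition \<gamma> = sorted_composition \<alpha>"
    by (rule sorted_composition_cong) (simp only: lev card_image[OF injl])
  have kc: "key_col c P = level c \<gamma>" for c by (rule key_col_of_columns[OF P(1,4)])
  have "comp_bound (stair n) P \<alpha>"
    unfolding comp_bound_def
  proof (intro allI impI)
    fix a b c assume ab: "stair n a < b"
    let ?L = "level c \<alpha>"
    have finL: "finite ?L" by (rule finite_key_column)
    \<comment> \<open>Since \<open>stair n a < b\<close>, reversal sends every letter
      \<open>\<ge> a\<close> below \<open>b\<close>. The two counts therefore come from disjoint
      parts of one column.\<close>
    have "(\<lambda>k. n + 1 - k) ` ?L \<inter> {b..} \<subseteq> (\<lambda>k. n + 1 - k) ` (?L - {a..})"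
    proof
      fix j assume j: "j \<in> (\<lambda>k. n + 1 - k) ` ?L \<inter> {b..}"
      then obtain k where k: "j = n + 1 - k" "k \<in> ?L" by blast
      have "\<not> a \<le> k"
      proof
        assume "a \<le> k"
        then have "n + 1 - k \<le> n + 1 - a" by simp
        then show False using ab j k(1) by (simp add: stair_def)
      qed
      then show "j \<in> (\<lambda>k. n + 1 - k) ` (?L - {a..})" using k by (intro image_eqI[of _ _ k]) simp_all
    qed
    then have "card ((\<lambda>k. n + 1 - k) ` ?L \<inter> {b..}) \<le> card ((\<lambda>k. n + 1 - k) ` (?L - {a..}))"
      using finL by (intro card_mono) simp_all
    also have "\<dots> \<le> card (?L - {a..})" using finL by (intro card_image_le) simp
    finally have "card (?L \<inter> {a..}) + card ((\<lambda>k. n + 1 - k) ` ?L \<inter> {b..}) \<le>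
        card (?L \<inter> {a..}) + card (?L - {a..})" by simp
    also have "\<dots> = card ?L"
      using finL by (metis Int_Diff_Un Int_Diff_disjoint card_Un_disjoint finite_Diff finite_Int)
    finally show "card (?L \<inter> {a..}) + card (key_col c P \<inter> {b..}) \<le> card (key_col c P)"
      by (simp only: kc lev card_image[OF injl])
  qed
  then have "P \<in> bound_tabs (stair n) \<alpha> (mset (concat P))"
    using P(1-3) sc by (simp add: bound_tabs_def)
  moreover have "size (mset (concat P)) = degree_of \<alpha>"
    using length_concat_composition[of P \<alpha>] P(3) sc by (simp only: size_mset)
  moreover have "size (filter_mset (\<lambda>z. z \<in> {n + 1 - t..}) (mset (concat P))) = psum t \<alpha>" if t: "t \<in> {1..n}" for t
  proof -
    \<comment> \<open>Exceeds the number of columns of \<open>P\<close> and every part of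
      \<open>\<alpha>\<close>, so the sums over \<open>c < K\<close> cut nothing off.\<close>
    define K where "K = length (concat P) + degree_of \<alpha>"
    have rows: "\<forall>R\<in>set P. length R \<le> K"
    proof
      fix R assume "R \<in> set P"
      then have "length R \<le> length (concat P)" by (induction P) auto
      then show "length R \<le> K" by (simp add: K_def)
    qed
    have "length (filter (\<lambda>z. z \<in> {n + 1 - t..}) (column_word c P)) =
        card {k \<in> {1..t}. c + 1 \<le> ?lk k}" for c
    proof -
      have "level c \<gamma> \<inter> {n + 1 - t..} = (\<lambda>k. n + 1 - k) ` {k \<in> {1..t}. c + 1 \<le> ?lk k}"
      proof (rule set_eqI)
        fix j
        show "j \<in> level c \<gamma> \<inter> {n + 1 - t..} \<longleftrightarrow> j \<in> (\<lambda>k. n + 1 - k) ` {k \<in> {1..t}. c + 1 \<le> ?lk k}"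
        proof
          assume "j \<in> level c \<gamma> \<inter> {n + 1 - t..}"
          then have j: "j \<in> {1..n}" "c + 1 \<le> ?lk (n + 1 - j)" "n + 1 - t \<le> j" by (auto simp: lk split: if_splits)
          then have "n + 1 - j \<in> {1..t}" using t by auto
          then show "j \<in> (\<lambda>k. n + 1 - k) ` {k \<in> {1..t}. c + 1 \<le> ?lk k}"
            using j by (intro image_eqI[of _ _ "n + 1 - j"]) auto
        next
          assume "j \<in> (\<lambda>k. n + 1 - k) ` {k \<in> {1..t}. c + 1 \<le> ?lk k}"
          then obtain k where k: "j = n + 1 - k" "k \<in> {1..t}" "c + 1 \<le> ?lk k" by blast
          have "n + 1 - j = k" "j \<in> {1..n}" "n + 1 - t \<le> j" using k(1,2) t by auto
          then show "j \<in> level c \<gamma> \<inter> {n + 1 - t..}" using k(3) by (simp add: lk)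
        qed
      qed
      moreover have "inj_on (\<lambda>k. n + 1 - k) {k \<in> {1..t}. c + 1 \<le> ?lk k}"
        using t by (auto simp: inj_on_def)
      ultimately show ?thesis
        using card_column[OF P(1), of "{n + 1 - t..}" c] by (simp only: P(4) card_image)
    qed
    then have "size (filter_mset (\<lambda>z. z \<in> {n + 1 - t..}) (mset (concat P))) =
        (\<Sum>c<K. card {k \<in> {1..t}. c + 1 \<le> ?lk k})"
      unfolding size_filter_columns[OF rows] by (intro sum.cong refl)
    also have "\<dots> = (\<Sum>k\<in>{1..t}. card {c \<in> {..<K}. c + 1 \<le> ?lk k})" by (rule sum_card_swap) simp_all
    also have "\<dots> = psum t \<alpha>"
      unfolding psum_def card_lt
    proof (rule sum.cong[OF refl])
      fix k
      have "?lk k \<le> K" using lookup_le_degree[of \<alpha> k] by (simp add: K_def)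
      then show "min K (?lk k) = ?lk k" by simp
    qed
    finally show ?thesis .
  qed
  ultimately show ?thesis by blast
qed

text \<open>For the extremal \<open>\<eta>\<close> of \<open>\<alpha>\<close>, any other composition
  with a bounded tableau has partial sums at least as large, one of them strictly larger, and its
  \<open>h\<close> vanishes by induction. The measure is the gap between the sum of the partial sums
  and its upper bound \<open>n * degree_of \<alpha>\<close>.\<close>

lemma bound_tabs_independent:
  fixes h :: "(nat \<Rightarrow>\<^sub>0 nat) \<Rightarrow> xpoly"
  assumes comb: "\<And>\<eta>. (\<Sum>\<alpha>\<in>comps n (size \<eta>). of_nat (card (bound_tabs (stair n) \<alpha> \<eta>)) * h \<alpha>) = 0"
    and keys: "Poly_Mapping.keys \<alpha> \<subseteq> {1..n}"
  shows "h \<alpha> = 0"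
  using keys
proof (induction "n * degree_of \<alpha> - (\<Sum>t\<in>{1..n}. psum t \<alpha>)" arbitrary: \<alpha> rule: less_induct)
  case less
  obtain \<eta> where \<eta>: "bound_tabs (stair n) \<alpha> \<eta> \<noteq> {}" "size \<eta> = degree_of \<alpha>"
      "\<forall>t\<in>{1..n}. size (filter_mset (\<lambda>z. z \<in> {n + 1 - t..}) \<eta>) = psum t \<alpha>"
    using bound_tabs_extremal[OF less.prems] by blast
  let ?F = "\<lambda>\<beta>. of_nat (card (bound_tabs (stair n) \<beta> \<eta>)) :: xpoly"
  have zero: "?F \<beta> * h \<beta> = 0" if b: "\<beta> \<in> comps n (size \<eta>)" "\<beta> \<noteq> \<alpha>" for \<beta>
  proof (cases "bound_tabs (stair n) \<beta> \<eta> = {}")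
    case False
    then obtain P where P: "P \<in> bound_tabs (stair n) \<beta> \<eta>" by blast
    have kb: "Poly_Mapping.keys \<beta> \<subseteq> {1..n}" "degree_of \<beta> = degree_of \<alpha>" using b(1) \<eta>(2) by (simp_all add: comps_def)
    have le: "psum t \<alpha> \<le> psum t \<beta>" if "t \<in> {1..n}" for t
      using bound_tabs_filter_le[OF P kb(1) that] \<eta>(3) that by simp
    have "\<exists>t\<in>{1..n}. psum t \<alpha> \<noteq> psum t \<beta>" using psum_inj[OF less.prems kb(1)] b(2) by blast
    then have "\<exists>t\<in>{1..n}. psum t \<alpha> < psum t \<beta>" using le by (meson le_neq_implies_less)
    then have lt: "(\<Sum>t\<in>{1..n}. psum t \<alpha>) < (\<Sum>t\<in>{1..n}. psum t \<beta>)"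
      using le by (intro sum_strict_mono_ex1) auto
    have "(\<Sum>t\<in>{1..n}. psum t \<beta>) \<le> (\<Sum>t\<in>{1..n}. degree_of \<beta>)" by (intro sum_mono psum_le_degree)
    then have "(\<Sum>t\<in>{1..n}. psum t \<beta>) \<le> n * degree_of \<alpha>" using kb(2) by simp
    then have "h \<beta> = 0" using lt kb by (intro less.hyps) auto
    then show ?thesis by simp
  qed simp
  have "\<alpha> \<in> comps n (size \<eta>)" using less.prems \<eta>(2) by (simp add: comps_def)
  then have "(\<Sum>\<beta>\<in>comps n (size \<eta>). ?F \<beta> * h \<beta>) = ?F \<alpha> * h \<alpha> + (\<Sum>\<beta>\<in>comps n (size \<eta>) - {\<alpha>}. ?F \<beta> * h \<beta>)"
    by (rule sum.remove[OF finite_comps])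
  also have "(\<Sum>\<beta>\<in>comps n (size \<eta>) - {\<alpha>}. ?F \<beta> * h \<beta>) = 0" by (rule sum.neutral) (use zero in blast)
  finally have "?F \<alpha> * h \<alpha> = 0" using comb[of \<eta>] by simp
  moreover have "?F \<alpha> \<noteq> 0" using \<eta>(1) finite_bound_tabs[of "stair n" \<alpha> \<eta>] by simp
  ultimately show ?case by simp
qed

lemma pvar_diff_nonzero: "pvar i - pvar (i + 1) \<noteq> (0 :: xpoly)"
proof
  assume "pvar i - pvar (i + 1) = (0 :: xpoly)"
  then have "Poly_Mapping.lookup (pvar i) (Poly_Mapping.single i 1) =
      Poly_Mapping.lookup (pvar (i + 1)) (Poly_Mapping.single i 1)" by simp
  moreover have "Poly_Mapping.single (i + 1) 1 \<noteq> (Poly_Mapping.single i 1 :: nat \<Rightarrow>\<^sub>0 nat)"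
  proof
    assume "Poly_Mapping.single (i + 1) 1 = (Poly_Mapping.single i 1 :: nat \<Rightarrow>\<^sub>0 nat)"
    then have "Poly_Mapping.lookup (Poly_Mapping.single (i + 1) (1 :: nat)) i =
      Poly_Mapping.lookup (Poly_Mapping.single i (1 :: nat)) i" by simp
    then show False by (simp add: lookup_single)
  qed
  ultimately show False by (simp add: pvar_def lookup_single when_def)
qed

text \<open>Independence makes the \<open>\<alpha>\<close>-factor of
  \<open>exchange_combination\<close> vanish. Subtracting
  \<open>(pvar i - pvar (i + 1)) * atom_poly \<alpha>\<close> turns this into the equation that
  defines \<open>pi_hat\<close>, whose solution is unique in an integral domain.\<close>

theorem atom_poly_pi_hat:
  assumes i: "i \<ge> 1" and gt: "Poly_Mapping.lookup \<alpha> (i + 1) < Poly_Mapping.lookup \<alpha> i"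
    and z: "Poly_Mapping.lookup \<alpha> 0 = 0"
  shows "pi_hat i (atom_poly \<alpha>) = atom_poly (swap_exponents i \<alpha>)"
proof -
  \<comment> \<open>The staircase has to include rows \<open>i\<close> and \<open>i + 1\<close> and
    the support of \<open>\<alpha>\<close>.\<close>
  define n where "n = Max (insert (i + 1) (Poly_Mapping.keys \<alpha>))"
  have n: "i + 1 \<le> n" "\<And>k. k \<in> Poly_Mapping.keys \<alpha> \<Longrightarrow> k \<le> n" by (simp_all add: n_def)
  have keys: "Poly_Mapping.keys \<alpha> \<subseteq> {1..n}"
  proof
    fix k assume k: "k \<in> Poly_Mapping.keys \<alpha>"
    then have "k \<noteq> 0" using z by (metis in_keys_iff)
    then show "k \<in> {1..n}" using n(2)[OF k] by simp
  qed
  let ?a = "atom_poly \<alpha>" and ?b = "atom_poly (swap_exponents i \<alpha>)"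
  have "pvar i * ?a - pvar (i + 1) * swap_vars i ?a - (pvar i - pvar (i + 1)) * atom_pair i \<alpha> = 0"
    by (rule bound_tabs_independent[OF exchange_combination[OF i n(1)] keys])
  then have "pvar i * ?a - pvar (i + 1) * swap_vars i ?a - (pvar i - pvar (i + 1)) * (?a + ?b) = 0"
    using gt by (simp add: atom_pair_def[OF i n(1)])
  then have eq: "(pvar i - pvar (i + 1)) * ?b = pvar (i + 1) * (?a - swap_vars i ?a)"
    by (simp add: algebra_simps)
  show ?thesis
    unfolding pi_hat_def
  proof (rule the_equality)
    show "(pvar i - pvar (i + 1)) * ?b = pvar (i + 1) * (?a - swap_vars i ?a)" by (rule eq)
  next
    fix g assume "(pvar i - pvar (i + 1)) * g = pvar (i + 1) * (?a - swap_vars i ?a)"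
    then have "(pvar i - pvar (i + 1)) * g = (pvar i - pvar (i + 1)) * ?b" using eq by simp
    then have "(pvar i - pvar (i + 1)) * (g - ?b) = 0" by (simp only: right_diff_distrib diff_self)
    then have "g - ?b = 0" using pvar_diff_nonzero[of i] by (metis mult_eq_0_iff)
    then show "g = ?b" by simp
  qed
qed

section \<open>Atoms of partitions\<close>

lemma tab_entry_ge: "tab Q \<Longrightarrow> set (concat Q) \<subseteq> {1..} \<Longrightarrow> r < length Q \<Longrightarrow> c < length (Q ! r) \<Longrightarrow> r < (Q ! r ! c :: nat)"
proof (induction r)
  case 0
  then have "Q ! 0 ! c \<in> set (concat Q)" by (auto intro!: bexI[of _ "Q ! 0"])
  then show ?case using 0 by auto
next
  case (Suc r)
  have "c < length (Q ! r) \<and> Q ! r ! c < Q ! Suc r ! c"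
    using tab_nth_column[OF Suc.prems(1), of r "Suc r" c] Suc.prems by simp
  then show ?case using Suc by simp
qed

lemma tab_entry_step:
  "r \<le> r' \<Longrightarrow> tab Q \<Longrightarrow> r' < length Q \<Longrightarrow> c < length (Q ! r') \<Longrightarrow>
    c < length (Q ! r) \<and> Q ! r ! c + (r' - r) \<le> (Q ! r' ! c :: nat)"
proof (induction r' rule: dec_induct)
  case (step k)
  have "c < length (Q ! k) \<and> Q ! k ! c < Q ! Suc k ! c"
    using tab_nth_column[OF step.prems(1), of k "Suc k" c] step.prems by simp
  moreover have "c < length (Q ! r)" "Q ! r ! c + (k - r) \<le> Q ! k ! c"
    using step.IH step.prems calculation by auto
  ultimately show ?case using step.hyps(1) by arith
qed simp

text \<open>Column strictness forces at least \<open>r + 1\<close> in row \<open>r\<close>. The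
  bottom entry of a column of height \<open>h\<close> is bounded by its key column
  \<open>{1..h}\<close>, so strictness leaves no slack anywhere in the column.\<close>

lemma key_tabs_partition_entry:
  assumes Q: "Q \<in> key_tabs \<alpha>" and lev: "\<And>c. level c \<alpha> = {1..card (level c \<alpha>)}"
    and rc: "r < length Q" "c < length (Q ! r)"
  shows "Q ! r ! c = r + 1"
proof -
  have t: "tab Q" "set (concat Q) \<subseteq> {1..}" "key_comp Q = \<alpha>" using Q by (simp_all add: key_tabs_def)
  let ?h = "card (level c \<alpha>)"
  have sh: "map length Q = sorted_composition \<alpha>" using sorted_composition_key_comp[OF t(1)] t(3) by simp
  have cell: "k < ?h \<longleftrightarrow> k < length Q \<and> c < length (Q ! k)" for k
    using partition_filter_iff[OF sorted_composition_props(1), of k c \<alpha>] card_level[of c \<alpha>]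
    unfolding sh[symmetric] by auto
  have h: "r < ?h" using cell rc by simp
  then have last: "?h - 1 < length Q" "c < length (Q ! (?h - 1))" using cell[of "?h - 1"] by simp_all
  have "Q ! (?h - 1) ! c \<le> ?h"
  proof -
    obtain k where k: "k \<in> key_col c Q" "Q ! (?h - 1) ! c \<le> k"
      using entry_le_key[OF t(1) in_tail_word[OF last]] by blast
    have "k \<in> level c \<alpha>" using k(1) unfolding key_comp[OF t(1)] t(3) .
    then have "k \<in> {1..?h}" by (subst lev[symmetric])
    then show ?thesis using k(2) by simp
  qed
  moreover have "Q ! r ! c + (?h - 1 - r) \<le> Q ! (?h - 1) ! c"
    using tab_entry_step[of r "?h - 1" Q c] t(1) last h by simp
  moreover have "r < Q ! r ! c" by (rule tab_entry_ge[OF t(1,2) rc])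
  ultimately show ?thesis using h by linarith
qed

lemma mset_monom_key_columns:
  assumes "tab T" "\<And>c. set (column_word c T) = level c \<gamma>"
  shows "mset_monom id (mset (concat T)) = \<gamma>"
proof (rule poly_mapping_eqI)
  fix k
  define K where "K = length (concat T) + degree_of \<gamma>"
  have rows: "\<forall>R\<in>set T. length R \<le> K"
  proof
    fix R assume "R \<in> set T"
    then have "length R \<le> length (concat T)" by (induction T) auto
    then show "length R \<le> K" by (simp add: K_def)
  qed
  have "Poly_Mapping.lookup (mset_monom id (mset (concat T))) k = count (mset (concat T)) k"
    using lookup_mset_monom[of id "mset (concat T)" k] by simp
  also have "\<dots> = size (filter_mset (\<lambda>z. z \<in> {k}) (mset (concat T)))"
    by (simp add: filter_eq_replicate_mset)
  also have "\<dots> = (\<Sum>c<K. length (filter (\<lambda>z. z \<in> {k}) (column_word c T)))" by (rule size_filter_columns[OF rows])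
  also have "\<dots> = (\<Sum>c<K. card {j \<in> {k}. c + 1 \<le> Poly_Mapping.lookup \<gamma> j})"
  proof (rule sum.cong[OF refl])
    fix c
    have "length (filter (\<lambda>z. z \<in> {k}) (column_word c T)) = card (level c \<gamma> \<inter> {k})"
      using card_column[OF assms(1), of "{k}" c] by (simp only: assms(2))
    also have "level c \<gamma> \<inter> {k} = {j \<in> {k}. c + 1 \<le> Poly_Mapping.lookup \<gamma> j}" by auto
    finally show "length (filter (\<lambda>z. z \<in> {k}) (column_word c T)) = card {j \<in> {k}. c + 1 \<le> Poly_Mapping.lookup \<gamma> j}" .
  qed
  also have "\<dots> = (\<Sum>j\<in>{k}. card {c \<in> {..<K}. c + 1 \<le> Poly_Mapping.lookup \<gamma> j})" by (rule sum_card_swap) simp_all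
  also have "\<dots> = Poly_Mapping.lookup \<gamma> k"
    unfolding card_lt using lookup_le_degree[of \<gamma> k] by (simp add: K_def)
  finally show "Poly_Mapping.lookup (mset_monom id (mset (concat T))) k = Poly_Mapping.lookup \<gamma> k" .
qed

lemma atom_poly_decreasing:
  assumes dec: "\<And>i. i \<ge> 1 \<Longrightarrow> Poly_Mapping.lookup \<alpha> (i + 1) \<le> Poly_Mapping.lookup \<alpha> i"
    and z: "Poly_Mapping.lookup \<alpha> 0 = 0"
  shows "atom_poly \<alpha> = Poly_Mapping.single \<alpha> 1"
proof -
  have mono: "Poly_Mapping.lookup \<alpha> j \<le> Poly_Mapping.lookup \<alpha> k" if "k \<le> j" "1 \<le> k" for j k
    using that
  proof (induction j rule: dec_induct)
    case (step j)
    then show ?case using dec[of j] by simp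
  qed simp
  have lev: "level c \<alpha> = {1..card (level c \<alpha>)}" for c
  proof (cases "level c \<alpha> = {}")
    case True
    then have "card (level c \<alpha>) = 0" by (simp only: card.empty)
    then show ?thesis using True by (simp only:) simp
  next
    case False
    define M where "M = Max (level c \<alpha>)"
    have M: "M \<in> level c \<alpha>" "\<And>k. k \<in> level c \<alpha> \<Longrightarrow> k \<le> M"
      unfolding M_def using Max_in[OF finite_key_column False] Max_ge[OF finite_key_column] by blast+
    have "level c \<alpha> = {1..M}"
    proof (rule set_eqI)
      fix k
      show "k \<in> level c \<alpha> \<longleftrightarrow> k \<in> {1..M}"
      proof
        assume k: "k \<in> level c \<alpha>"
        then have "k \<noteq> 0" using z by (cases k) auto
        then show "k \<in> {1..M}" using M(2)[OF k] by simp
      next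
        assume "k \<in> {1..M}"
        then show "k \<in> level c \<alpha>" using mono[of k M] M(1) by simp
      qed
    qed
    then show ?thesis by (simp only: card_atLeastAtMost diff_Suc_1)
  qed
  obtain T where T: "tab T" "set (concat T) \<subseteq> {1..}" "\<And>c. set (column_word c T) = level c \<alpha>"
    using key_tableau_exists[OF z] by blast
  have TK: "T \<in> key_tabs \<alpha>" using T key_comp_of_columns[OF T(1,3)] by (simp add: key_tabs_def)
  have "key_tabs \<alpha> = {T}"
  proof
    show "key_tabs \<alpha> \<subseteq> {T}"
    proof
      fix Q assume Q: "Q \<in> key_tabs \<alpha>"
      have sh: "map length Q = map length T"
        using Q TK sorted_composition_key_comp[of Q] sorted_composition_key_comp[of T] by (simp add: key_tabs_def)
      have "Q = T"
      proof (rule nth_equalityI)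
        show len: "length Q = length T" using sh by (metis length_map)
        fix r assume r: "r < length Q"
        have lr: "length (Q ! r) = length (T ! r)" using sh r len by (metis nth_map)
        show "Q ! r = T ! r"
        proof (rule nth_equalityI[OF lr])
          fix c assume "c < length (Q ! r)"
          then show "Q ! r ! c = T ! r ! c"
            using key_tabs_partition_entry[OF Q lev, of r c] key_tabs_partition_entry[OF TK lev, of r c] r len lr
            by simp
        qed
      qed
      then show "Q \<in> {T}" by simp
    qed
    show "{T} \<subseteq> key_tabs \<alpha>" using TK by simp
  qed
  then show ?thesis
    using mset_monom_key_columns[OF T(1,3)] by (simp add: atom_poly_def poly_gf_def)
qed

lemma atom_rel_eq: "atom_rel \<alpha> f \<Longrightarrow> Poly_Mapping.lookup \<alpha> 0 = 0 \<Longrightarrow> f = atom_poly \<alpha>"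
proof (induction rule: atom_rel.induct)
  case (decreasing \<alpha>)
  then show ?case using atom_poly_decreasing by simp
next
  case (ascent i \<alpha> f)
  have "Poly_Mapping.lookup (swap_exponents i \<alpha>) 0 = 0"
    using ascent by (simp add: lookup_swap_exponents Transposition.transpose_def)
  then have "f = atom_poly (swap_exponents i \<alpha>)" using ascent.IH by simp
  moreover have "pi_hat i (atom_poly (swap_exponents i \<alpha>)) = atom_poly (swap_exponents i (swap_exponents i \<alpha>))"
    using ascent \<open>Poly_Mapping.lookup (swap_exponents i \<alpha>) 0 = 0\<close>
    by (intro atom_poly_pi_hat) (simp_all add: lookup_swap_exponents)
  ultimately show ?case by simp
qed

text \<open>Exchanging an ascent moves the larger part to the smaller index and lowers the weighted
  sum of the parts, so the recursion terminates in a weakly decreasing composition.\<close>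

lemma atom_rel_exists: "Poly_Mapping.lookup \<alpha> 0 = 0 \<Longrightarrow> atom_rel \<alpha> (atom_poly \<alpha>)"
proof (induction "\<Sum>k\<in>Poly_Mapping.keys \<alpha>. k * Poly_Mapping.lookup \<alpha> k" arbitrary: \<alpha> rule: less_induct)
  case less
  show ?case
  proof (cases "\<forall>i\<ge>1. Poly_Mapping.lookup \<alpha> (i + 1) \<le> Poly_Mapping.lookup \<alpha> i")
    case True
    then show ?thesis using atom_rel.decreasing[of \<alpha>] atom_poly_decreasing[of \<alpha>] less.prems by simp
  next
    case False
    then obtain i where i: "i \<ge> 1" "Poly_Mapping.lookup \<alpha> i < Poly_Mapping.lookup \<alpha> (i + 1)" by (auto simp: not_le)
    let ?\<beta> = "swap_exponents i \<alpha>"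
    have z: "Poly_Mapping.lookup ?\<beta> 0 = 0"
      using less.prems i(1) by (simp add: lookup_swap_exponents Transposition.transpose_def)
    define A where "A = (Poly_Mapping.keys \<alpha> \<union> Poly_Mapping.keys ?\<beta>) - {i, i + 1}"
    have w: "(\<Sum>k\<in>Poly_Mapping.keys \<gamma>. k * Poly_Mapping.lookup \<gamma> k) =
        i * Poly_Mapping.lookup \<gamma> i + (i + 1) * Poly_Mapping.lookup \<gamma> (i + 1) + (\<Sum>k\<in>A. k * Poly_Mapping.lookup \<gamma> k)"
      if "\<gamma> = \<alpha> \<or> \<gamma> = ?\<beta>" for \<gamma>
    proof -
      have "(\<Sum>k\<in>Poly_Mapping.keys \<gamma>. k * Poly_Mapping.lookup \<gamma> k) =
          (\<Sum>k\<in>insert i (insert (i + 1) A). k * Poly_Mapping.lookup \<gamma> k)"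
        using that by (intro sum.mono_neutral_left) (auto simp: A_def in_keys_iff)
      then show ?thesis by (simp add: A_def)
    qed
    have "(\<Sum>k\<in>A. k * Poly_Mapping.lookup ?\<beta> k) = (\<Sum>k\<in>A. k * Poly_Mapping.lookup \<alpha> k)"
      by (rule sum.cong) (auto simp: A_def lookup_swap_exponents Transposition.transpose_def)
    moreover have "Poly_Mapping.lookup ?\<beta> i = Poly_Mapping.lookup \<alpha> (i + 1)"
      "Poly_Mapping.lookup ?\<beta> (i + 1) = Poly_Mapping.lookup \<alpha> i" by (simp_all add: lookup_swap_exponents)
    ultimately have "(\<Sum>k\<in>Poly_Mapping.keys ?\<beta>. k * Poly_Mapping.lookup ?\<beta> k) <
        (\<Sum>k\<in>Poly_Mapping.keys \<alpha>. k * Poly_Mapping.lookup \<alpha> k)"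
      unfolding w[OF disjI1[OF refl]] w[OF disjI2[OF refl]] using i(2) by simp
    then have "atom_rel ?\<beta> (atom_poly ?\<beta>)" using z by (rule less.hyps)
    then have "atom_rel \<alpha> (pi_hat i (atom_poly ?\<beta>))" by (rule atom_rel.ascent[OF i])
    moreover have "pi_hat i (atom_poly ?\<beta>) = atom_poly (swap_exponents i ?\<beta>)"
      using i z by (intro atom_poly_pi_hat) (simp_all add: lookup_swap_exponents)
    ultimately show ?thesis by simp
  qed
qed

theorem demazure_atom_eq: "Poly_Mapping.lookup \<alpha> 0 = 0 \<Longrightarrow> demazure_atom \<alpha> = atom_poly \<alpha>"
  unfolding demazure_atom_def
  by (rule the_equality) (auto intro: atom_rel_exists dest: atom_rel_eq)

section \<open>Tableau series\<close>

lemma monom_series_mset: "monom_series (mset_monom v M) = (\<Prod>k\<in>set_mset M. mvar (v k) ^ count M k)"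
proof -
  have "monom_series (mset_monom v M) = (\<Prod>k\<in>#M. mvar (v k))"
    by (induction M) (simp_all add: monom_series_0 monom_series_times[symmetric] mvar_monom)
  then show ?thesis by (simp add: image_prod_mset_multiplicity)
qed

lemma finite_fill: "finite {p. fill T p = Some a}"
proof (rule finite_subset)
  show "{p. fill T p = Some a} \<subseteq> (SIGMA r:{..<length T}. {..<length (T ! r)})"
    by (auto simp: fill_def split: if_splits)
qed simp

lemma content_fill: "content (fill T) a = count (mset (concat T)) a"
  unfolding content_def
proof (induction T)
  case Nil
  show ?case by (simp add: fill_def)
next
  case (Cons R T)
  let ?A = "{0 :: nat} \<times> {c. c < length R \<and> R ! c = a}"
  let ?B = "map_prod Suc id ` {p. fill T p = Some a}"
  have "{p. fill (R # T) p = Some a} = ?A \<union> ?B"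
  proof (intro set_eqI iffI)
    fix p assume p: "p \<in> {p. fill (R # T) p = Some a}"
    obtain r c where rc: "p = (r, c)" by (cases p)
    show "p \<in> ?A \<union> ?B"
    proof (cases r)
      case 0
      then show ?thesis using p rc by (auto simp: fill_def split: if_splits)
    next
      case (Suc k)
      then have "fill T (k, c) = Some a" using p rc by (auto simp: fill_def split: if_splits)
      then have "map_prod Suc id (k, c) \<in> ?B" by blast
      then show ?thesis using rc Suc by simp
    qed
  qed (auto simp: fill_def split: if_splits)
  moreover have "card (?A \<union> ?B) = card ?A + card ?B"
    by (rule card_Un_disjoint) (auto simp: finite_fill)
  moreover have "card ?A = count (mset R) a"
    by (simp add: card_cartesian_product count_mset count_list_eq_length_filter length_filter_conv_card
        eq_commute[of a])
  moreover have "card ?B = card {p. fill T p = Some a}"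
    by (rule card_image) (auto simp: inj_on_def)
  ultimately show ?case using Cons by simp
qed

lemma ran_fill: "ran (fill T) = set (concat T)"
proof -
  have "a \<in> ran (fill T) \<longleftrightarrow> a \<in> set (concat T)" for a
  proof -
    have "a \<in> ran (fill T) \<longleftrightarrow> {p. fill T p = Some a} \<noteq> {}" unfolding ran_def by blast
    also have "\<dots> \<longleftrightarrow> content (fill T) a \<noteq> 0"
      unfolding content_def using finite_fill[of T a] by simp
    also have "\<dots> \<longleftrightarrow> a \<in># mset (concat T)" by (simp only: content_fill count_eq_zero_iff not_not)
    finally show ?thesis by (simp only: set_mset_mset)
  qed
  then show ?thesis by blast
qed

lemma content_monomial_fill:
  "content_monomial (\<lambda>a. mvar (v a)) S (fill T) =
    (\<Prod>a\<in>set (concat T) \<inter> S. mvar (v a) ^ count (mset (concat T)) a)"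
  by (simp only: content_monomial_def ran_fill content_fill)

abbreviation x_weight :: "nat list list \<Rightarrow> (var \<Rightarrow>\<^sub>0 nat)" where
  "x_weight Q \<equiv> mset_monom X (mset (concat Q))"

abbreviation y_weight :: "letter list list \<Rightarrow> (var \<Rightarrow>\<^sub>0 nat)" where
  "y_weight P \<equiv> mset_monom Y (mset (concat P))"

lemma content_monomial_x: "content_monomial x_var UNIV (fill Q) = monom_series (x_weight Q)"
  unfolding content_monomial_fill[of X] monom_series_mset set_mset_mset Int_UNIV_right ..

lemma content_monomial_y:
  assumes "set (concat P) \<subseteq> hat_alphabet m"
  shows "content_monomial y_var ordinary_letters (fill P) * content_monomial y_var (hatted_letters m) (fill P)
    = monom_series (y_weight P)"
proof -
  let ?A = "set (concat P)" and ?f = "\<lambda>a. y_var a ^ count (mset (concat P)) a"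
  have "(\<Prod>a\<in>?A \<inter> ordinary_letters. ?f a) * (\<Prod>a\<in>?A \<inter> hatted_letters m. ?f a) =
      (\<Prod>a\<in>(?A \<inter> ordinary_letters) \<union> (?A \<inter> hatted_letters m). ?f a)"
    by (rule prod.union_disjoint[symmetric]) (auto simp: ordinary_letters_def hatted_letters_def)
  also have "(?A \<inter> ordinary_letters) \<union> (?A \<inter> hatted_letters m) = ?A"
    using assms unfolding hat_alphabet_def by blast
  finally show ?thesis
    unfolding content_monomial_fill[of Y] monom_series_mset set_mset_mset .
qed

lemma inj_var: "inj X" "inj Y"
  by (simp_all add: inj_def)

lemma fill_inj_on:
  assumes "\<And>T. T \<in> S \<Longrightarrow> map length T = \<nu>" shows "inj_on fill S"
  by (rule inj_onI, rule fill_inj) (simp_all add: assms)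

text \<open>Transfers the infinite sums over fillings to generating functions over lists of rows;
  the common shape makes \<open>fill\<close> injective.\<close>

lemma infsum_fill:
  assumes S: "\<And>T. T \<in> S \<Longrightarrow> tab T \<and> map length T = \<nu>" and z: "inj z"
    and f: "\<And>T. T \<in> S \<Longrightarrow> f (fill T) = monom_series (mset_monom z (mset (concat T)))"
  shows "(\<Sum>\<^sub>\<infinity>F\<in>fill ` S. f F) = gen_fun S (\<lambda>T. mset_monom z (mset (concat T)))"
proof -
  have "(\<Sum>\<^sub>\<infinity>F\<in>fill ` S. f F) = (\<Sum>\<^sub>\<infinity>T\<in>S. (f \<circ> fill) T)"
    using S by (intro infsum_reindex fill_inj_on) auto
  also have "\<dots> = (\<Sum>\<^sub>\<infinity>T\<in>S. monom_series (mset_monom z (mset (concat T))))"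
    by (rule infsum_cong) (simp add: f)
  also have "\<dots> = gen_fun S (\<lambda>T. mset_monom z (mset (concat T)))"
    by (rule infsum_monom_series[OF finite_fibres_tabs[OF z]]) (simp add: S)
  finally show ?thesis .
qed

lemma Tab_fill_filter:
  assumes "is_partition \<nu>"
  shows "{F \<in> Tab B \<nu>. R F} = fill ` {T. tab T \<and> map length T = \<nu> \<and> set (concat T) \<subseteq> B \<and> R (fill T)}"
  unfolding Tab_eq_fill[OF assms] by blast

definition F_tabs :: "nat \<Rightarrow> (nat \<Rightarrow>\<^sub>0 nat) \<Rightarrow> letter list list set" where
  "F_tabs m \<alpha> = {P. tab P \<and> map length P = sorted_composition \<alpha> \<and> set (concat P) \<subseteq> hat_alphabet m \<and>
     filling_le (right_key (fill P)) (B_plus_lam_comp m \<alpha>)}"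

lemma F_series_gen_fun: "F_series m \<alpha> = gen_fun (F_tabs m \<alpha>) y_weight"
  unfolding F_series_def Tab_fill_filter[OF sorted_composition_props(1)] F_tabs_def[symmetric]
  by (rule infsum_fill[OF _ inj_var(2)])
    (simp add: F_tabs_def, rule content_monomial_y, simp only: F_tabs_def mem_Collect_eq)

definition S_tabs :: "nat \<Rightarrow> mpartition \<Rightarrow> nat list list set" where
  "S_tabs m \<Lambda> = {Q. tab Q \<and> map length Q = mp_shape \<Lambda> \<and> set (concat Q) \<subseteq> {1..} \<and>
     restrict_filling (Ord ` {1..m}) (map_filling Ord (right_key (fill Q)))
       = restrict_filling (Ord ` {1..m}) (B_plus m \<Lambda>)}"

definition S_star_tabs :: "nat \<Rightarrow> mpartition \<Rightarrow> letter list list set" where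
  "S_star_tabs m \<Lambda> = {P. tab P \<and> map length P = mp_shape \<Lambda> \<and> set (concat P) \<subseteq> hat_alphabet m \<and>
     filling_le (right_key (fill P)) (B_plus_lam m \<Lambda>)}"

lemma mp_shape_partition: "is_partition (mp_shape \<Lambda>)"
  by (auto simp: mp_shape_def is_partition_def sorted_wrt_rev)

lemma m_schur_gen_fun: "m_schur m \<Lambda> = gen_fun (S_tabs m \<Lambda>) x_weight"
  unfolding m_schur_def S_set_def Tab_fill_filter[OF mp_shape_partition] S_tabs_def[symmetric]
  by (rule infsum_fill[OF _ inj_var(1)]) (auto simp: S_tabs_def content_monomial_x)

lemma dual_m_schur_gen_fun: "dual_m_schur m \<Lambda> = gen_fun (S_star_tabs m \<Lambda>) y_weight"
  unfolding dual_m_schur_def S_star_set_def Tab_fill_filter[OF mp_shape_partition] S_star_tabs_def[symmetric]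
  by (rule infsum_fill[OF _ inj_var(2)])
    (simp add: S_star_tabs_def, rule content_monomial_y, simp only: S_star_tabs_def mem_Collect_eq)

text \<open>The left side runs over monomials and the right side over tableaux. Grouping tableaux by
  monomial works because a coefficient counts its group.\<close>

lemma series_of_atom_poly: "series_of_xpoly (atom_poly \<alpha>) = gen_fun (key_tabs \<alpha>) x_weight"
proof -
  let ?K = "key_tabs \<alpha>" and ?w = "\<lambda>Q :: nat list list. mset_monom id (mset (concat Q)) :: nat \<Rightarrow>\<^sub>0 nat"
  let ?m = "\<lambda>\<mu>. \<Prod>i\<in>Poly_Mapping.keys \<mu>. x_var i ^ Poly_Mapping.lookup \<mu> i"
  have fin: "finite ?K" by (rule finite_key_tabs)
  have lk: "Poly_Mapping.lookup (atom_poly \<alpha>) \<mu> = int (card {Q \<in> ?K. ?w Q = \<mu>})" for \<mu>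
    unfolding atom_poly_def by (rule lookup_poly_gf[OF fin])
  have mw: "?m (?w Q) = monom_series (x_weight Q)" for Q
  proof -
    have l: "Poly_Mapping.lookup (?w Q) i = count (mset (concat Q)) i" for i
      using lookup_mset_monom[of id "mset (concat Q)" i] by simp
    have "Poly_Mapping.keys (?w Q) = set_mset (mset (concat Q))"
      by (rule set_eqI) (simp only: in_keys_iff l count_eq_zero_iff not_not)
    then show ?thesis by (simp only: l monom_series_mset)
  qed
  have sub: "Poly_Mapping.keys (atom_poly \<alpha>) \<subseteq> ?w ` ?K"
  proof
    fix \<mu> assume "\<mu> \<in> Poly_Mapping.keys (atom_poly \<alpha>)"
    then have "card {Q \<in> ?K. ?w Q = \<mu>} \<noteq> 0" by (simp add: in_keys_iff lk)
    then have "{Q \<in> ?K. ?w Q = \<mu>} \<noteq> {}" by (rule contrapos_nn) (simp only: card.empty)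
    then show "\<mu> \<in> ?w ` ?K" by blast
  qed
  have "series_of_xpoly (atom_poly \<alpha>) = (\<Sum>\<mu>\<in>?w ` ?K. of_int (Poly_Mapping.lookup (atom_poly \<alpha>) \<mu>) * ?m \<mu>)"
    unfolding series_of_xpoly_def
    by (rule sum.mono_neutral_left) (use fin sub in \<open>auto simp: in_keys_iff\<close>)
  also have "\<dots> = (\<Sum>\<mu>\<in>?w ` ?K. \<Sum>Q\<in>{Q \<in> ?K. ?w Q = \<mu>}. monom_series (x_weight Q))"
  proof (rule sum.cong[OF refl])
    fix \<mu>
    have "(\<Sum>Q\<in>{Q \<in> ?K. ?w Q = \<mu>}. monom_series (x_weight Q)) = (\<Sum>Q\<in>{Q \<in> ?K. ?w Q = \<mu>}. ?m \<mu>)"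
    proof (rule sum.cong[OF refl])
      fix Q assume "Q \<in> {Q \<in> ?K. ?w Q = \<mu>}"
      then have "?w Q = \<mu>" by blast
      then show "monom_series (x_weight Q) = ?m \<mu>" using mw[of Q] by (simp only:)
    qed
    then show "of_int (Poly_Mapping.lookup (atom_poly \<alpha>) \<mu>) * ?m \<mu> =
        (\<Sum>Q\<in>{Q \<in> ?K. ?w Q = \<mu>}. monom_series (x_weight Q))"
      by (simp only: sum_constant lk of_int_of_nat_eq)
  qed
  also have "\<dots> = (\<Sum>Q\<in>?K. monom_series (x_weight Q))" by (rule sum.image_gen[OF fin, symmetric])
  also have "\<dots> = (\<Sum>\<^sub>\<infinity>Q\<in>?K. monom_series (x_weight Q))" by (rule infsum_finite[OF fin, symmetric])
  also have "\<dots> = gen_fun ?K x_weight"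
    by (rule infsum_monom_series[OF finite_fibres_finite[OF fin]])
  finally show ?thesis .
qed

section \<open>The composition of an \<open>m\<close>-partition\<close>

definition mp_of :: "nat \<Rightarrow> (nat \<Rightarrow>\<^sub>0 nat) \<Rightarrow> mpartition" where
  "mp_of m \<gamma> = (map (Poly_Mapping.lookup \<gamma>) [1..<Suc m],
     rev (sorted_list_of_multiset (image_mset (Poly_Mapping.lookup \<gamma>) (mset_set (Poly_Mapping.keys \<gamma> \<inter> {m<..})))))"

lemma mp_of_mpartition: "mp_of m \<gamma> \<in> mpartitions m"
proof -
  let ?M = "image_mset (Poly_Mapping.lookup \<gamma>) (mset_set (Poly_Mapping.keys \<gamma> \<inter> {m<..}))"
  have "set (sorted_list_of_multiset ?M) = Poly_Mapping.lookup \<gamma> ` (Poly_Mapping.keys \<gamma> \<inter> {m<..})" by simp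
  then have "0 \<notin> set (sorted_list_of_multiset ?M)" by (auto simp: in_keys_iff)
  then show ?thesis by (simp add: mpartitions_def mp_of_def is_partition_def sorted_wrt_rev)
qed

lemma mp_shape_mp_of:
  assumes "Poly_Mapping.lookup \<gamma> 0 = 0" shows "mp_shape (mp_of m \<gamma>) = sorted_composition \<gamma>"
proof -
  let ?lk = "Poly_Mapping.lookup \<gamma>" and ?K = "Poly_Mapping.keys \<gamma>"
  have a: "mset (filter (\<lambda>p. p \<noteq> 0) (map ?lk [1..<Suc m])) = image_mset ?lk (mset_set (?K \<inter> {..m}))"
  proof -
    have "mset (filter (\<lambda>p. p \<noteq> 0) (map ?lk [1..<Suc m])) =
        image_mset ?lk (mset (filter (\<lambda>i. ?lk i \<noteq> 0) [1..<Suc m]))"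
      by (simp only: filter_map comp_def mset_map)
    also have "mset (filter (\<lambda>i. ?lk i \<noteq> 0) [1..<Suc m]) = mset_set (set (filter (\<lambda>i. ?lk i \<noteq> 0) [1..<Suc m]))"
      by (rule mset_set_set[symmetric]) simp
    also have "set (filter (\<lambda>i. ?lk i \<noteq> 0) [1..<Suc m]) = ?K \<inter> {..m}"
    proof (rule set_eqI)
      fix i
      show "i \<in> set (filter (\<lambda>i. ?lk i \<noteq> 0) [1..<Suc m]) \<longleftrightarrow> i \<in> ?K \<inter> {..m}"
        using assms by (cases "i = 0") (auto simp: in_keys_iff)
    qed
    finally show ?thesis .
  qed
  have b: "filter (\<lambda>p. p \<noteq> 0) (snd (mp_of m \<gamma>)) = snd (mp_of m \<gamma>)"
    using mp_of_mpartition[of m \<gamma>]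
    by (cases "mp_of m \<gamma>") (auto simp: mpartitions_def is_partition_def filter_id_conv intro: gr0I)
  have "mset (filter (\<lambda>p. p \<noteq> 0) (fst (mp_of m \<gamma>) @ snd (mp_of m \<gamma>))) =
      image_mset ?lk (mset_set (?K \<inter> {..m})) + image_mset ?lk (mset_set (?K \<inter> {m<..}))"
    unfolding filter_append mset_append b unfolding mp_of_def fst_conv snd_conv a by simp
  also have "\<dots> = image_mset ?lk (mset_set (?K \<inter> {..m}) + mset_set (?K \<inter> {m<..}))" by simp
  also have "mset_set (?K \<inter> {..m}) + mset_set (?K \<inter> {m<..}) = mset_set ((?K \<inter> {..m}) \<union> (?K \<inter> {m<..}))"
    by (rule mset_set_Union[symmetric]) auto
  also have "(?K \<inter> {..m}) \<union> (?K \<inter> {m<..}) = ?K" by auto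
  finally have "sort (filter (\<lambda>p. p \<noteq> 0) (fst (mp_of m \<gamma>) @ snd (mp_of m \<gamma>))) =
      sorted_list_of_multiset (image_mset ?lk (mset_set ?K))"
    by (metis sorted_list_of_multiset_mset)
  then show ?thesis by (simp only: mp_shape_def sorted_composition_def)
qed

lemma sorted_list_split:
  fixes A :: "nat set"
  assumes "finite A" "0 \<notin> A"
  shows "sorted_list_of_set A = sorted_list_of_set (A \<inter> {1..m}) @ sorted_list_of_set (A - {1..m})"
proof (rule sorted_distinct_set_unique)
  show "sorted (sorted_list_of_set (A \<inter> {1..m}) @ sorted_list_of_set (A - {1..m}))"
  proof -
    have "x \<le> y" if "x \<in> A \<inter> {1..m}" "y \<in> A - {1..m}" for x y
      using that assms(2) by (cases "y = 0") auto
    then show ?thesis using assms(1) by (simp add: sorted_append)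
  qed
qed (use assms in auto)

lemma restrict_columns:
  assumes "\<And>c. set (u c) \<subseteq> S" "\<And>c. set (v c) \<inter> S = {}"
  shows "restrict_filling S (filling_of_columns (\<lambda>c. u c @ v c)) = filling_of_columns u"
proof
  fix p :: "nat \<times> nat"
  obtain r c where p: "p = (r, c)" by (cases p)
  consider "r < length (u c)" | "length (u c) \<le> r" "r < length (u c @ v c)" | "length (u c @ v c) \<le> r" by fastforce
  then show "restrict_filling S (filling_of_columns (\<lambda>c. u c @ v c)) p = filling_of_columns u p"
  proof cases
    case 1
    then have "u c ! r \<in> S" using assms(1)[of c] nth_mem by blast
    then show ?thesis using 1 p by (simp add: restrict_filling_def filling_of_columns_def nth_append)
  next
    case 2
    then have "v c ! (r - length (u c)) \<in> set (v c)" by simp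
    then have "v c ! (r - length (u c)) \<notin> S" using assms(2)[of c] by blast
    then show ?thesis using 2 p by (simp add: restrict_filling_def filling_of_columns_def nth_append)
  next
    case 3
    then show ?thesis using p by (simp add: restrict_filling_def filling_of_columns_def)
  qed
qed

lemma restrict_right_key:
  assumes "tab Q" "Poly_Mapping.lookup (key_comp Q) 0 = 0"
  shows "restrict_filling (Ord ` {1..m}) (map_filling Ord (right_key (fill Q))) =
    filling_of_columns (\<lambda>c. map Ord (sorted_list_of_set (level c (key_comp Q) \<inter> {1..m})))"
proof -
  let ?L = "\<lambda>c. level c (key_comp Q)"
  have z: "0 \<notin> ?L c" for c using assms(2) by simp
  have eq: "map_filling Ord (right_key (fill Q)) =
      filling_of_columns (\<lambda>c. map Ord (sorted_list_of_set (?L c \<inter> {1..m})) @ map Ord (sorted_list_of_set (?L c - {1..m})))"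
    unfolding right_key_fill[OF assms(1)] map_filling_of_columns key_comp[OF assms(1)] map_append[symmetric]
      sorted_list_split[OF finite_key_column z, symmetric] ..
  show ?thesis unfolding eq
  proof (rule restrict_columns)
    fix c
    have f: "finite (?L c \<inter> {1..m})" "finite (?L c - {1..m})" using finite_key_column[of c "key_comp Q"] by simp_all
    show "set (map Ord (sorted_list_of_set (?L c \<inter> {1..m}))) \<subseteq> Ord ` {1..m}"
      unfolding set_map set_sorted_list_of_set[OF f(1)] by blast
    show "set (map Ord (sorted_list_of_set (?L c - {1..m}))) \<inter> Ord ` {1..m} = {}"
      unfolding set_map set_sorted_list_of_set[OF f(2)] by auto
  qed
qed

definition prescribed_level :: "nat \<Rightarrow> nat list \<times> nat list \<Rightarrow> nat \<Rightarrow> nat set" where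
  "prescribed_level m \<Lambda> c = {i \<in> {1..m}. c + 1 \<le> fst \<Lambda> ! (i - 1)}"

lemma prescribed_level_iff: "i \<in> prescribed_level m \<Lambda> c \<longleftrightarrow> i \<in> {1..m} \<and> c < fst \<Lambda> ! (i - 1)"
  unfolding prescribed_level_def mem_Collect_eq Suc_eq_plus1[symmetric] Suc_le_eq by (rule refl)

lemma prescribed_level_subset: "prescribed_level m \<Lambda> c \<subseteq> {1..m}"
  unfolding prescribed_level_def by (rule Collect_restrict)

lemma finite_prescribed_level: "finite (prescribed_level m \<Lambda> c)"
  by (rule finite_subset[OF prescribed_level_subset finite_atLeastAtMost])

lemma B_plus_columns:
  "B_plus m \<Lambda> = filling_of_columns (\<lambda>c. map Ord (sorted_list_of_set (prescribed_level m \<Lambda> c)) @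
    replicate (card {r. (r, c) \<in> diagram (mp_shape \<Lambda>)} - card (prescribed_level m \<Lambda> c)) (Hat 0))"
  unfolding B_plus_def Let_def prescribed_level_def[symmetric] length_map length_sorted_list_of_set ..

lemma restrict_B_plus:
  "restrict_filling (Ord ` {1..m}) (B_plus m \<Lambda>) =
    filling_of_columns (\<lambda>c. map Ord (sorted_list_of_set (prescribed_level m \<Lambda> c)))"
  unfolding B_plus_columns
proof (rule restrict_columns)
  fix c
  show "set (map Ord (sorted_list_of_set (prescribed_level m \<Lambda> c))) \<subseteq> Ord ` {1..m}"
    unfolding set_map set_sorted_list_of_set[OF finite_prescribed_level]
    by (rule image_mono[OF prescribed_level_subset])
  have "set (replicate k (Hat 0)) \<inter> Ord ` {1..m} = {}" for k by (cases k) auto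
  then show "set (replicate (card {r. (r, c) \<in> diagram (mp_shape \<Lambda>)} -
      card (prescribed_level m \<Lambda> c)) (Hat 0)) \<inter> Ord ` {1..m} = {}" .
qed

text \<open>In every column the letters \<open>\<le> m\<close> come first on both sides, so
  restriction leaves their positions alone. Comparing the remaining columns for all \<open>c\<close>
  amounts to comparing the first \<open>m\<close> parts.\<close>

lemma S_condition_iff:
  assumes "tab Q" "Poly_Mapping.lookup (key_comp Q) 0 = 0"
  shows "restrict_filling (Ord ` {1..m}) (map_filling Ord (right_key (fill Q))) =
      restrict_filling (Ord ` {1..m}) (B_plus m \<Lambda>) \<longleftrightarrow>
    (\<forall>i\<in>{1..m}. Poly_Mapping.lookup (key_comp Q) i = fst \<Lambda> ! (i - 1))"
proof -
  let ?lk = "Poly_Mapping.lookup (key_comp Q)"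
  let ?A = "\<lambda>c. level c (key_comp Q) \<inter> {1..m}" and ?B = "prescribed_level m \<Lambda>"
  have inj: "map Ord (sorted_list_of_set (?A c)) = map Ord (sorted_list_of_set (?B c)) \<longleftrightarrow> ?A c = ?B c" for c
  proof
    assume "map Ord (sorted_list_of_set (?A c)) = map Ord (sorted_list_of_set (?B c))"
    then have "sorted_list_of_set (?A c) = sorted_list_of_set (?B c)"
      by (rule map_injective) (simp add: inj_def)
    moreover have "finite (?A c)" by (rule finite_Int[OF disjI2]) simp
    moreover have "finite (?B c)" by (rule finite_prescribed_level)
    ultimately show "?A c = ?B c" by (rule sorted_list_of_set_inject)
  qed (simp only:)
  have "restrict_filling (Ord ` {1..m}) (map_filling Ord (right_key (fill Q))) =
      restrict_filling (Ord ` {1..m}) (B_plus m \<Lambda>) \<longleftrightarrow> (\<forall>c. ?A c = ?B c)"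
    unfolding restrict_right_key[OF assms] restrict_B_plus filling_of_columns_eq_iff
    unfolding fun_eq_iff inj by (rule refl)
  also have "\<dots> \<longleftrightarrow> (\<forall>i\<in>{1..m}. ?lk i = fst \<Lambda> ! (i - 1))"
  proof
    assume eq: "\<forall>c. ?A c = ?B c"
    show "\<forall>i\<in>{1..m}. ?lk i = fst \<Lambda> ! (i - 1)"
    proof
      fix i assume i: "i \<in> {1..m}"
      have "c < ?lk i \<longleftrightarrow> c < fst \<Lambda> ! (i - 1)" for c
      proof -
        have "?A c = ?B c" using eq by (rule spec)
        then have "i \<in> ?A c \<longleftrightarrow> i \<in> ?B c" by (simp only:)
        then show ?thesis using i by (simp add: prescribed_level_iff Suc_le_eq)
      qed
      then show "?lk i = fst \<Lambda> ! (i - 1)" by (metis linorder_neqE_nat less_irrefl)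
    qed
  next
    assume eq: "\<forall>i\<in>{1..m}. ?lk i = fst \<Lambda> ! (i - 1)"
    show "\<forall>c. ?A c = ?B c"
    proof
      fix c
      show "?A c = ?B c"
      proof (rule set_eqI)
        fix i
        show "i \<in> ?A c \<longleftrightarrow> i \<in> ?B c"
          unfolding prescribed_level_iff using eq by auto
      qed
    qed
  qed
  finally show ?thesis .
qed

text \<open>\<open>lam m\<close> sends every letter beyond \<open>m\<close> to \<open>Hat 0\<close>,
  and their number in a column is exactly the padding in \<open>B_plus\<close>. The order of the
  parts beyond \<open>m\<close> thus has no influence on the bound.\<close>

lemma B_plus_lam_mp_of:
  assumes z: "Poly_Mapping.lookup \<gamma> 0 = 0"
  shows "B_plus_lam m (mp_of m \<gamma>) = B_plus_lam_comp m \<gamma>"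
proof -
  let ?A = "\<lambda>c. level c \<gamma> \<inter> {1..m}" and ?C = "\<lambda>c. level c \<gamma> - {1..m}"
  let ?f = "\<lambda>a. case a of Ord i \<Rightarrow> lam m i | Hat h \<Rightarrow> Hat h"
  have z': "0 \<notin> level c \<gamma>" for c using z by simp
  have A: "prescribed_level m (mp_of m \<gamma>) c = ?A c" for c
  proof (rule set_eqI)
    fix i
    show "i \<in> prescribed_level m (mp_of m \<gamma>) c \<longleftrightarrow> i \<in> ?A c"
      unfolding prescribed_level_iff by (auto simp: mp_of_def simp del: upt_Suc)
  qed
  have card: "card {r. (r, c) \<in> diagram (mp_shape (mp_of m \<gamma>))} = card (level c \<gamma>)" for c
  proof -
    have "{r. (r, c) \<in> diagram (mp_shape (mp_of m \<gamma>))} = {..<card (level c \<gamma>)}"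
    proof (rule set_eqI)
      fix r
      show "r \<in> {r. (r, c) \<in> diagram (mp_shape (mp_of m \<gamma>))} \<longleftrightarrow> r \<in> {..<card (level c \<gamma>)}"
        using partition_filter_iff[OF sorted_composition_props(1), of r c \<gamma>] card_level[of c \<gamma>]
        unfolding mp_shape_mp_of[OF z] diagram_def by simp
    qed
    then show ?thesis by simp
  qed
  have col: "map ?f (map Ord (sorted_list_of_set (?A c)) @
      replicate (card (level c \<gamma>) - card (?A c)) (Hat 0)) =
      map (lam m) (sorted_list_of_set (level c \<gamma>))" for c
  proof -
    have fin: "finite (level c \<gamma>)" by (rule finite_key_column)
    have "card (level c \<gamma>) = card (?A c) + card (?C c)"
      using fin by (metis Int_Diff_Un Int_Diff_disjoint card_Un_disjoint finite_Diff finite_Int)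
    then have len: "card (level c \<gamma>) - card (?A c) = card (?C c)" by simp
    have "map (lam m) (sorted_list_of_set (?C c)) = map (\<lambda>_. Hat 0) (sorted_list_of_set (?C c))"
    proof (rule map_cong[OF refl])
      fix k assume "k \<in> set (sorted_list_of_set (?C c))"
      then have "k \<in> ?C c" using fin by simp
      then have "k \<notin> {1..m}" "k \<noteq> 0" using z'[of c] by (auto intro: gr0I)
      then show "lam m k = Hat 0" by (simp add: lam_def)
    qed
    then have "map (lam m) (sorted_list_of_set (?C c)) = replicate (card (?C c)) (Hat 0)"
      by (simp add: map_replicate_const)
    then have "map (lam m) (sorted_list_of_set (level c \<gamma>)) =
        map (lam m) (sorted_list_of_set (?A c)) @ replicate (card (?C c)) (Hat 0)"
      by (subst sorted_list_split[OF fin z', of m]) (simp only: map_append)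
    then show ?thesis unfolding len by (simp add: comp_def)
  qed
  have "B_plus_lam m (mp_of m \<gamma>) = filling_of_columns (\<lambda>c. rev (map (lam m) (sorted_list_of_set (level c \<gamma>))))"
    unfolding B_plus_lam_def B_plus_columns map_filling_of_columns reverse_filling_of_columns A card col ..
  then show ?thesis
    using key_bound_filling_columns[of "lam m" \<gamma>] by (simp only: B_plus_lam_comp_def key_bound_filling_def)
qed

lemma partition_mset_eqI: "is_partition \<mu> \<Longrightarrow> is_partition \<nu> \<Longrightarrow> mset \<mu> = mset \<nu> \<Longrightarrow> \<mu> = \<nu>"
  by (rule partition_eqI) (simp_all add: size_mset[symmetric] mset_filter del: size_mset)

text \<open>The first \<open>m\<close> parts are prescribed, and the shape then determines the
  multiset of the remaining ones, which is all that the second component records.\<close>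

lemma mp_of_unique:
  assumes L: "\<Lambda> \<in> mpartitions m" and z: "Poly_Mapping.lookup \<gamma> 0 = 0"
    and a: "\<forall>i\<in>{1..m}. Poly_Mapping.lookup \<gamma> i = fst \<Lambda> ! (i - 1)" and sh: "mp_shape \<Lambda> = sorted_composition \<gamma>"
  shows "\<Lambda> = mp_of m \<gamma>"
proof -
  have p: "is_partition (snd \<Lambda>)" "is_partition (snd (mp_of m \<gamma>))" "length (fst \<Lambda>) = m"
    using L mp_of_mpartition[of m \<gamma>] by (auto simp: mpartitions_def)
  have f: "fst \<Lambda> = fst (mp_of m \<gamma>)"
    using p(3) a by (intro nth_equalityI) (simp_all add: mp_of_def del: upt_Suc)
  have id: "filter (\<lambda>p. p \<noteq> 0) \<nu> = \<nu>" if "is_partition \<nu>" for \<nu>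
    using that by (auto simp: is_partition_def filter_id_conv intro: gr0I)
  have "sort (filter (\<lambda>p. p \<noteq> 0) (fst \<Lambda> @ snd \<Lambda>)) =
      sort (filter (\<lambda>p. p \<noteq> 0) (fst (mp_of m \<gamma>) @ snd (mp_of m \<gamma>)))"
    using sh mp_shape_mp_of[OF z, of m] unfolding mp_shape_def by (metis rev_rev_ident)
  then have "mset (filter (\<lambda>p. p \<noteq> 0) (fst \<Lambda> @ snd \<Lambda>)) =
      mset (filter (\<lambda>p. p \<noteq> 0) (fst (mp_of m \<gamma>) @ snd (mp_of m \<gamma>)))"
    by (metis mset_sort)
  then have "mset (snd \<Lambda>) = mset (snd (mp_of m \<gamma>))"
    by (simp only: filter_append mset_append f id[OF p(1)] id[OF p(2)] add_left_cancel)
  then have "snd \<Lambda> = snd (mp_of m \<gamma>)" by (rule partition_mset_eqI[OF p(1,2)])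
  then show ?thesis using f by (rule prod_eqI[rotated])
qed

lemma zero_not_key:
  assumes "tab Q" "set (concat Q) \<subseteq> {1..}" shows "Poly_Mapping.lookup (key_comp Q) 0 = 0"
proof (rule ccontr)
  assume "Poly_Mapping.lookup (key_comp Q) 0 \<noteq> 0"
  then have "0 \<in> key_col 0 Q" unfolding key_comp[OF assms(1)] by simp
  then have "0 \<in> set (concat Q)" using key_set_subset[of "tail_word 0 Q"] unfolding set_tail_word_0 by blast
  then show False using assms(2) by auto
qed

section \<open>The identity\<close>

text \<open>The last two assumptions say that the sets \<open>S i\<close> are the fibres of
  \<open>k\<close> on \<open>T\<close>.\<close>

lemma has_sum_regroup:
  assumes f: "\<And>i. i \<in> I \<Longrightarrow> f i = gen_fun (S i) w" and fin: "finite_fibres T w"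
    and T: "\<And>p. p \<in> T \<Longrightarrow> k p \<in> I \<and> p \<in> S (k p)"
    and S: "\<And>i p. i \<in> I \<Longrightarrow> p \<in> S i \<Longrightarrow> p \<in> T \<and> k p = i"
  shows "(f has_sum gen_fun T w) I"
proof -
  have bij: "bij_betw (\<lambda>p. (k p, p)) T (SIGMA i:I. S i)"
    unfolding bij_betw_def
  proof
    show "(\<lambda>p. (k p, p)) ` T = (SIGMA i:I. S i)"
    proof (intro equalityI subsetI)
      fix q assume "q \<in> (SIGMA i:I. S i)"
      then obtain i p where q: "q = (i, p)" "i \<in> I" "p \<in> S i" by auto
      then show "q \<in> (\<lambda>p. (k p, p)) ` T" using S[OF q(2,3)] by (intro image_eqI[of _ _ p]) auto
    qed (use T in auto)
  qed (simp add: inj_on_def)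
  have "((\<lambda>i. gen_fun (S i) w) has_sum gen_fun (SIGMA i:I. S i) (\<lambda>(i, p). w p)) I"
    by (rule has_sum_gen_fun_Sigma) (rule finite_fibres_bij[OF bij _ fin], simp)
  moreover have "gen_fun T w = gen_fun (SIGMA i:I. S i) (\<lambda>(i, p). w p)"
    by (rule gen_fun_bij[OF bij]) simp
  ultimately have "((\<lambda>i. gen_fun (S i) w) has_sum gen_fun T w) I" by simp
  then show ?thesis using has_sum_cong[of I f "\<lambda>i. gen_fun (S i) w"] f by simp
qed

definition pair_weight :: "nat \<times> letter \<Rightarrow> (var \<Rightarrow>\<^sub>0 nat)" where
  "pair_weight = (\<lambda>(i, j). Poly_Mapping.single (X i) 1 + Poly_Mapping.single (Y j) 1)"

lemma pair_weight_factor: "1 / (1 - x_var i * y_var j) = 1 / (1 - monom_series (pair_weight (i, j)))"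
  by (simp add: pair_weight_def mvar_monom monom_series_times)

text \<open>The injection \<open>g\<close> lets one lemma serve both infinite products:
  \<open>id\<close> for all letters and \<open>Ord\<close> for the ordinary ones.\<close>

lemma locally_finite_pairs:
  assumes "inj g" shows "locally_finite I (pair_weight \<circ> map_prod id g)"
  unfolding locally_finite_def
proof (intro conjI allI ballI)
  fix \<mu>
  have "{e \<in> I. \<exists>\<nu>. (pair_weight \<circ> map_prod id g) e + \<nu> = \<mu>} \<subseteq>
      (X -` Poly_Mapping.keys \<mu>) \<times> ((Y \<circ> g) -` Poly_Mapping.keys \<mu>)"
    by (auto simp: pair_weight_def in_keys_iff lookup_add lookup_single)
  moreover have "inj (Y \<circ> g)" using assms inj_var(2) by (rule inj_compose[rotated])
  ultimately show "finite {e \<in> I. \<exists>\<nu>. (pair_weight \<circ> map_prod id g) e + \<nu> = \<mu>}"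
    using inj_var(1) by (meson finite_SigmaI finite_keys finite_subset finite_vimageI)
next
  fix e :: "nat \<times> 'a"
  obtain i j where e: "e = (i, j)" by (cases e)
  have "Poly_Mapping.lookup (pair_weight (i, g j)) (X i) \<noteq> 0"
    by (simp add: pair_weight_def lookup_add lookup_single)
  then show "(pair_weight \<circ> map_prod id g) e \<noteq> 0" using e by auto
qed

lemma mset_series_image:
  assumes "inj_on g I" shows "mset_series (g ` I) u = mset_series I (u \<circ> g)"
proof (rule gen_fun_bij[symmetric])
  have inv: "image_mset (inv_into I g) (image_mset g A) = A" if "set_mset A \<subseteq> I" for A
  proof -
    have "image_mset (inv_into I g) (image_mset g A) = image_mset (\<lambda>x. x) A"
      unfolding multiset.map_comp by (rule image_mset_cong) (use that assms in \<open>auto simp: inv_into_f_f\<close>)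
    then show ?thesis by simp
  qed
  have inv': "image_mset g (image_mset (inv_into I g) A) = A" if "set_mset A \<subseteq> g ` I" for A
  proof -
    have "image_mset g (image_mset (inv_into I g) A) = image_mset (\<lambda>x. x) A"
      unfolding multiset.map_comp by (rule image_mset_cong) (use that in \<open>auto simp: f_inv_into_f\<close>)
    then show ?thesis by simp
  qed
  show "bij_betw (image_mset g) {A. set_mset A \<subseteq> I} {A. set_mset A \<subseteq> g ` I}"
  proof (rule bij_betw_byWitness[where f' = "image_mset (inv_into I g)"])
    show "image_mset (inv_into I g) ` {A. set_mset A \<subseteq> g ` I} \<subseteq> {A. set_mset A \<subseteq> I}"
      by (auto simp: subset_eq intro: inv_into_into)
    show "image_mset g ` {A. set_mset A \<subseteq> I} \<subseteq> {A. set_mset A \<subseteq> g ` I}"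
      by (rule image_subsetI) (simp add: image_mono)
  qed (use inv inv' in blast)+
  show "mset_weight u (image_mset g A) = mset_weight (u \<circ> g) A" for A
    by (simp add: mset_weight_def multiset.map_comp comp_def)
qed

lemma antimono_lam: "antimono (lam m)"
  by (auto simp: lam_def intro!: antimonoI)

theorem proposition59:
  fixes m :: nat
  assumes "m \<ge> 1"
  shows "\<exists>P R :: var mfps.
    has_product (\<lambda>(i, j). 1 / (1 - x_var i * y_var j))
      {(i, j). i \<ge> 1 \<and> j \<in> hat_alphabet m \<and> j \<le> lam m i} P \<and>
    has_product (\<lambda>(i, j). 1 / (1 - x_var i * y_var (Ord j))) {(i, j). i \<ge> 1 \<and> j \<ge> 1} R \<and>
    P = R * (\<Prod>(i, h) | i \<in> {1..m} \<and> h \<in> {1..m} \<and> i + h \<le> m + 1.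
               1 / (1 - x_var i * y_var (Hat h))) \<and>
    ((\<lambda>\<alpha>. series_of_xpoly (demazure_atom \<alpha>) * F_series m \<alpha>) has_sum P) weak_compositions \<and>
    ((\<lambda>\<Lambda>. m_schur m \<Lambda> * dual_m_schur m \<Lambda>) has_sum P) (mpartitions m)"
proof -
  let ?I = "{(i, j). i \<ge> 1 \<and> j \<in> hat_alphabet m \<and> j \<le> lam m i}"
  let ?O = "{(i, j). i \<ge> (1 :: nat) \<and> j \<ge> (1 :: nat)}"
  let ?H = "{(i, h). i \<in> {1..m} \<and> h \<in> {1..m} \<and> i + h \<le> m + 1}"
  define P where "P = mset_series ?I pair_weight"
  define R where "R = mset_series ?O (pair_weight \<circ> map_prod id Ord)"
  have lf: "locally_finite J pair_weight" for J
    using locally_finite_pairs[of id J] by (simp add: map_prod.id)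
  have injO: "inj Ord" "inj Hat" by (simp_all add: inj_def)
  have prodP: "has_product (\<lambda>(i, j). 1 / (1 - x_var i * y_var j)) ?I P"
  proof -
    have "(\<lambda>(i, j). 1 / (1 - x_var i * y_var j)) = (\<lambda>e. 1 / (1 - monom_series (pair_weight e)))"
      by (rule ext) (simp add: pair_weight_factor split: prod.splits)
    then show ?thesis unfolding P_def using has_product_mset_series[OF lf] by simp
  qed
  have prodR: "has_product (\<lambda>(i, j). 1 / (1 - x_var i * y_var (Ord j))) ?O R"
  proof -
    have "(\<lambda>(i, j). 1 / (1 - x_var i * y_var (Ord j))) =
        (\<lambda>e. 1 / (1 - monom_series ((pair_weight \<circ> map_prod id Ord) e)))"
      by (rule ext) (simp add: pair_weight_factor split: prod.splits)
    then show ?thesis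
      unfolding R_def using has_product_mset_series[OF locally_finite_pairs[OF injO(1)]] by simp
  qed
  have PR: "P = R * (\<Prod>(i, h)\<in>?H. 1 / (1 - x_var i * y_var (Hat h)))"
  proof -
    let ?o = "map_prod id Ord :: nat \<times> nat \<Rightarrow> _" and ?h = "map_prod id Hat :: nat \<times> nat \<Rightarrow> _"
    have inj: "inj_on ?o J" "inj_on ?h J" for J by (auto simp: inj_on_def)
    have finH: "finite ?H" by (rule finite_subset[of _ "{1..m} \<times> {1..m}"]) auto
    \<comment> \<open>Ordinary letters lie below every value of \<open>lam m\<close>. For
      \<open>h \<ge> 1\<close>, \<open>Hat h \<le> lam m i\<close> fails when \<open>i > m\<close>,
      where the bound is \<open>Hat 0\<close>, and otherwise means
      \<open>i + h \<le> m + 1\<close>.\<close>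
    have split: "?I = ?o ` ?O \<union> ?h ` ?H"
    proof (intro equalityI subsetI)
      fix e assume e: "e \<in> ?I"
      obtain i j where ij: "e = (i, j)" by (cases e)
      show "e \<in> ?o ` ?O \<union> ?h ` ?H"
      proof (cases j)
        case (Ord k)
        then have "(i, k) \<in> ?O" using e ij by (auto simp: hat_alphabet_def ordinary_letters_def hatted_letters_def)
        then have "?o (i, k) \<in> ?o ` ?O" by (rule imageI)
        then show ?thesis using ij Ord by simp
      next
        case (Hat k)
        then have "(i, k) \<in> ?H"
          using e ij by (auto simp: hat_alphabet_def ordinary_letters_def hatted_letters_def lam_def split: if_splits)
        then have "?h (i, k) \<in> ?h ` ?H" by (rule imageI)
        then show ?thesis using ij Hat by simp
      qed
    qed (auto simp: hat_alphabet_def ordinary_letters_def hatted_letters_def lam_def)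
    have "P = mset_series (?o ` ?O) pair_weight * (\<Prod>e\<in>?h ` ?H. 1 / (1 - monom_series (pair_weight e)))"
      unfolding P_def split using finH by (intro mset_series_Un lf) auto
    also have "mset_series (?o ` ?O) pair_weight = R"
      unfolding R_def by (rule mset_series_image[OF inj(1)])
    also have "(\<Prod>e\<in>?h ` ?H. 1 / (1 - monom_series (pair_weight e))) =
        (\<Prod>e\<in>?H. 1 / (1 - monom_series (pair_weight (?h e))))"
      by (subst prod.reindex[OF inj(2)]) (simp only: comp_def)
    also have "\<dots> = (\<Prod>(i, h)\<in>?H. 1 / (1 - x_var i * y_var (Hat h)))"
      by (rule prod.cong) (auto simp: pair_weight_factor)
    finally show ?thesis .
  qed
  let ?BP = "bounded_pairs (lam m) {1..} (hat_alphabet m)"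
  \<comment> \<open>The components are exchanged so that fibres become products in the order of the
    factors: the tableau with the \<open>x\<close> weight comes first.\<close>
  let ?T = "{(Q, P). (P, Q) \<in> ?BP}"
  let ?w = "\<lambda>(Q, P). x_weight Q + y_weight P"
  obtain f where f: "bij_betw f {A. set_mset A \<subseteq> region (lam m) {1..} (hat_alphabet m)} ?BP"
      "\<And>A. mset (concat (fst (f A))) = image_mset snd A" "\<And>A. mset (concat (snd (f A))) = image_mset fst A"
    using rsk_bounded[OF antimono_lam[of m], of "{1..}" "hat_alphabet m"] by blast
  have reg: "region (lam m) {1..} (hat_alphabet m) = ?I" by (auto simp: region_def)
  have bijT: "bij_betw (prod.swap \<circ> f) {A. set_mset A \<subseteq> ?I} ?T"
  proof (rule bij_betw_trans)
    show "bij_betw f {A. set_mset A \<subseteq> ?I} ?BP" using f(1) unfolding reg .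
    show "bij_betw prod.swap ?BP ?T"
      by (rule bij_betw_byWitness[where f' = prod.swap]) auto
  qed
  have wt: "?w ((prod.swap \<circ> f) A) = mset_weight pair_weight A" for A
  proof -
    have "mset_weight pair_weight A = mset_monom X (image_mset fst A) + mset_monom Y (image_mset snd A)"
      by (induction A) (simp_all add: mset_weight_def pair_weight_def case_prod_unfold ac_simps)
    then show ?thesis by (simp only: comp_def prod.swap_def case_prod_conv f(2,3))
  qed
  have PT: "P = gen_fun ?T ?w" unfolding P_def
    by (rule gen_fun_bij[where f = "prod.swap \<circ> f", OF bijT]) (rule wt)
  have finT: "finite_fibres ?T ?w"
    by (rule finite_fibres_bij[where f = "prod.swap \<circ> f", OF bijT _ finite_fibres_msets[OF lf]]) (rule wt)
  have Tprops: "tab Q \<and> tab P \<and> map length P = map length Q \<and> set (concat Q) \<subseteq> {1..} \<and>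
      set (concat P) \<subseteq> hat_alphabet m \<and> Poly_Mapping.lookup (key_comp Q) 0 = 0 \<and>
      filling_le (right_key (fill P)) (B_plus_lam_comp m (key_comp Q))" if "(Q, P) \<in> ?T" for Q P
  proof -
    have b: "tab P" "tab Q" "map length P = map length Q" "set (concat Q) \<subseteq> {1..}"
        "set (concat P) \<subseteq> hat_alphabet m" "\<forall>a b. lam m a < b \<longrightarrow> key_bound a b P Q"
      using that by (simp_all add: bounded_pairs_def)
    have "filling_le (right_key (fill P)) (key_bound_filling (lam m) (key_comp Q))"
      using right_key_le_iff[OF b(1-3) antimono_lam key_comp[OF b(2)], of m] b(6) by blast
    then show ?thesis using b zero_not_key[OF b(2,4)] by (simp add: B_plus_lam_comp_def key_bound_filling_def)
  qed
  have Tintro: "(Q, P) \<in> ?T"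
    if "tab Q" "tab P" "map length P = map length Q" "set (concat Q) \<subseteq> {1..}" "set (concat P) \<subseteq> hat_alphabet m"
      "filling_le (right_key (fill P)) (B_plus_lam_comp m (key_comp Q))" for Q P
  proof -
    have "\<forall>a b. lam m a < b \<longrightarrow> key_bound a b P Q"
      using right_key_le_iff[OF that(2,1,3) antimono_lam key_comp[OF that(1)], of m] that(6)
      unfolding B_plus_lam_comp_def key_bound_filling_def by blast
    then show ?thesis using that by (simp add: bounded_pairs_def)
  qed
  have ffx: "finite_fibres S x_weight" if "\<And>T. T \<in> S \<Longrightarrow> tab T" for S
    by (rule finite_fibres_tabs[OF inj_var(1) that])
  have ffy: "finite_fibres S y_weight" if "\<And>T. T \<in> S \<Longrightarrow> tab T" for S
    by (rule finite_fibres_tabs[OF inj_var(2) that])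
  have sum1: "((\<lambda>\<alpha>. series_of_xpoly (demazure_atom \<alpha>) * F_series m \<alpha>) has_sum P) weak_compositions"
    unfolding PT
  proof (rule has_sum_regroup[where S = "\<lambda>\<alpha>. key_tabs \<alpha> \<times> F_tabs m \<alpha>" and k = "\<lambda>(Q, P). key_comp Q", OF _ finT])
    fix \<alpha> assume "\<alpha> \<in> weak_compositions"
    then have z: "Poly_Mapping.lookup \<alpha> 0 = 0" by (simp add: weak_compositions_def)
    show "series_of_xpoly (demazure_atom \<alpha>) * F_series m \<alpha> = gen_fun (key_tabs \<alpha> \<times> F_tabs m \<alpha>) ?w"
      unfolding demazure_atom_eq[OF z] series_of_atom_poly F_series_gen_fun
      by (rule gen_fun_times[OF ffx ffy]) (simp_all add: key_tabs_def F_tabs_def)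
  next
    fix p assume p: "p \<in> ?T"
    obtain Q P' where q: "p = (Q, P')" by (cases p)
    have t: "(Q, P') \<in> ?T" using p q by simp
    show "(case p of (Q, P) \<Rightarrow> key_comp Q) \<in> weak_compositions \<and>
        p \<in> key_tabs (case p of (Q, P) \<Rightarrow> key_comp Q) \<times> F_tabs m (case p of (Q, P) \<Rightarrow> key_comp Q)"
      using Tprops[OF t] q by (simp add: weak_compositions_def key_tabs_def F_tabs_def sorted_composition_key_comp)
  next
    fix \<alpha> p assume p: "\<alpha> \<in> weak_compositions" "p \<in> key_tabs \<alpha> \<times> F_tabs m \<alpha>"
    obtain Q P' where q: "p = (Q, P')" by (cases p)
    have t: "tab Q" "set (concat Q) \<subseteq> {1..}" "key_comp Q = \<alpha>" "tab P'" "map length P' = sorted_composition \<alpha>"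
        "set (concat P') \<subseteq> hat_alphabet m" "filling_le (right_key (fill P')) (B_plus_lam_comp m \<alpha>)"
      using p(2) q by (simp_all add: key_tabs_def F_tabs_def)
    have "(Q, P') \<in> ?T"
      using t sorted_composition_key_comp[OF t(1)] by (intro Tintro) simp_all
    then show "p \<in> ?T \<and> (case p of (Q, P) \<Rightarrow> key_comp Q) = \<alpha>" using q t(3) by simp
  qed
  \<comment> \<open>Both the condition on \<open>Q\<close> and the bound on \<open>P\<close> depend
    on the key content only through its image under \<open>mp_of m\<close>. Hence the coarser
    fibres, which unite several compositions, are again products.\<close>
  have sum2: "((\<lambda>\<Lambda>. m_schur m \<Lambda> * dual_m_schur m \<Lambda>) has_sum P) (mpartitions m)"
    unfolding PT
  proof (rule has_sum_regroup[where S = "\<lambda>\<Lambda>. S_tabs m \<Lambda> \<times> S_star_tabs m \<Lambda>"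
        and k = "\<lambda>(Q, P). mp_of m (key_comp Q)", OF _ finT])
    fix \<Lambda>
    show "m_schur m \<Lambda> * dual_m_schur m \<Lambda> = gen_fun (S_tabs m \<Lambda> \<times> S_star_tabs m \<Lambda>) ?w"
      unfolding m_schur_gen_fun dual_m_schur_gen_fun
      by (rule gen_fun_times[OF ffx ffy]) (simp_all add: S_tabs_def S_star_tabs_def)
  next
    fix p assume p: "p \<in> ?T"
    obtain Q P' where q: "p = (Q, P')" by (cases p)
    have "(Q, P') \<in> ?T" using p q by simp
    note t = Tprops[OF this]
    let ?L = "mp_of m (key_comp Q)"
    have sh: "map length Q = mp_shape ?L"
      using t mp_shape_mp_of[of "key_comp Q" m] sorted_composition_key_comp[of Q] by simp
    have "\<forall>i\<in>{1..m}. Poly_Mapping.lookup (key_comp Q) i = fst ?L ! (i - 1)"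
      by (auto simp: mp_of_def simp del: upt_Suc)
    then have "Q \<in> S_tabs m ?L"
      using t sh S_condition_iff[of Q m ?L] by (simp add: S_tabs_def)
    moreover have "P' \<in> S_star_tabs m ?L"
      using t sh B_plus_lam_mp_of[of "key_comp Q" m] by (simp add: S_star_tabs_def)
    ultimately show "(case p of (Q, P) \<Rightarrow> mp_of m (key_comp Q)) \<in> mpartitions m \<and>
        p \<in> S_tabs m (case p of (Q, P) \<Rightarrow> mp_of m (key_comp Q)) \<times>
          S_star_tabs m (case p of (Q, P) \<Rightarrow> mp_of m (key_comp Q))"
      using q mp_of_mpartition by simp
  next
    fix \<Lambda> p assume p: "\<Lambda> \<in> mpartitions m" "p \<in> S_tabs m \<Lambda> \<times> S_star_tabs m \<Lambda>"
    obtain Q P' where q: "p = (Q, P')" by (cases p)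
    have tQ: "tab Q" "map length Q = mp_shape \<Lambda>" "set (concat Q) \<subseteq> {1..}"
      and rQ: "restrict_filling (Ord ` {1..m}) (map_filling Ord (right_key (fill Q))) =
        restrict_filling (Ord ` {1..m}) (B_plus m \<Lambda>)"
      and tP: "tab P'" "map length P' = mp_shape \<Lambda>" "set (concat P') \<subseteq> hat_alphabet m"
        "filling_le (right_key (fill P')) (B_plus_lam m \<Lambda>)"
      using p(2) q by (simp_all add: S_tabs_def S_star_tabs_def)
    have z: "Poly_Mapping.lookup (key_comp Q) 0 = 0" by (rule zero_not_key[OF tQ(1,3)])
    have L: "\<Lambda> = mp_of m (key_comp Q)"
      using S_condition_iff[OF tQ(1) z, of m \<Lambda>] rQ sorted_composition_key_comp[OF tQ(1)] tQ(2)
      by (intro mp_of_unique[OF p(1) z]) simp_all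
    have "B_plus_lam m \<Lambda> = B_plus_lam_comp m (key_comp Q)"
      unfolding L by (rule B_plus_lam_mp_of[OF z])
    then have "(Q, P') \<in> ?T" using tQ tP by (intro Tintro) simp_all
    then show "p \<in> ?T \<and> (case p of (Q, P) \<Rightarrow> mp_of m (key_comp Q)) = \<Lambda>" using q L by simp
  qed
  show ?thesis using prodP prodR PR sum1 sum2 by blast
qed

end
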